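(* Let $a\in\mathbb{R}$ and let $g\colon L^2\to\mathbb{R}^{p+2}$ be an isometric immersion with $\phi=\langle g,e\rangle>0$, where $e$ is a fixed vector. For any compactly supported smooth variation $g_t$ of $g$, the first variation of the energy potential is given by $$\frac{d}{dt}\Big|_{t=0}E_{a,e}(g_t)=\int_{L^2}\phi^{a-1}\langle ae^\perp-2\phi\mathcal{H}_g,\eta\rangle\,dL,$$ where $\eta\in\Gamma(N_gL)$ is the normal component of the variational vector field $\partial g_t/\partial t|_{t=0}$. Moreover, when $e$ is a unit vector, $g$ is a critical point of the energy potential for any compactly supported variation if and only if $g$ is an $a$-singular minimal surface with density vector $e$.
   Context: **Variation.** A smooth variation of $g$ is a smooth map $G\colon(-\varepsilon,\varepsilon)\times L^2\to\mathbb{R}^{p+2}$ such that each $g_t=G(t,\cdot)$ is an immersion and $g_0=g$. It is compactly supported if $g_t=g$ outside a fixed compact subset of $L^2$. **Energy potential.** The energy potential is $E_{a,e}(g_t)=\int_{L^2}\langle g_t,e\rangle^a\,dL_t$, where $dL_t$ is the volume element of the metric induced by $g_t$ and $dL=dL_0$. (If $L^2$ is non-compact, the integral is taken over a compact region containing the support of the variation.) **Singular minimal surface.** $\mathcal{H}_g$ is the mean curvature vector field of $g$ (half the trace of the second fundamental form), $N_gL$ the normal bundle, and $e^\perp$ the orthogonal projection of $e$ onto $N_gL$. For a unit vector $e$, $g$ is an $a$-singular minimal surface with density vector $e$ if $\phi=\langle g,e\rangle>0$ and $2\mathcal{H}_g=\frac a\phi e^\perp$. *)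

theory Defs
  imports "HOL-Analysis.Analysis"
begin

primrec Ck_on ::
    "nat \<Rightarrow> 'a::real_normed_vector set \<Rightarrow> ('a \<Rightarrow> 'b::real_normed_vector) \<Rightarrow> bool" where
  "Ck_on 0 S f \<longleftrightarrow> continuous_on S f"
| "Ck_on (Suc k) S f \<longleftrightarrow>
     (\<forall>x\<in>S. f differentiable (at x)) \<and>
     (\<forall>v. Ck_on k S (\<lambda>x. frechet_derivative f (at x) v))"

text \<open>Only used for open \<open>S\<close> in finite dimension; there, \<open>Ck_on k\<close> is the usual notion of
  class \<open>C\<^sup>k\<close>.\<close>
definition smooth_on :: "'a::real_normed_vector set \<Rightarrow> ('a \<Rightarrow> 'b::real_normed_vector) \<Rightarrow> bool" where
  "smooth_on S f \<longleftrightarrow> (\<forall>k. Ck_on k S f)"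


text \<open>A surface is a Hausdorff, second countable space (the universe of a type) together with a
  smooth atlas.  The atlas need not be maximal: every notion below depends only on the smooth
  structure it generates.  A chart is a pair of its domain and its coordinate map; the values of
  the coordinate map outside the domain are irrelevant.\<close>

type_synonym 'a chart = "'a set \<times> ('a \<Rightarrow> real^2)"

definition chart_inv :: "'a chart \<Rightarrow> real^2 \<Rightarrow> 'a" where
  "chart_inv c = inv_into (fst c) (snd c)"

definition chart_image :: "'a chart \<Rightarrow> (real^2) set" where
  "chart_image c = snd c ` fst c"

definition smooth_surface ::
    "'a::{t2_space,second_countable_topology} chart set \<Rightarrow> bool" where
  "smooth_surface A \<longleftrightarrow>
     (\<forall>c\<in>A. open (fst c) \<and> open (chart_image c) \<and>
        homeomorphism (fst c) (chart_image c) (snd c) (chart_inv c)) \<and>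
     (\<Union>c\<in>A. fst c) = UNIV \<and>
     (\<forall>c\<in>A. \<forall>d\<in>A. smooth_on (snd c ` (fst c \<inter> fst d)) (snd d \<circ> chart_inv c))"

text \<open>Pointwise notions are computed in this arbitrary chart around \<open>x\<close>; their values do not
  depend on the choice.\<close>
definition chart_at :: "'a chart set \<Rightarrow> 'a \<Rightarrow> 'a chart" where
  "chart_at A x = (SOME c. c \<in> A \<and> x \<in> fst c)"

definition smooth_map :: "'a chart set \<Rightarrow> ('a \<Rightarrow> 'b::real_normed_vector) \<Rightarrow> bool" where
  "smooth_map A f \<longleftrightarrow> (\<forall>c\<in>A. smooth_on (chart_image c) (f \<circ> chart_inv c))"

definition immersion :: "'a chart set \<Rightarrow> ('a \<Rightarrow> 'b::real_normed_vector) \<Rightarrow> bool" where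
  "immersion A f \<longleftrightarrow> smooth_map A f \<and>
     (\<forall>c\<in>A. \<forall>u\<in>chart_image c. inj (frechet_derivative (f \<circ> chart_inv c) (at u)))"


text \<open>A metric \<open>h\<close> is given by its Gram matrices: \<open>h c u\<close> has the entries
  \<open>\<langle>\<partial>\<^sub>i, \<partial>\<^sub>j\<rangle>\<close> with respect to the coordinate fields of the chart \<open>c\<close> at the point with
  coordinates \<open>u\<close>.\<close>

type_synonym 'a metric_coeffs = "'a chart \<Rightarrow> real^2 \<Rightarrow> real^2^2"

definition riemannian_metric :: "'a chart set \<Rightarrow> 'a metric_coeffs \<Rightarrow> bool" where
  "riemannian_metric A h \<longleftrightarrow>
     (\<forall>c\<in>A. smooth_on (chart_image c) (h c) \<and>
        (\<forall>u\<in>chart_image c. transpose (h c u) = h c u \<and>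
           (\<forall>v. v \<noteq> 0 \<longrightarrow> v \<bullet> (h c u *v v) > 0))) \<and>
     (\<forall>c\<in>A. \<forall>d\<in>A. \<forall>x\<in>fst c \<inter> fst d.
        let J = matrix (frechet_derivative (snd d \<circ> chart_inv c) (at (snd c x)))
        in h c (snd c x) = transpose J ** h d (snd d x) ** J)"

definition induced_metric :: "('a \<Rightarrow> 'b::real_inner) \<Rightarrow> 'a metric_coeffs" where
  "induced_metric f c u = (\<chi> i j.
     frechet_derivative (f \<circ> chart_inv c) (at u) (axis i 1) \<bullet>
     frechet_derivative (f \<circ> chart_inv c) (at u) (axis j 1))"

definition isometric_immersion ::
    "'a chart set \<Rightarrow> 'a metric_coeffs \<Rightarrow> ('a \<Rightarrow> 'b::real_inner) \<Rightarrow> bool" where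
  "isometric_immersion A h f \<longleftrightarrow> immersion A f \<and>
     (\<forall>c\<in>A. \<forall>u\<in>chart_image c. h c u = induced_metric f c u)"

text \<open>The Borel measure given by \<open>sqrt (det h) du\<^sub>1 du\<^sub>2\<close> in every chart.  For a Riemannian metric
  it exists by the change of variables formula, and it is unique because countably many charts
  cover the surface.\<close>
definition volume_measure ::
    "'a::topological_space chart set \<Rightarrow> 'a metric_coeffs \<Rightarrow> 'a measure" where
  "volume_measure A h = (THE M. sets M = sets borel \<and>
     (\<forall>c\<in>A. \<forall>B\<in>sets borel. B \<subseteq> fst c \<longrightarrow>
        emeasure M B =
          (\<integral>\<^sup>+ u. ennreal (sqrt (det (h c u))) * indicator (snd c ` B) u \<partial>lborel)))"


definition tangent_space ::
    "'a chart set \<Rightarrow> ('a \<Rightarrow> 'b::euclidean_space) \<Rightarrow> 'a \<Rightarrow> 'b set" where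
  "tangent_space A f x =
     (let c = chart_at A x in range (frechet_derivative (f \<circ> chart_inv c) (at (snd c x))))"

definition normal_space ::
    "'a chart set \<Rightarrow> ('a \<Rightarrow> 'b::euclidean_space) \<Rightarrow> 'a \<Rightarrow> 'b set" where
  "normal_space A f x = (tangent_space A f x)\<^sup>\<bottom>"

definition orthogonal_projection :: "'b::real_inner set \<Rightarrow> 'b \<Rightarrow> 'b" where
  "orthogonal_projection W v = (THE w. w \<in> W \<and> (\<forall>z\<in>W. orthogonal (v - w) z))"

definition normal_part ::
    "'a chart set \<Rightarrow> ('a \<Rightarrow> 'b::euclidean_space) \<Rightarrow> 'a \<Rightarrow> 'b \<Rightarrow> 'b" where
  "normal_part A f x v = orthogonal_projection (normal_space A f x) v"

text \<open>The arguments \<open>v\<close>, \<open>w\<close> are tangent vectors in the coordinates of \<open>c\<close>, extended to coordinate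
  vector fields with constant coefficients, so that by the Gauss formula the second fundamental
  form is the normal part of the second derivative.\<close>
definition second_fundamental_form ::
    "'a chart set \<Rightarrow> ('a \<Rightarrow> 'b::euclidean_space) \<Rightarrow> 'a chart \<Rightarrow> 'a \<Rightarrow> real^2 \<Rightarrow> real^2 \<Rightarrow> 'b" where
  "second_fundamental_form A f c x v w =
     normal_part A f x
       (frechet_derivative (\<lambda>u. frechet_derivative (f \<circ> chart_inv c) (at u) w) (at (snd c x)) v)"

text \<open>Half the trace, with respect to the induced metric, of the second fundamental form.\<close>
definition mean_curvature ::
    "'a chart set \<Rightarrow> ('a \<Rightarrow> 'b::euclidean_space) \<Rightarrow> 'a \<Rightarrow> 'b" where
  "mean_curvature A f x =
     (let c = chart_at A x; G' = matrix_inv (induced_metric f c (snd c x))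
      in (1/2) *\<^sub>R (\<Sum>i\<in>UNIV. \<Sum>j\<in>UNIV.
           (G' $ i $ j) *\<^sub>R second_fundamental_form A f c x (axis i 1) (axis j 1)))"


definition smooth_variation ::
    "'a chart set \<Rightarrow> ('a \<Rightarrow> 'b::euclidean_space) \<Rightarrow> real \<Rightarrow> (real \<Rightarrow> 'a \<Rightarrow> 'b) \<Rightarrow> bool" where
  "smooth_variation A g \<epsilon> G \<longleftrightarrow> 0 < \<epsilon> \<and>
     (\<forall>c\<in>A. smooth_on ({-\<epsilon><..<\<epsilon>} \<times> chart_image c) (\<lambda>(t, u). G t (chart_inv c u))) \<and>
     (\<forall>t\<in>{-\<epsilon><..<\<epsilon>}. immersion A (G t)) \<and>
     G 0 = g"

definition compact_variation ::
    "'a::topological_space chart set \<Rightarrow> ('a \<Rightarrow> 'b::euclidean_space) \<Rightarrow> real \<Rightarrow> 'a set \<Rightarrow>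
     (real \<Rightarrow> 'a \<Rightarrow> 'b) \<Rightarrow> bool" where
  "compact_variation A g \<epsilon> K G \<longleftrightarrow> smooth_variation A g \<epsilon> G \<and> compact K \<and>
     (\<forall>t\<in>{-\<epsilon><..<\<epsilon>}. \<forall>x. x \<notin> K \<longrightarrow> G t x = g x)"

definition normal_variation_field ::
    "'a chart set \<Rightarrow> (real \<Rightarrow> 'a \<Rightarrow> 'b::euclidean_space) \<Rightarrow> 'a \<Rightarrow> 'b" where
  "normal_variation_field A G x =
     normal_part A (G 0) x (vector_derivative (\<lambda>t. G t x) (at 0))"

text \<open>The energy over the region \<open>K\<close>; for a compact surface, \<open>K = UNIV\<close> gives the total energy.\<close>
definition energy_potential ::
    "'a::topological_space chart set \<Rightarrow> real \<Rightarrow> 'b::euclidean_space \<Rightarrow> 'a set \<Rightarrow> ('a \<Rightarrow> 'b) \<Rightarrow> real"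
  where
  "energy_potential A a e K f =
     (LINT x:K|volume_measure A (induced_metric f). (f x \<bullet> e) powr a)"

definition energy_critical ::
    "'a::topological_space chart set \<Rightarrow> real \<Rightarrow> 'b::euclidean_space \<Rightarrow> ('a \<Rightarrow> 'b) \<Rightarrow> bool" where
  "energy_critical A a e g \<longleftrightarrow>
     (\<forall>\<epsilon> K G. compact_variation A g \<epsilon> K G \<longrightarrow>
        ((\<lambda>t. energy_potential A a e K (G t)) has_real_derivative 0) (at 0))"

definition singular_minimal_surface ::
    "'a chart set \<Rightarrow> real \<Rightarrow> 'b::euclidean_space \<Rightarrow> ('a \<Rightarrow> 'b) \<Rightarrow> bool" where
  "singular_minimal_surface A a e g \<longleftrightarrow> immersion A g \<and> norm e = 1 \<and>
     (\<forall>x. g x \<bullet> e > 0) \<and>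
     (\<forall>x. 2 *\<^sub>R mean_curvature A g x = (a / (g x \<bullet> e)) *\<^sub>R normal_part A g x e)"

end

theory Submission
  imports Defs
begin

text \<open>
  In a chart, the energy has the density \<open>\<phi>\<^sup>a s\<close>, where \<open>s = area g\<^sub>1 g\<^sub>2\<close> is the area
  density.  As \<open>s\<close> has the gradient \<open>(P\<^sub>1, P\<^sub>2)\<close> given by the conormals, the energy varies in the
  direction \<open>Z\<close> with the density \<open>a \<phi>\<^sup>a\<^sup>-\<^sup>1 s (Z \<bullet> e) + \<phi>\<^sup>a (Z\<^sub>1 \<bullet> P\<^sub>1 + Z\<^sub>2 \<bullet> P\<^sub>2)\<close>.  Up to
  the divergence of \<open>\<phi>\<^sup>a P \<bullet> Z\<close> this is \<open>Q \<bullet> Z\<close> with the Euler--Lagrange field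
  \<open>Q = a \<phi>\<^sup>a\<^sup>-\<^sup>1 s e - \<partial>\<^sub>1(\<phi>\<^sup>a P\<^sub>1) - \<partial>\<^sub>2(\<phi>\<^sup>a P\<^sub>2)\<close>.  The field \<open>Q\<close> is orthogonal to the surface, and
  the normal part of \<open>\<partial>\<^sub>1 P\<^sub>1 + \<partial>\<^sub>2 P\<^sub>2\<close> is \<open>2 s H\<close>, so that
  \<open>Q = s \<phi>\<^sup>a\<^sup>-\<^sup>1 (a e\<^sup>\<bottom> - 2 \<phi> H)\<close>.  A partition of unity on the support of the variation
  reduces the first variation formula to fields supported in one chart.  If the energy is critical, the
  variations \<open>g + t \<rho> w\<close>, with a bump function \<open>\<rho>\<close> and a constant vector \<open>w\<close>, show that \<open>Q = 0\<close>.
\<close>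

subsection \<open>Calculus of \<open>C\<^sup>k\<close> maps\<close>

text \<open>The region \<open>K\<close> is an arbitrary compact set, so the share of the energy in
  one chart carries the indicator of \<open>K\<close> in its weight. Differentiation under the
  integral accepts any bounded measurable weight, but integration by parts does not. Hence there are
  two splittings: the energy is split by the measurable weights
  \<open>indicator K x * (b i x / S x)\<close>, differentiated and reassembled; only then is the
  variation field, which vanishes off \<open>K\<close>, split smoothly and integrated by parts chart
  by chart. Positivity of \<open>g x \<bullet> e\<close> passes to \<open>G t x \<bullet> e\<close>
  only for small \<open>t\<close> and for \<open>x\<close> in a compact set, which is why time
  intervals are shrunk. The energy is invariant under reparametrization; this is why
  \<open>Q\<close> is normal, why the full variation field can be kept until the end, and why
  constant vectors suffice as test directions. Pointwise notions use an arbitrarily chosen chart, so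
  each has to be shown independent of it, and \<open>volume_measure\<close> is a definite
  description, so existence and uniqueness have to be established for the metric induced by every
  \<open>G t\<close>.\<close>

declare Ck_on.simps(2) [simp del]

lemma Ck_on_imp_continuous: "Ck_on k S f \<Longrightarrow> continuous_on S f"
  by (cases k)
    (auto simp: Ck_on.simps(2) intro!: continuous_at_imp_continuous_on differentiable_imp_continuous_within)

lemma Ck_on_SucD:
  assumes "Ck_on (Suc k) S f" "x \<in> S"
  shows "(f has_derivative frechet_derivative f (at x)) (at x)"
  using assms frechet_derivative_works by (auto simp: Ck_on.simps(2))

lemma Ck_on_SucD': "Ck_on (Suc k) S f \<Longrightarrow> Ck_on k S (\<lambda>x. frechet_derivative f (at x) v)"
  by (simp add: Ck_on.simps(2))

text \<open>Openness of \<open>S\<close> makes agreement on \<open>S\<close> agreement near each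
  point, which is what the derivatives inside \<open>Ck_on\<close> see.\<close>

lemma Ck_on_cong:
  assumes "open S" "\<And>x. x \<in> S \<Longrightarrow> f x = g x" "Ck_on k S f"
  shows "Ck_on k S g"
  using assms(2,3)
proof (induction k arbitrary: f g)
  case 0
  then show ?case by (simp cong: continuous_on_cong)
next
  case (Suc k)
  have der: "(g has_derivative frechet_derivative f (at x)) (at x)" if "x \<in> S" for x
    using has_derivative_transform_within_open[OF Ck_on_SucD[OF Suc.prems(2) that] assms(1) that]
      Suc.prems(1) by blast
  then have eq: "frechet_derivative f (at x) = frechet_derivative g (at x)" if "x \<in> S" for x
    using frechet_derivative_at that by blast
  have "Ck_on k S (\<lambda>x. frechet_derivative g (at x) v)" for v
    by (rule Suc.IH[of "\<lambda>x. frechet_derivative f (at x) v"]) (use eq Suc.prems Ck_on_SucD' in auto)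
  then show ?case using der by (auto simp: differentiable_def Ck_on.simps(2))
qed

lemma Ck_on_SucI:
  assumes "open S" and der: "\<And>x. x \<in> S \<Longrightarrow> (f has_derivative f' x) (at x)"
    and "\<And>v. Ck_on k S (\<lambda>x. f' x v)"
  shows "Ck_on (Suc k) S f"
proof -
  have "f' x = frechet_derivative f (at x)" if "x \<in> S" for x
    using frechet_derivative_at der that by blast
  then have "Ck_on k S (\<lambda>x. frechet_derivative f (at x) v)" for v
    using Ck_on_cong[OF assms(1) _ assms(3)] by simp
  then show ?thesis using der by (auto simp: differentiable_def Ck_on.simps(2))
qed

lemma Ck_on_subset: "Ck_on k S f \<Longrightarrow> T \<subseteq> S \<Longrightarrow> Ck_on k T f"
  by (induction k arbitrary: f) (auto simp: Ck_on.simps(2) intro: continuous_on_subset)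

text \<open>Used for extension by zero: a field with compact support in an open set is glued with
  the zero function on the complement of its support.\<close>

lemma Ck_on_Un:
  "open S \<Longrightarrow> open T \<Longrightarrow> Ck_on k S f \<Longrightarrow> Ck_on k T f \<Longrightarrow> Ck_on k (S \<union> T) f"
  by (induction k arbitrary: f) (auto simp: Ck_on.simps(2) intro: continuous_on_open_Un)

lemma Ck_on_Suc_imp: "Ck_on (Suc k) S f \<Longrightarrow> Ck_on k S f"
proof (induction k arbitrary: f)
  case 0
  then show ?case using Ck_on_imp_continuous by auto
next
  case (Suc k)
  show ?case
    using Suc.prems Suc.IH by (subst Ck_on.simps(2), subst (asm) Ck_on.simps(2)) auto
qed

lemma Ck_on_const: "Ck_on k S (\<lambda>x. c)"
  by (induction k arbitrary: c) (auto simp: Ck_on.simps(2))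

lemma Ck_on_linear:
  assumes "bounded_linear f"
  shows "Ck_on k S f"
proof (cases k)
  case 0
  then show ?thesis using linear_continuous_on[OF assms] by simp
next
  case (Suc l)
  have "(f has_derivative f) (at x)" for x
    using assms bounded_linear_imp_has_derivative by blast
  then have "frechet_derivative f (at x) = f" "f differentiable (at x)" for x
    using frechet_derivative_at by (metis, auto simp: differentiable_def)
  then show ?thesis by (simp add: Suc Ck_on_const Ck_on.simps(2))
qed

lemma Ck_on_add:
  assumes "open S" "Ck_on k S f" "Ck_on k S g"
  shows "Ck_on k S (\<lambda>x. f x + g x)"
  using assms(2,3)
proof (induction k arbitrary: f g)
  case 0
  then show ?case by (simp add: continuous_on_add)
next
  case (Suc k)
  show ?case
  proof (rule Ck_on_SucI[OF assms(1)])
    show "((\<lambda>x. f x + g x) has_derivative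
        (\<lambda>v. frechet_derivative f (at x) v + frechet_derivative g (at x) v)) (at x)" if "x \<in> S" for x
      by (intro has_derivative_add Ck_on_SucD[OF Suc.prems(1) that] Ck_on_SucD[OF Suc.prems(2) that])
  qed (intro Suc.IH Ck_on_SucD' Suc.prems)
qed

lemma Ck_on_sum:
  assumes "open S" "\<And>i. i \<in> I \<Longrightarrow> Ck_on k S (f i)"
  shows "Ck_on k S (\<lambda>x. \<Sum>i\<in>I. f i x)"
  using assms(2)
  by (induction I rule: infinite_finite_induct) (auto simp: Ck_on_const intro: Ck_on_add[OF assms(1)])

lemma (in bounded_bilinear) Ck_on:
  assumes "open S" "Ck_on k S f" "Ck_on k S g"
  shows "Ck_on k S (\<lambda>x. prod (f x) (g x))"
  using assms(2,3)
proof (induction k arbitrary: f g)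
  case 0
  then show ?case by (simp add: continuous_on)
next
  case (Suc k)
  note S = Ck_on_Suc_imp[OF Suc.prems(1)] Ck_on_Suc_imp[OF Suc.prems(2)]
  show ?case
  proof (rule Ck_on_SucI[OF assms(1)])
    show "((\<lambda>x. prod (f x) (g x)) has_derivative
        (\<lambda>v. prod (f x) (frechet_derivative g (at x) v) + prod (frechet_derivative f (at x) v) (g x)))
        (at x)" if "x \<in> S" for x
      by (intro FDERIV Ck_on_SucD[OF Suc.prems(1) that] Ck_on_SucD[OF Suc.prems(2) that])
  qed (intro Ck_on_add Suc.IH S Ck_on_SucD' Suc.prems assms(1))
qed

lemmas Ck_on_mult = bounded_bilinear.Ck_on[OF bounded_bilinear_mult]
lemmas Ck_on_scaleR = bounded_bilinear.Ck_on[OF bounded_bilinear_scaleR]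
lemmas Ck_on_inner = bounded_bilinear.Ck_on[OF bounded_bilinear_inner]

lemma Ck_on_minus:
  assumes "open S" "Ck_on k S f"
  shows "Ck_on k S (\<lambda>x. - f x)"
  using Ck_on_scaleR[OF assms(1) Ck_on_const[of k S "-1"] assms(2)] by simp

lemma Ck_on_diff:
  assumes "open S" "Ck_on k S f" "Ck_on k S g"
  shows "Ck_on k S (\<lambda>x. f x - g x)"
  using Ck_on_add[OF assms(1,2) Ck_on_minus[OF assms(1,3)]] by simp

text \<open>The chain rule differentiates \<open>f\<close> in the moving direction
  \<open>?g' x v\<close>, whereas \<open>Ck_on\<close> speaks of fixed directions. Expanding the
  moving direction in \<open>Basis\<close> leaves sums of products to which the induction hypothesis
  applies.\<close>

lemma Ck_on_compose:
  fixes g :: "'a::real_normed_vector \<Rightarrow> 'b::euclidean_space"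
  assumes "open S" "open T" "Ck_on k S g" "Ck_on k T f" "g ` S \<subseteq> T"
  shows "Ck_on k S (\<lambda>x. f (g x))"
  using assms(3-5)
proof (induction k arbitrary: f g)
  case 0
  then show ?case by (auto intro: continuous_on_compose2)
next
  case (Suc k)
  let ?f' = "\<lambda>y. frechet_derivative f (at y)" and ?g' = "\<lambda>x. frechet_derivative g (at x)"
  have gS: "g x \<in> T" if "x \<in> S" for x
    using Suc.prems that by auto
  have der: "((\<lambda>x. f (g x)) has_derivative (\<lambda>v. ?f' (g x) (?g' x v))) (at x)" if "x \<in> S" for x
    using has_derivative_compose[OF Ck_on_SucD[OF Suc.prems(1) that] Ck_on_SucD[OF Suc.prems(2) gS[OF that]]]
    by simp
  have expand: "?f' (g x) (?g' x v) = (\<Sum>b\<in>Basis. (?g' x v \<bullet> b) *\<^sub>R ?f' (g x) b)" if "x \<in> S" for x v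
  proof -
    interpret linear "?f' (g x)"
      using has_derivative_linear Ck_on_SucD[OF Suc.prems(2) gS[OF that]] by blast
    have "?f' (g x) (?g' x v) = ?f' (g x) (\<Sum>b\<in>Basis. (?g' x v \<bullet> b) *\<^sub>R b)"
      by (simp add: euclidean_representation)
    then show ?thesis by (simp add: sum scale)
  qed
  have "Ck_on k S (\<lambda>x. \<Sum>b\<in>Basis. (?g' x v \<bullet> b) *\<^sub>R ?f' (g x) b)" for v
  proof (intro Ck_on_sum assms(1) Ck_on_scaleR Ck_on_inner Ck_on_const)
    show "Ck_on k S (\<lambda>x. ?f' (g x) b)" for b
      by (rule Suc.IH[OF Ck_on_Suc_imp[OF Suc.prems(1)] Ck_on_SucD'[OF Suc.prems(2)] Suc.prems(3)])
  qed (rule Ck_on_SucD'[OF Suc.prems(1)])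
  then have "Ck_on k S (\<lambda>x. ?f' (g x) (?g' x v))" for v
    using Ck_on_cong[OF assms(1)] expand by (metis (no_types, lifting))
  then show ?case
    by (intro Ck_on_SucI[OF assms(1) der]) auto
qed

lemma Ck_on_powr: "Ck_on k {0<..} (\<lambda>x::real. x powr a)"
proof (induction k arbitrary: a)
  case 0
  show ?case by (auto intro!: continuous_intros)
next
  case (Suc k)
  show ?case
  proof (rule Ck_on_SucI)
    show "((\<lambda>x. x powr a) has_derivative (\<lambda>v. (a * x powr (a - 1)) * v)) (at x)" if "x \<in> {0<..}" for x :: real
      using has_real_derivative_powr[of x a] that by (simp add: has_field_derivative_def)
  qed (auto intro!: Ck_on_mult Ck_on_const Suc)
qed

lemma Ck_on_powr':
  assumes "open S" "Ck_on k S f" "\<And>x. x \<in> S \<Longrightarrow> 0 < f x"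
  shows "Ck_on k S (\<lambda>x. f x powr (a::real))"
  using Ck_on_compose[OF assms(1) _ assms(2) Ck_on_powr] assms(3) by (auto simp: image_subset_iff)

subsection \<open>A smooth bump function\<close>

text \<open>The factor \<open>1 / x ^ n\<close> closes the family under differentiation: the
  derivative combines the members \<open>n + 2\<close> and \<open>n + 1\<close>, so smoothness of
  all members is one induction on the order.\<close>

definition exp_flat :: "nat \<Rightarrow> real \<Rightarrow> real" where
  "exp_flat n x = (if 0 < x then exp (- (1 / x)) / x ^ n else 0)"

lemma exp_flat_nonneg: "0 \<le> exp_flat n x"
  by (simp add: exp_flat_def)

text \<open>This is \<open>(1 + y / m) ^ m \<le> exp y\<close> for \<open>y = 1 / x\<close> and
  \<open>m = n + 2\<close>; two powers of \<open>x\<close> survive the division by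
  \<open>x ^ n\<close>. A quadratic bound makes the difference quotient at 0 tend to 0.\<close>

lemma exp_flat_bound:
  assumes "0 < x"
  shows "exp_flat n x \<le> real (Suc (Suc n)) ^ Suc (Suc n) * x\<^sup>2"
proof -
  let ?m = "Suc (Suc n)"
  have "(1 / (x * ?m)) ^ ?m \<le> (1 + (1 / x) / ?m) ^ ?m"
    using assms by (intro power_mono) auto
  also have "\<dots> \<le> exp (1 / x)"
    by (rule exp_ge_one_plus_x_over_n_power_n) (use assms in \<open>auto intro: order_trans[of _ 0]\<close>)
  finally have "1 / exp (1 / x) \<le> 1 / (1 / (x * ?m)) ^ ?m"
    using assms by (intro divide_left_mono) auto
  then have "exp (- (1 / x)) \<le> x ^ ?m * real ?m ^ ?m"
    by (simp add: exp_minus field_simps power_mult_distrib del: power_Suc of_nat_Suc)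
  then have "exp (- (1 / x)) / x ^ n \<le> x ^ ?m * real ?m ^ ?m / x ^ n"
    using assms by (intro divide_right_mono) auto
  also have "\<dots> = real ?m ^ ?m * x\<^sup>2"
    using assms by (simp add: field_simps power2_eq_square)
  finally show ?thesis using assms by (simp add: exp_flat_def)
qed

lemma exp_flat_deriv:
  "(exp_flat n has_real_derivative (exp_flat (n + 2) x - n * exp_flat (n + 1) x)) (at x)"
proof -
  consider "x > 0" | "x < 0" | "x = 0" by linarith
  then show ?thesis
  proof cases
    case 1
    have "((\<lambda>x. exp (- (1 / x)) / x ^ n) has_real_derivative
        exp_flat (n + 2) x - n * exp_flat (n + 1) x) (at x)"
    proof -
      have "((\<lambda>x. exp (- (1 / x))) has_real_derivative exp (- (1 / x)) / x\<^sup>2) (at x)"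
        using 1 by (auto intro!: derivative_eq_intros simp: field_simps power2_eq_square)
      from DERIV_quotient[OF this DERIV_pow[of n x UNIV]] 1
      have "((\<lambda>x. exp (- (1 / x)) / x ^ n) has_real_derivative
        (exp (- (1 / x)) / x\<^sup>2 * x ^ n - real n * x ^ (n - Suc 0) * exp (- (1 / x))) / (x ^ n)\<^sup>2) (at x)"
        by (simp add: power2_eq_square)
      moreover have "(exp (- (1 / x)) / x\<^sup>2 * x ^ n - real n * x ^ (n - Suc 0) * exp (- (1 / x))) / (x ^ n)\<^sup>2
          = exp_flat (n + 2) x - n * exp_flat (n + 1) x"
        using 1 by (cases n) (simp_all add: exp_flat_def field_simps power2_eq_square)
      ultimately show ?thesis by simp
    qed
    then show ?thesis
      by (rule has_field_derivative_transform_within[where d = x]) (use 1 in \<open>auto simp: exp_flat_def dist_real_def\<close>)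
  next
    case 2
    have "((\<lambda>x. 0) has_real_derivative exp_flat (n + 2) x - n * exp_flat (n + 1) x) (at x)"
      using 2 by (simp add: exp_flat_def)
    then show ?thesis
      by (rule has_field_derivative_transform_within[where d = "- x"]) (use 2 in \<open>auto simp: exp_flat_def dist_real_def\<close>)
  next
    case 3
    let ?C = "real (Suc (Suc n)) ^ Suc (Suc n)"
    have bound: "norm (exp_flat n h / h) \<le> ?C * \<bar>h\<bar>" for h
    proof (cases "h > 0")
      case True
      have "exp_flat n h / h \<le> ?C * h\<^sup>2 / h"
        using True exp_flat_bound by (intro divide_right_mono) auto
      then show ?thesis
        using True exp_flat_nonneg[of n h] by (simp add: power2_eq_square)
    next
      case False
      then have "norm (exp_flat n h / h) = 0" by (simp add: exp_flat_def)
      then show ?thesis by (simp only:) (intro mult_nonneg_nonneg, auto)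
    qed
    have "((\<lambda>h::real. C * \<bar>h\<bar>) \<longlongrightarrow> 0) (at 0)" for C
      by (rule tendsto_eq_intros refl | simp)+
    from Lim_null_comparison[OF always_eventually[OF allI[OF bound]] this]
    have "((\<lambda>h. exp_flat n h / h) \<longlongrightarrow> 0) (at 0)" .
    then show ?thesis
      using 3 by (simp add: DERIV_def exp_flat_def)
  qed
qed

lemma Ck_on_exp_flat: "Ck_on k UNIV (exp_flat n)"
proof (induction k arbitrary: n)
  case 0
  show ?case
    using DERIV_isCont[OF exp_flat_deriv] by (auto intro!: continuous_at_imp_continuous_on)
next
  case (Suc k)
  show ?case
  proof (rule Ck_on_SucI)
    show "(exp_flat n has_derivative (\<lambda>v. (exp_flat (n + 2) x - n * exp_flat (n + 1) x) * v)) (at x)" for x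
      using exp_flat_deriv[of n x] by (simp add: has_field_derivative_def)
  qed (intro open_UNIV Ck_on_mult Ck_on_diff Ck_on_const Suc)+
qed

text \<open>The squared distance, unlike the distance, is smooth at the centre
  \<open>p\<close>.\<close>

definition bump :: "'a::euclidean_space \<Rightarrow> real \<Rightarrow> 'a \<Rightarrow> real" where
  "bump p r x = exp_flat 0 (r\<^sup>2 - (x - p) \<bullet> (x - p))"

lemma Ck_on_bump: "Ck_on k UNIV (bump p r)"
proof -
  have id: "Ck_on k UNIV (\<lambda>x::'a. x)"
    by (rule Ck_on_linear[OF bounded_linear_ident])
  have "Ck_on k UNIV (\<lambda>x. r\<^sup>2 - (x - p) \<bullet> (x - p))"
    by (intro Ck_on_diff Ck_on_const Ck_on_inner id open_UNIV)
  then show ?thesis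
    unfolding bump_def[abs_def]
    using Ck_on_compose[OF open_UNIV open_UNIV _ Ck_on_exp_flat] by blast
qed

lemma bump_nonneg: "0 \<le> bump p r x"
  by (simp add: bump_def exp_flat_nonneg)

lemma bump_pos_iff:
  assumes "0 < r"
  shows "0 < bump p r x \<longleftrightarrow> x \<in> ball p r"
proof -
  have "(x - p) \<bullet> (x - p) < r\<^sup>2 \<longleftrightarrow> norm (x - p) < r"
    using assms real_sqrt_less_iff[of "(x - p) \<bullet> (x - p)" "r\<^sup>2"] by (simp add: norm_eq_sqrt_inner)
  then show ?thesis by (simp add: bump_def exp_flat_def dist_norm norm_minus_commute)
qed

lemma bump_eq_0:
  assumes "0 < r" "x \<notin> ball p r"
  shows "bump p r x = 0"
  using assms bump_pos_iff[of r p x] bump_nonneg[of p r x] by linarith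

subsection \<open>Symmetry of second derivatives\<close>

lemma has_derivative_along_line:
  assumes "(f has_derivative f') (at (p + r *\<^sub>R v))"
  shows "((\<lambda>r. f (p + r *\<^sub>R v)) has_vector_derivative f' v) (at r)"
proof -
  have "((\<lambda>r. p + r *\<^sub>R v) has_derivative (\<lambda>h. h *\<^sub>R v)) (at r)"
    by (auto intro!: derivative_eq_intros)
  from has_derivative_compose[OF this assms]
  have "((\<lambda>r. f (p + r *\<^sub>R v)) has_derivative (\<lambda>h. f' (h *\<^sub>R v))) (at r)" .
  then show ?thesis
    using linear_cmul[OF has_derivative_linear[OF assms]] by (simp add: has_vector_derivative_def)
qed

text \<open>The mean value theorem is applied to the increment in direction \<open>w\<close> as a
  function of the step in direction \<open>v\<close>, and then along \<open>w\<close>. The second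
  difference on the left is symmetric in \<open>v\<close> and \<open>w\<close>; Schwarz's theorem
  rests on this.\<close>

lemma second_difference:
  fixes f :: "'a::real_normed_vector \<Rightarrow> real"
  assumes S: "\<And>q r. 0 \<le> q \<Longrightarrow> q \<le> s \<Longrightarrow> 0 \<le> r \<Longrightarrow> r \<le> s \<Longrightarrow> x + r *\<^sub>R v + q *\<^sub>R w \<in> S"
    and f: "Ck_on 2 S f" and s: "0 < s"
  obtains q r where "0 < q" "q < s" "0 < r" "r < s"
    "f (x + s *\<^sub>R v + s *\<^sub>R w) - f (x + s *\<^sub>R v) - f (x + s *\<^sub>R w) + f x =
       s\<^sup>2 * frechet_derivative (\<lambda>y. frechet_derivative f (at y) v) (at (x + r *\<^sub>R v + q *\<^sub>R w)) w"
proof -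
  let ?D = "\<lambda>y. frechet_derivative f (at y) v"
  have f2: "Ck_on (Suc 1) S f" "Ck_on (Suc 0) S ?D"
    using f Ck_on_SucD'[of 1 S f v] by (simp_all add: numeral_2_eq_2)
  define \<phi> where "\<phi> r = f (x + s *\<^sub>R w + r *\<^sub>R v) - f (x + r *\<^sub>R v)" for r
  have "(\<phi> has_real_derivative (?D (x + s *\<^sub>R w + r *\<^sub>R v) - ?D (x + r *\<^sub>R v))) (at r)"
    if "0 \<le> r" "r \<le> s" for r
  proof -
    have "x + s *\<^sub>R w + r *\<^sub>R v \<in> S" "x + r *\<^sub>R v \<in> S"
      using S[of s r] S[of 0 r] that s by (auto simp: add_ac)
    then show ?thesis
      unfolding \<phi>_def has_real_derivative_iff_has_vector_derivative
      by (intro has_vector_derivative_diff has_derivative_along_line Ck_on_SucD[OF f2(1)])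
  qed
  from MVT2[OF s this] obtain r where r: "0 < r" "r < s"
    "\<phi> s - \<phi> 0 = s * (?D (x + s *\<^sub>R w + r *\<^sub>R v) - ?D (x + r *\<^sub>R v))" by auto
  have "((\<lambda>q. ?D (x + r *\<^sub>R v + q *\<^sub>R w)) has_real_derivative
     frechet_derivative ?D (at (x + r *\<^sub>R v + q *\<^sub>R w)) w) (at q)" if "0 \<le> q" "q \<le> s" for q
    unfolding has_real_derivative_iff_has_vector_derivative
    using S[of q r] that r by (intro has_derivative_along_line Ck_on_SucD[OF f2(2)]) auto
  from MVT2[OF s this] obtain q where "0 < q" "q < s"
    "?D (x + r *\<^sub>R v + s *\<^sub>R w) - ?D (x + r *\<^sub>R v) = s * frechet_derivative ?D (at (x + r *\<^sub>R v + q *\<^sub>R w)) w"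
    by auto
  moreover have "f (x + s *\<^sub>R v + s *\<^sub>R w) - f (x + s *\<^sub>R v) - f (x + s *\<^sub>R w) + f x = \<phi> s - \<phi> 0"
    by (simp add: \<phi>_def add_ac)
  moreover have "x + s *\<^sub>R w + r *\<^sub>R v = x + r *\<^sub>R v + s *\<^sub>R w"
    by simp
  ultimately show ?thesis
    using r by (intro that[of q r]) (simp_all add: power2_eq_square)
qed

text \<open>Evaluating the same second difference in both orders makes the two mixed derivatives
  agree at some pair of points in an arbitrarily small parallelogram; continuity then excludes a gap
  at \<open>x\<close>.\<close>

lemma symmetric_second_derivative_real:
  fixes f :: "'a::real_normed_vector \<Rightarrow> real"
  assumes S: "open S" "x \<in> S" and f: "Ck_on 2 S f"
  shows "frechet_derivative (\<lambda>y. frechet_derivative f (at y) v) (at x) w =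
         frechet_derivative (\<lambda>y. frechet_derivative f (at y) w) (at x) v"
    (is "?A v w x = ?A w v x")
proof (rule ccontr)
  assume neq: "?A v w x \<noteq> ?A w v x"
  define e where "e = \<bar>?A v w x - ?A w v x\<bar> / 2"
  have e: "e > 0" using neq by (simp add: e_def)
  have cont: "continuous_on S (?A v w)" for v w
    using Ck_on_SucD'[OF Ck_on_SucD'[of "Suc 0" S f v], of w] f by (simp add: numeral_2_eq_2)
  obtain d1 where d1: "d1 > 0" "\<And>y. y \<in> S \<Longrightarrow> dist y x < d1 \<Longrightarrow> dist (?A v w y) (?A v w x) < e"
    using cont[of v w] S(2) e unfolding continuous_on_iff by meson
  obtain d2 where d2: "d2 > 0" "\<And>y. y \<in> S \<Longrightarrow> dist y x < d2 \<Longrightarrow> dist (?A w v y) (?A w v x) < e"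
    using cont[of w v] S(2) e unfolding continuous_on_iff by meson
  obtain d3 where d3: "d3 > 0" "ball x d3 \<subseteq> S"
    using S open_contains_ball by blast
  define d where "d = Min {d1, d2, d3}"
  have d: "d > 0" "d \<le> d1" "d \<le> d2" "d \<le> d3" using d1 d2 d3 by (auto simp: d_def)
  \<comment> \<open>The summand 1 keeps \<open>N\<close> positive even if both vectors vanish. With
    \<open>s = d / (2 * N)\<close> the whole parallelogram lies within \<open>d / 2\<close> of
    \<open>x\<close>.\<close>
  define N where "N = norm v + norm w + 1"
  define s where "s = d / (2 * N)"
  have nn: "N > 0" unfolding N_def by (smt (verit) norm_ge_zero)
  have s: "s > 0" using d nn by (simp add: s_def)
  have near: "dist (x + r *\<^sub>R v + q *\<^sub>R w) x < d" if "0 \<le> r" "r \<le> s" "0 \<le> q" "q \<le> s" for r q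
  proof -
    have "dist (x + r *\<^sub>R v + q *\<^sub>R w) x \<le> r * norm v + q * norm w"
      using that norm_triangle_ineq[of "r *\<^sub>R v" "q *\<^sub>R w"] by (simp add: dist_norm add.assoc)
    also have "\<dots> \<le> s * norm v + s * norm w"
      using that by (intro add_mono mult_right_mono) auto
    also have "\<dots> \<le> s * N"
      using s by (simp add: algebra_simps N_def)
    also have "\<dots> = d / 2" using nn by (simp add: s_def)
    finally show ?thesis using d by linarith
  qed
  have inS: "x + r *\<^sub>R v + q *\<^sub>R w \<in> S" if "0 \<le> r" "r \<le> s" "0 \<le> q" "q \<le> s" for r q
    using near[OF that] d3 d by (auto simp: dist_commute subset_eq)
  obtain q r where qr: "0 < q" "q < s" "0 < r" "r < s"
    "f (x + s *\<^sub>R v + s *\<^sub>R w) - f (x + s *\<^sub>R v) - f (x + s *\<^sub>R w) + f x =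
       s\<^sup>2 * ?A v w (x + r *\<^sub>R v + q *\<^sub>R w)"
    by (rule second_difference[OF _ f s, of x v w]) (rule inS)
  have inS': "x + r *\<^sub>R w + q *\<^sub>R v \<in> S" if "0 \<le> r" "r \<le> s" "0 \<le> q" "q \<le> s" for r q
    using inS[of q r] that by (simp add: add_ac)
  obtain q' r' where qr': "0 < q'" "q' < s" "0 < r'" "r' < s"
    "f (x + s *\<^sub>R w + s *\<^sub>R v) - f (x + s *\<^sub>R w) - f (x + s *\<^sub>R v) + f x =
       s\<^sup>2 * ?A w v (x + r' *\<^sub>R w + q' *\<^sub>R v)"
    by (rule second_difference[OF _ f s, of x w v]) (rule inS')
  have "f (x + s *\<^sub>R w + s *\<^sub>R v) = f (x + s *\<^sub>R v + s *\<^sub>R w)"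
    by (simp add: add_ac)
  then have "s\<^sup>2 * ?A v w (x + r *\<^sub>R v + q *\<^sub>R w) = s\<^sup>2 * ?A w v (x + r' *\<^sub>R w + q' *\<^sub>R v)"
    using qr(5) qr'(5) by linarith
  then have "?A v w (x + r *\<^sub>R v + q *\<^sub>R w) = ?A w v (x + r' *\<^sub>R w + q' *\<^sub>R v)"
    using s by simp
  moreover have "dist (?A v w (x + r *\<^sub>R v + q *\<^sub>R w)) (?A v w x) < e"
    using qr near[of r q] inS[of r q] d by (intro d1(2)) auto
  moreover have "dist (?A w v (x + r' *\<^sub>R w + q' *\<^sub>R v)) (?A w v x) < e"
    using qr' near[of q' r'] inS[of q' r'] d by (intro d2(2)) (auto simp: add_ac)
  ultimately have "\<bar>?A v w x - ?A w v x\<bar> < 2 * e"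
    by (simp add: dist_real_def)
  then show False by (simp add: e_def)
qed

lemma frechet_derivative_inner:
  assumes "f differentiable (at x)"
  shows "frechet_derivative (\<lambda>y. f y \<bullet> b) (at x) v = frechet_derivative f (at x) v \<bullet> b"
proof -
  have "((\<lambda>y. f y \<bullet> b) has_derivative (\<lambda>v. frechet_derivative f (at x) v \<bullet> b)) (at x)"
    using assms by (intro has_derivative_inner_left) (simp add: frechet_derivative_works)
  from frechet_derivative_at[OF this] show ?thesis by metis
qed

lemma frechet_derivative_cong_open:
  assumes "open S" "x \<in> S" "\<And>y. y \<in> S \<Longrightarrow> f y = g y"
  shows "frechet_derivative f (at x) = frechet_derivative g (at x)"
proof -
  have "(f has_derivative D) (at x) \<longleftrightarrow> (g has_derivative D) (at x)" for D
    by (auto intro: has_derivative_transform_within_open[OF _ assms(1,2)] simp: assms(3))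
  then show ?thesis by (simp add: frechet_derivative_def)
qed

text \<open>Taking the inner product with an arbitrary \<open>b\<close> reduces the claim to real
  functions, for which the mean value theorem is available.\<close>

lemma symmetric_second_derivative:
  fixes f :: "'a::real_normed_vector \<Rightarrow> 'b::real_inner"
  assumes S: "open S" "x \<in> S" and f: "Ck_on 2 S f"
  shows "frechet_derivative (\<lambda>y. frechet_derivative f (at y) v) (at x) w =
         frechet_derivative (\<lambda>y. frechet_derivative f (at y) w) (at x) v"
    (is "?A v w = ?A w v")
proof -
  have f2: "Ck_on (Suc 1) S f" "Ck_on (Suc 0) S (\<lambda>y. frechet_derivative f (at y) v)" for v
    using f Ck_on_SucD'[of 1 S f v] by (simp_all add: numeral_2_eq_2)
  have d1: "f differentiable (at y)" if "y \<in> S" for y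
    using f2(1) that by (simp add: Ck_on.simps(2))
  have d2: "(\<lambda>y. frechet_derivative f (at y) v) differentiable (at x)" for v
    using f2(2) S by (simp add: Ck_on.simps(2))
  have "?A v w \<bullet> b = ?A w v \<bullet> b" for b
  proof -
    have eq: "frechet_derivative (\<lambda>y. frechet_derivative (\<lambda>y. f y \<bullet> b) (at y) v) (at x) w = ?A v w \<bullet> b" for v w
    proof -
      have "frechet_derivative (\<lambda>y. frechet_derivative (\<lambda>y. f y \<bullet> b) (at y) v) (at x) =
            frechet_derivative (\<lambda>y. frechet_derivative f (at y) v \<bullet> b) (at x)"
        by (rule frechet_derivative_cong_open[OF S]) (simp add: frechet_derivative_inner d1)
      then show ?thesis by (simp add: frechet_derivative_inner d2)
    qed
    have "Ck_on 2 S (\<lambda>y. f y \<bullet> b)"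
      by (intro Ck_on_inner S f Ck_on_const)
    from symmetric_second_derivative_real[OF S this, of v w] show ?thesis
      unfolding eq .
  qed
  then show ?thesis using vector_eq_rdot[of "?A v w" "?A w v"] by blast
qed

subsection \<open>Differentiation under the integral sign\<close>

text \<open>Dominated convergence along sequences: the mean value inequality bounds the difference
  quotients by \<open>w\<close>, and \<open>F' 0\<close> is measurable as their pointwise
  limit.\<close>

lemma has_real_derivative_integral:
  fixes F :: "real \<Rightarrow> 'a \<Rightarrow> real"
  assumes "0 < \<delta>"
    and int: "\<And>t. \<bar>t\<bar> < \<delta> \<Longrightarrow> integrable M (F t)"
    and der: "\<And>t x. \<bar>t\<bar> < \<delta> \<Longrightarrow> x \<in> space M \<Longrightarrow> ((\<lambda>t. F t x) has_real_derivative F' t x) (at t)"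
    and bound: "\<And>t x. \<bar>t\<bar> < \<delta> \<Longrightarrow> x \<in> space M \<Longrightarrow> \<bar>F' t x\<bar> \<le> w x"
    and w: "integrable M w"
  shows "((\<lambda>t. integral\<^sup>L M (F t)) has_real_derivative integral\<^sup>L M (F' 0)) (at 0)"
proof -
  let ?q = "\<lambda>t x. (F t x - F 0 x) / t"
  have lip: "\<bar>?q t x\<bar> \<le> w x" if "\<bar>t\<bar> < \<delta>" "x \<in> space M" for t x
  proof -
    have mem: "t \<in> {-\<delta><..<\<delta>}" "0 \<in> {-\<delta><..<\<delta>}"
      using that(1) assms(1) by auto
    have d: "((\<lambda>t. F t x) has_field_derivative F' t x) (at t within {-\<delta><..<\<delta>})"
      "norm (F' t x) \<le> w x" if "t \<in> {-\<delta><..<\<delta>}" for t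
    proof -
      have t: "\<bar>t\<bar> < \<delta>" using that by auto
      show "((\<lambda>t. F t x) has_field_derivative F' t x) (at t within {-\<delta><..<\<delta>})"
        by (rule has_field_derivative_at_within[OF der[OF t \<open>x \<in> space M\<close>]])
      show "norm (F' t x) \<le> w x"
        using bound[OF t \<open>x \<in> space M\<close>] by (simp only: real_norm_def)
    qed
    have "norm (F t x - F 0 x) \<le> w x * norm (t - 0)"
      by (rule field_differentiable_bound[OF convex_real_interval(8) d mem])
    then have "\<bar>F t x - F 0 x\<bar> \<le> w x * \<bar>t\<bar>"
      by (simp only: real_norm_def diff_zero)
    moreover have "0 \<le> w x"
      using bound[OF that] abs_ge_zero order_trans by blast
    ultimately show ?thesis
      using pos_divide_le_eq[of "\<bar>t\<bar>" "\<bar>F t x - F 0 x\<bar>" "w x"]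
      by (cases "t = 0") (simp_all only: abs_divide zero_less_abs_iff, simp_all)
  qed
  have seq: "(\<lambda>n. integral\<^sup>L M (?q (X n))) \<longlonglongrightarrow> integral\<^sup>L M (F' 0)"
    if X: "\<And>n. \<bar>X n\<bar> < \<delta>" "\<And>n. X n \<noteq> 0" "X \<longlonglongrightarrow> 0" for X :: "nat \<Rightarrow> real"
  proof -
    have lim: "(\<lambda>n. ?q (X n) x) \<longlonglongrightarrow> F' 0 x" if "x \<in> space M" for x
    proof -
      have "((\<lambda>t. ?q t x) \<longlongrightarrow> F' 0 x) (at 0)"
        using der[of 0 x] that assms(1) by (simp add: DERIV_def)
      then show ?thesis
        using X(2,3) unfolding tendsto_at_iff_sequentially o_def by blast
    qed
    have meas: "?q (X n) \<in> borel_measurable M" for n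
      using int[OF X(1), of n] int[of 0] assms(1)
      by (intro borel_measurable_divide borel_measurable_diff borel_measurable_integrable) auto
    show ?thesis
    proof (rule integral_dominated_convergence[where w = w])
      show "F' 0 \<in> borel_measurable M"
        by (rule borel_measurable_LIMSEQ_metric[OF meas lim])
      show "AE x in M. norm (?q (X n) x) \<le> w x" for n
        using lip[OF X(1)] by simp
    qed (simp_all add: meas lim w)
  qed
  have "((\<lambda>t. (integral\<^sup>L M (F t) - integral\<^sup>L M (F 0)) / t) \<longlongrightarrow> integral\<^sup>L M (F' 0)) (at 0)"
  proof (subst tendsto_at_iff_sequentially, intro allI impI)
    fix X :: "nat \<Rightarrow> real"
    assume X: "\<forall>i. X i \<in> UNIV - {0}" "X \<longlonglongrightarrow> 0"
    \<comment> \<open>The sequence is within \<open>\<delta>\<close> of 0 only eventually, so its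
      first \<open>N\<close> terms are cut off.\<close>
    then obtain N where N: "\<And>n. n \<ge> N \<Longrightarrow> \<bar>X n\<bar> < \<delta>"
      using LIMSEQ_D[OF X(2) assms(1)] by (metis diff_zero real_norm_def)
    have "(\<lambda>n. integral\<^sup>L M (?q (X (n + N)))) \<longlonglongrightarrow> integral\<^sup>L M (F' 0)"
      using N X(1) by (intro seq LIMSEQ_ignore_initial_segment[OF X(2)]) simp_all
    moreover have "integral\<^sup>L M (?q (X (n + N))) =
        (integral\<^sup>L M (F (X (n + N))) - integral\<^sup>L M (F 0)) / X (n + N)" for n
      using Bochner_Integration.integral_diff[OF int[OF N[of "n + N"]] int[of 0]] assms(1) by simp
    ultimately have "(\<lambda>n. (integral\<^sup>L M (F (X (n + N))) - integral\<^sup>L M (F 0)) / X (n + N)) \<longlonglongrightarrow> integral\<^sup>L M (F' 0)"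
      by (simp only:)
    then show "((\<lambda>t. (integral\<^sup>L M (F t) - integral\<^sup>L M (F 0)) / t) \<circ> X) \<longlonglongrightarrow> integral\<^sup>L M (F' 0)"
      using LIMSEQ_offset[of "\<lambda>n. (integral\<^sup>L M (F (X n)) - integral\<^sup>L M (F 0)) / X n" N]
      by (simp add: o_def)
  qed
  then show ?thesis by (simp add: DERIV_def)
qed

lemma integrable_compact_support:
  fixes f :: "'a::euclidean_space \<Rightarrow> real"
  assumes "compact C" "continuous_on C f" "\<And>x. x \<notin> C \<Longrightarrow> f x = 0"
  shows "integrable lborel f"
proof -
  have "f = (\<lambda>x. indicator C x *\<^sub>R f x)"
    using assms(3) by (fastforce simp: indicator_def)
  then show ?thesis using borel_integrable_compact[OF assms(1,2)] by simp
qed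

text \<open>The weight is merely measurable because it will contain the indicator of the region of
  integration. Since it vanishes off \<open>C\<close>, only the values of \<open>f\<close> on
  \<open>C\<close> enter.\<close>

lemma integrable_weight:
  fixes f m :: "'a::euclidean_space \<Rightarrow> real"
  assumes "compact C" "continuous_on C f" and m: "m \<in> borel_measurable borel" "\<And>u. \<bar>m u\<bar> \<le> 1"
    and 0: "\<And>u. u \<notin> C \<Longrightarrow> m u = 0"
  shows "integrable lborel (\<lambda>u. m u * f u)"
proof -
  have I: "integrable lborel (\<lambda>u. indicator C u *\<^sub>R f u)"
    by (rule borel_integrable_compact[OF assms(1,2)])
  have eq: "m u * f u = m u * (indicator C u *\<^sub>R f u)" for u
    using 0 by (cases "u \<in> C") auto
  show ?thesis
  proof (rule Bochner_Integration.integrable_bound[OF I])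
    show "(\<lambda>u. m u * f u) \<in> borel_measurable lborel"
      unfolding eq using m(1) borel_measurable_integrable[OF I] by (intro borel_measurable_times) simp_all
    show "AE u in lborel. norm (m u * f u) \<le> norm (indicator C u *\<^sub>R f u)"
      unfolding eq using m(2) by (intro AE_I2) (auto simp: abs_mult intro: mult_left_le_one_le)
  qed
qed

text \<open>The integral of a compactly supported function is invariant under translations, so its
  derivative along a line of translations vanishes.\<close>
lemma integral_directional_derivative_eq_0:
  fixes f :: "'a::euclidean_space \<Rightarrow> real"
  assumes der: "\<And>x. (f has_derivative f' x) (at x)"
    and cont: "continuous_on UNIV (\<lambda>x. f' x v)"
    and C: "compact C" "\<And>x. x \<notin> C \<Longrightarrow> f x = 0"
  shows "integral\<^sup>L lborel (\<lambda>x. f' x v) = 0"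
proof -
  \<comment> \<open>All points that a translation by at most 1 in parameter can bring into
    \<open>C\<close>; the translated derivatives are dominated by a constant on this compact
    set.\<close>
  define T where "T = (\<lambda>(x, s). x - s *\<^sub>R v) ` (C \<times> {-1..1::real})"
  have "compact T"
    unfolding T_def using C(1)
    by (intro compact_continuous_image compact_Times) (auto intro!: continuous_intros simp: case_prod_unfold)
  have T: "x \<in> T" if "x + t *\<^sub>R v \<in> C" "\<bar>t\<bar> < 1" for x t
    unfolding T_def using that by (intro image_eqI[where x = "(x + t *\<^sub>R v, t)"]) auto
  have f'0: "f' x v = 0" if "x \<notin> C" for x
  proof -
    have "((\<lambda>_. 0) has_derivative f' x) (at x)"
      by (rule has_derivative_transform_within_open[OF der, of "- C"])
        (use that C compact_imp_closed in \<open>auto simp: open_Compl\<close>)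
    then have "f' x = (\<lambda>_. 0)"
      using has_derivative_unique has_derivative_const by blast
    then show ?thesis by simp
  qed
  have "bounded ((\<lambda>x. f' x v) ` C)"
    using C(1) continuous_on_subset[OF cont subset_UNIV]
    by (intro compact_imp_bounded compact_continuous_image)
  then obtain B where B: "B > 0" "\<And>x. x \<in> C \<Longrightarrow> \<bar>f' x v\<bar> \<le> B"
    by (auto simp: bounded_pos)
  have int: "integrable lborel f"
    by (intro integrable_compact_support[OF C(1)] continuous_at_imp_continuous_on ballI
        has_derivative_continuous[OF der] C(2))
  have shift: "integrable lborel (\<lambda>x. f (x + t *\<^sub>R v))"
    "integral\<^sup>L lborel (\<lambda>x. f (x + t *\<^sub>R v)) = integral\<^sup>L lborel f" for t
    using int integrable_distr_eq[of "(+) (t *\<^sub>R v)" lborel borel f] integral_distr[of "(+) (t *\<^sub>R v)" lborel borel f]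
    by (simp_all add: lborel_distr_plus add.commute[of _ "t *\<^sub>R v"] borel_measurable_integrable[OF int, simplified])
  have "((\<lambda>t. integral\<^sup>L lborel (\<lambda>x. f (x + t *\<^sub>R v))) has_real_derivative
      integral\<^sup>L lborel (\<lambda>x. f' (x + 0 *\<^sub>R v) v)) (at 0)"
  proof (rule has_real_derivative_integral[where \<delta> = 1 and w = "\<lambda>x. indicator T x *\<^sub>R B"])
    show "((\<lambda>t. f (x + t *\<^sub>R v)) has_real_derivative f' (x + t *\<^sub>R v) v) (at t)" for x t
      using has_derivative_along_line[OF der] by (simp add: has_real_derivative_iff_has_vector_derivative)
    show "\<bar>f' (x + t *\<^sub>R v) v\<bar> \<le> indicator T x *\<^sub>R B" if "\<bar>t\<bar> < 1" for t x
      using T[of x t] B f'0[of "x + t *\<^sub>R v"] that by (cases "x + t *\<^sub>R v \<in> C") (auto simp: indicator_def)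
    show "integrable lborel (\<lambda>x. indicator T x *\<^sub>R B)"
      using \<open>compact T\<close> by (intro borel_integrable_compact) auto
  qed (use shift in auto)
  moreover have "((\<lambda>t. integral\<^sup>L lborel (\<lambda>x. f (x + t *\<^sub>R v))) has_real_derivative 0) (at 0)"
    by (simp add: shift(2))
  ultimately have "integral\<^sup>L lborel (\<lambda>x. f' (x + 0 *\<^sub>R v) v) = 0"
    by (rule DERIV_unique)
  then show ?thesis by simp
qed

subsection \<open>Change of variables for nonnegative integrals\<close>

text \<open>Mediates between gauge integrals, in which the change of variables theorem is stated,
  and the nonnegative Lebesgue integrals that define measures. Integrability and value are paired
  because that theorem transports them as a pair.\<close>

lemma absolutely_integrable_iff_nn_integral:
  fixes f :: "'a::euclidean_space \<Rightarrow> real"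
  assumes "\<And>x. x \<in> S \<Longrightarrow> 0 \<le> f x" and meas: "(\<lambda>x. indicator S x * f x) \<in> borel_measurable borel"
  shows "(f absolutely_integrable_on S \<and> integral S f = b) \<longleftrightarrow>
     (0 \<le> b \<and> (\<integral>\<^sup>+x. ennreal (f x) * indicator S x \<partial>lborel) = ennreal b)"
proof -
  have int: "0 \<le> integral S f \<and> (\<integral>\<^sup>+x. ennreal (f x) * indicator S x \<partial>lborel) = ennreal (integral S f)"
    if "f integrable_on S"
    using nn_integral_has_integral_lebesgue'[OF assms(1) integrable_integral[OF that]]
      integral_nonneg[OF that assms(1)] by simp
  have "f integrable_on S" if "(\<integral>\<^sup>+x. ennreal (f x) * indicator S x \<partial>lborel) = ennreal b"
  proof -
    have "(\<integral>\<^sup>+x. ennreal (indicator S x * f x) \<partial>lborel) = (\<integral>\<^sup>+x. ennreal (f x) * indicator S x \<partial>lborel)"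
      by (intro nn_integral_cong) (auto simp: indicator_def)
    then have "(\<lambda>x. indicator S x * f x) integrable_on UNIV"
      using assms(1) that by (intro nn_integral_integrable_on[OF meas]) (auto simp: indicator_def)
    moreover have "(\<lambda>x. indicator S x * f x) = (\<lambda>x. if x \<in> S then f x else 0)"
      by (auto simp: indicator_def)
    ultimately show ?thesis by (simp add: integrable_restrict_UNIV)
  qed
  then show ?thesis
    using int absolutely_integrable_on_iff_nonneg[of S f] assms(1) by auto
qed

text \<open>The two sides take the same finite values: one equals \<open>b\<close> exactly if the
  other does, for every real \<open>b \<ge> 0\<close>. This also settles the infinite case, where
  neither side equals any such \<open>b\<close>. The detour through \<open>real^1\<close> matches
  the vector-valued form of the absolute change of variables theorem.\<close>

lemma nn_integral_change_of_variables:
  fixes k :: "real^'m::{finite,wellorder} \<Rightarrow> real" and g :: "real^'m::_ \<Rightarrow> real^'m::_"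
  assumes S: "S \<in> sets borel"
    and der: "\<And>x. x \<in> S \<Longrightarrow> (g has_derivative g' x) (at x within S)"
    and inj: "inj_on g S"
    and nonneg: "\<And>x. x \<in> S \<Longrightarrow> 0 \<le> k (g x)"
    and meas1: "(\<lambda>y. indicator (g ` S) y * k y) \<in> borel_measurable borel"
    and meas2: "(\<lambda>x. indicator S x * (\<bar>det (matrix (g' x))\<bar> * k (g x))) \<in> borel_measurable borel"
  shows "(\<integral>\<^sup>+x. ennreal (\<bar>det (matrix (g' x))\<bar> * k (g x)) * indicator S x \<partial>lborel) =
         (\<integral>\<^sup>+y. ennreal (k y) * indicator (g ` S) y \<partial>lborel)" (is "?L = ?R")
proof -
  have SL: "S \<in> sets lebesgue" using S by auto
  have "(\<lambda>x. \<bar>det (matrix (g' x))\<bar> * k (g x)) absolutely_integrable_on S \<and>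
        integral S (\<lambda>x. \<bar>det (matrix (g' x))\<bar> * k (g x)) = b \<longleftrightarrow>
        k absolutely_integrable_on (g ` S) \<and> integral (g ` S) k = b" for b
    using has_absolute_integral_change_of_variables[OF SL der inj, of "\<lambda>y. vec (k y) :: real^1" "vec b"]
    by (simp add: absolutely_integrable_on_1_iff integral_on_1_eq)
  then have *: "(0 \<le> b \<and> ?L = ennreal b) \<longleftrightarrow> (0 \<le> b \<and> ?R = ennreal b)" for b
    using absolutely_integrable_iff_nn_integral[OF _ meas2] absolutely_integrable_iff_nn_integral[OF _ meas1]
      nonneg by (smt (verit, best) abs_ge_zero image_iff mult_nonneg_nonneg)
  show ?thesis
  proof (cases ?L rule: ennreal_cases)
    case (real r)
    then show ?thesis using *[of r] by simp
  next
    case top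
    then show ?thesis using * by (cases ?R rule: ennreal_cases) auto
  qed
qed

subsection \<open>Charts\<close>

abbreviation transition :: "'a chart \<Rightarrow> 'a chart \<Rightarrow> real^2 \<Rightarrow> real^2" where
  "transition c d \<equiv> snd d \<circ> chart_inv c"

abbreviation jacobian :: "'a chart \<Rightarrow> 'a chart \<Rightarrow> real^2 \<Rightarrow> real^2^2" where
  "jacobian c d u \<equiv> matrix (frechet_derivative (transition c d) (at u))"

abbreviation overlap :: "'a chart \<Rightarrow> 'a chart \<Rightarrow> (real^2) set" where
  "overlap c d \<equiv> snd c ` (fst c \<inter> fst d)"

locale surface =
  fixes A :: "'a::{t2_space,second_countable_topology} chart set"
  assumes smooth_surface: "smooth_surface A"
begin

lemma open_chart: "c \<in> A \<Longrightarrow> open (fst c)" and open_chart_image: "c \<in> A \<Longrightarrow> open (chart_image c)"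
  and chart_homeomorphism: "c \<in> A \<Longrightarrow> homeomorphism (fst c) (chart_image c) (snd c) (chart_inv c)"
  and charts_cover: "(\<Union>c\<in>A. fst c) = UNIV"
  and transition_smooth: "c \<in> A \<Longrightarrow> d \<in> A \<Longrightarrow> Ck_on k (overlap c d) (transition c d)"
  using smooth_surface by (auto simp: smooth_surface_def smooth_on_def)

lemma chart_inv_left [simp]: "c \<in> A \<Longrightarrow> x \<in> fst c \<Longrightarrow> chart_inv c (snd c x) = x"
  and chart_inv_right [simp]: "c \<in> A \<Longrightarrow> u \<in> chart_image c \<Longrightarrow> snd c (chart_inv c u) = u"
  and chart_inv_in [simp]: "c \<in> A \<Longrightarrow> u \<in> chart_image c \<Longrightarrow> chart_inv c u \<in> fst c"
  and continuous_chart: "c \<in> A \<Longrightarrow> continuous_on (fst c) (snd c)"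
  and continuous_chart_inv: "c \<in> A \<Longrightarrow> continuous_on (chart_image c) (chart_inv c)"
  using chart_homeomorphism[of c] by (auto simp: homeomorphism_def)

lemma in_chart_image [simp]: "x \<in> fst c \<Longrightarrow> snd c x \<in> chart_image c"
  by (auto simp: chart_image_def)

lemma chart_vimage:
  assumes "c \<in> A"
  shows "snd c ` (B \<inter> fst c) = {u \<in> chart_image c. chart_inv c u \<in> B}"
proof safe
  fix u assume "u \<in> chart_image c" "chart_inv c u \<in> B"
  then show "u \<in> snd c ` (B \<inter> fst c)"
    using assms by (intro image_eqI[of _ _ "chart_inv c u"]) auto
qed (use assms in auto)

lemma overlap_iff:
  assumes "c \<in> A"
  shows "u \<in> overlap c d \<longleftrightarrow> u \<in> chart_image c \<and> chart_inv c u \<in> fst d"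
  using chart_vimage[OF assms, of "fst d"] by (auto simp: Int_commute)

lemma open_overlap:
  assumes "c \<in> A" "d \<in> A"
  shows "open (overlap c d)"
proof -
  have "overlap c d = chart_image c \<inter> chart_inv c -` fst d"
    using overlap_iff[OF assms(1)] by blast
  then show ?thesis
    using continuous_open_preimage[OF continuous_chart_inv open_chart_image open_chart] assms by simp
qed

lemma chart_ex: obtains c where "c \<in> A" "x \<in> fst c"
  using charts_cover by blast

lemma chart_at_mem: "chart_at A x \<in> A" and mem_chart_at: "x \<in> fst (chart_at A x)"
proof -
  have "\<exists>c. c \<in> A \<and> x \<in> fst c" using chart_ex by blast
  then show "chart_at A x \<in> A" "x \<in> fst (chart_at A x)"
    unfolding chart_at_def using someI_ex[of "\<lambda>c. c \<in> A \<and> x \<in> fst c"] by auto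
qed

lemma chart_inv_measurable:
  assumes "c \<in> A"
  shows "chart_inv c \<in> restrict_space borel (chart_image c) \<rightarrow>\<^sub>M borel"
  by (intro borel_measurable_continuous_on_restrict continuous_chart_inv assms)

lemma chart_image_borel [measurable]: "c \<in> A \<Longrightarrow> chart_image c \<in> sets borel"
  using open_chart_image by (intro borel_open)

lemma chart_borel [measurable]: "c \<in> A \<Longrightarrow> fst c \<in> sets borel"
  using open_chart by (intro borel_open)

lemma image_chart_borel:
  assumes "c \<in> A" "B \<in> sets borel" "B \<subseteq> fst c"
  shows "snd c ` B \<in> sets borel"
proof -
  have "chart_inv c -` B \<inter> space (restrict_space borel (chart_image c)) \<in> sets (restrict_space borel (chart_image c))"
    using measurable_sets[OF chart_inv_measurable assms(2)] assms(1) .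
  moreover have "snd c ` B = chart_inv c -` B \<inter> space (restrict_space borel (chart_image c))"
    using chart_vimage[OF assms(1), of B] assms(3) by (auto simp: space_restrict_space Int_absorb2)
  ultimately show ?thesis
    using assms(1) by (simp add: sets_restrict_space_iff)
qed

text \<open>Second countability enters here, through Lindelof's theorem. The enumeration may repeat
  charts; a repeated chart just contributes an empty disjointed piece.\<close>

lemma countable_atlas:
  "\<exists>C :: nat \<Rightarrow> 'a chart. (\<forall>n. C n \<in> A) \<and> (\<Union>n. fst (C n)) = UNIV"
proof -
  obtain F where F: "F \<subseteq> fst ` A" "countable F" "\<Union>F = UNIV"
    using Lindelof[of "fst ` A"] open_chart charts_cover by (metis (no_types, lifting) imageE)
  then have ne: "F \<noteq> {}" by auto
  have "\<forall>n. \<exists>c. c \<in> A \<and> fst c = from_nat_into F n"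
    using F(1) from_nat_into[OF ne] by (metis (no_types, lifting) imageE subsetD)
  then obtain C where C: "\<And>n. C n \<in> A" "\<And>n. fst (C n) = from_nat_into F n" by metis
  have "(\<Union>n. fst (C n)) = UNIV"
    using range_from_nat_into[OF ne F(2)] F(3) by (simp add: C(2))
  with C(1) show ?thesis by blast
qed

lemma transition_has_derivative:
  assumes "c \<in> A" "d \<in> A" "u \<in> overlap c d"
  shows "(transition c d has_derivative frechet_derivative (transition c d) (at u)) (at u)"
  using Ck_on_SucD[OF transition_smooth[of c d "Suc 0"]] assms by auto

end

subsection \<open>The measure with given densities in charts\<close>

text \<open>The transformation law is the condition under which the measures of different charts
  agree on overlaps. The density stays abstract so that the construction serves the metric induced
  by every member of a variation.\<close>

locale surface_density = surface A for A :: "'a::{t2_space,second_countable_topology} chart set" +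
  fixes w :: "'a chart \<Rightarrow> real^2 \<Rightarrow> real"
  assumes w_nonneg: "c \<in> A \<Longrightarrow> u \<in> chart_image c \<Longrightarrow> 0 \<le> w c u"
    and w_continuous: "c \<in> A \<Longrightarrow> continuous_on (chart_image c) (w c)"
    and w_transition: "c \<in> A \<Longrightarrow> d \<in> A \<Longrightarrow> u \<in> overlap c d \<Longrightarrow>
      w c u = \<bar>det (jacobian c d u)\<bar> * w d (transition c d u)"
begin

definition chart_measure :: "'a chart \<Rightarrow> 'a measure" where
  "chart_measure c = distr (density (restrict_space lborel (chart_image c)) (\<lambda>u. ennreal (w c u)))
     borel (chart_inv c)"

text \<open>The predicate under the definite description in \<open>volume_measure\<close>, with
  \<open>w\<close> in place of \<open>sqrt (det h)\<close>.\<close>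

definition is_volume :: "'a measure \<Rightarrow> bool" where
  "is_volume M \<longleftrightarrow> sets M = sets borel \<and>
     (\<forall>c\<in>A. \<forall>B\<in>sets borel. B \<subseteq> fst c \<longrightarrow>
        emeasure M B = (\<integral>\<^sup>+ u. ennreal (w c u) * indicator (snd c ` B) u \<partial>lborel))"

lemma w_measurable:
  assumes "c \<in> A"
  shows "(\<lambda>u. w c u) \<in> borel_measurable (restrict_space lborel (chart_image c))"
  using borel_measurable_continuous_on_restrict[OF w_continuous[OF assms]]
  by (simp cong: measurable_cong_sets sets_restrict_space_cong)

lemma chart_inv_measurable':
  assumes "c \<in> A"
  shows "chart_inv c \<in> density (restrict_space lborel (chart_image c)) f \<rightarrow>\<^sub>M borel"
  using chart_inv_measurable[OF assms] by (simp cong: measurable_cong_sets sets_restrict_space_cong)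

lemma emeasure_chart_measure:
  assumes c: "c \<in> A" and B: "B \<in> sets borel"
  shows "emeasure (chart_measure c) B =
    (\<integral>\<^sup>+ u. ennreal (w c u) * indicator (snd c ` (B \<inter> fst c)) u \<partial>lborel)"
proof -
  let ?R = "restrict_space lborel (chart_image c)"
  let ?V = "chart_inv c -` B \<inter> space ?R"
  have V: "?V \<in> sets ?R"
    using measurable_sets[OF chart_inv_measurable'[OF c, of "\<lambda>_. 1"] B] by simp
  have "emeasure (chart_measure c) B = emeasure (density ?R (\<lambda>u. ennreal (w c u))) ?V"
    unfolding chart_measure_def using emeasure_distr[OF chart_inv_measurable'[OF c] B] by simp
  also have "\<dots> = (\<integral>\<^sup>+u. ennreal (w c u) * indicator ?V u \<partial>?R)"
    using w_measurable[OF c] V by (intro emeasure_density) auto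
  also have "\<dots> = (\<integral>\<^sup>+u. ennreal (w c u) * indicator ?V u * indicator (chart_image c) u \<partial>lborel)"
    using c by (intro nn_integral_restrict_space) auto
  also have "\<dots> = (\<integral>\<^sup>+ u. ennreal (w c u) * indicator (snd c ` (B \<inter> fst c)) u \<partial>lborel)"
    using chart_vimage[OF c, of B]
    by (intro nn_integral_cong) (auto simp: indicator_def space_restrict_space)
  finally show ?thesis .
qed

lemma sets_chart_measure [simp]: "sets (chart_measure c) = sets borel"
  by (simp add: chart_measure_def)

lemma w_indicator_measurable:
  assumes "c \<in> A" "S \<in> sets borel" "S \<subseteq> chart_image c"
  shows "(\<lambda>u. indicator S u * w c u) \<in> borel_measurable borel"
  using borel_measurable_continuous_on_indicator[OF assms(2) continuous_on_subset[OF w_continuous[OF assms(1)] assms(3)]]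
  by simp

text \<open>Change of variables along the transition map, whose Jacobian factor is absorbed by
  \<open>w_transition\<close>.\<close>

lemma chart_measure_consistent:
  assumes c: "c \<in> A" and d: "d \<in> A" and B: "B \<in> sets borel" "B \<subseteq> fst c" "B \<subseteq> fst d"
  shows "emeasure (chart_measure c) B = emeasure (chart_measure d) B"
proof -
  let ?S = "snd c ` B"
  have S: "?S \<in> sets borel" by (rule image_chart_borel[OF c B(1,2)])
  have sub: "?S \<subseteq> overlap c d" "?S \<subseteq> chart_image c" using B by auto
  have im: "transition c d ` ?S = snd d ` B"
    using B c by (force simp: image_image)
  have inj: "inj_on (transition c d) ?S"
  proof (rule inj_onI)
    fix u v assume uv: "u \<in> ?S" "v \<in> ?S" "transition c d u = transition c d v"
    then obtain x y where xy: "x \<in> B" "u = snd c x" "y \<in> B" "v = snd c y" by auto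
    then have "snd d x = snd d y"
      using uv(3) B(2) c by (auto simp: subset_iff)
    then have "x = y"
      using chart_inv_left[OF d, of x] chart_inv_left[OF d, of y] xy B(3) by auto
    then show "u = v" using xy by simp
  qed
  have eq: "indicator ?S u * (\<bar>det (jacobian c d u)\<bar> * w d (transition c d u)) = indicator ?S u * w c u" for u
    using w_transition[OF c d, of u] sub by (auto simp: indicator_def)
  have im': "snd d ` B \<in> sets borel" "snd d ` B \<subseteq> chart_image d"
    using image_chart_borel[OF d B(1,3)] B(3) by auto
  have "(\<integral>\<^sup>+u. ennreal (\<bar>det (jacobian c d u)\<bar> * w d (transition c d u)) * indicator ?S u \<partial>lborel) =
         (\<integral>\<^sup>+v. ennreal (w d v) * indicator (transition c d ` ?S) v \<partial>lborel)"
  proof (rule nn_integral_change_of_variables[OF S _ inj, where k = "w d" and g' = "\<lambda>u. frechet_derivative (transition c d) (at u)"])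
    show "(transition c d has_derivative frechet_derivative (transition c d) (at u)) (at u within ?S)"
      if "u \<in> ?S" for u
      by (rule has_derivative_at_withinI[OF transition_has_derivative[OF c d subsetD[OF sub(1) that]]])
    show "0 \<le> w d (transition c d u)" if "u \<in> ?S" for u
    proof -
      have "transition c d u \<in> snd d ` B" using im that by blast
      then show ?thesis using w_nonneg[OF d] im'(2) by blast
    qed
    show "(\<lambda>v. indicator (transition c d ` ?S) v * w d v) \<in> borel_measurable borel"
      unfolding im by (rule w_indicator_measurable[OF d im'])
    show "(\<lambda>u. indicator ?S u * (\<bar>det (jacobian c d u)\<bar> * w d (transition c d u))) \<in> borel_measurable borel"
      unfolding eq by (rule w_indicator_measurable[OF c S sub(2)])
  qed
  moreover have "ennreal (\<bar>det (jacobian c d u)\<bar> * w d (transition c d u)) * indicator ?S u =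
      ennreal (w c u) * indicator ?S u" for u
    using w_transition[OF c d, of u] sub by (auto simp: indicator_def)
  ultimately show ?thesis
    unfolding im emeasure_chart_measure[OF c B(1)] emeasure_chart_measure[OF d B(1)]
      Int_absorb2[OF B(2)] Int_absorb2[OF B(3)] by (simp only:)
qed

lemma chart_piece_borel:
  assumes "\<And>n. C n \<in> A"
  shows "disjointed (\<lambda>n. fst (C n)) n \<in> sets borel"
proof -
  have "range (\<lambda>n. fst (C n)) \<subseteq> sets borel"
    using chart_borel[OF assms] by auto
  from sets.range_disjointed_sets[OF this] show ?thesis by auto
qed

lemma emeasure_pieces:
  assumes C: "\<And>n. C n \<in> A" "(\<Union>n. fst (C n)) = UNIV" and M: "sets M = sets borel" and B: "B \<in> sets borel"
  shows "emeasure M B = (\<Sum>n. emeasure M (B \<inter> disjointed (\<lambda>n. fst (C n)) n))"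
proof -
  let ?P = "disjointed (\<lambda>n. fst (C n))"
  have P: "?P n \<in> sets borel" for n
    by (rule chart_piece_borel[OF C(1)])
  have "(\<Sum>n. emeasure M (B \<inter> ?P n)) = emeasure M (\<Union>n. B \<inter> ?P n)"
    using P B M by (intro suminf_emeasure disjoint_family_subset[OF disjoint_family_disjointed]) auto
  also have "(\<Union>n. B \<inter> ?P n) = B"
    unfolding Int_UN_distrib[symmetric] UN_disjointed_eq C(2) by simp
  finally show ?thesis by simp
qed

text \<open>On a set inside one chart the value is prescribed, and every Borel set is a countable
  disjoint union of such sets.\<close>

lemma is_volume_unique:
  assumes "is_volume M" "is_volume N"
  shows "M = N"
proof (rule measure_eqI)
  show "sets M = sets N" using assms by (simp add: is_volume_def)
  fix B assume "B \<in> sets M"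
  then have B: "B \<in> sets borel" using assms by (simp add: is_volume_def)
  obtain C :: "nat \<Rightarrow> 'a chart" where C: "\<And>n. C n \<in> A" "(\<Union>n. fst (C n)) = UNIV"
    using countable_atlas by blast
  let ?P = "disjointed (\<lambda>n. fst (C n))"
  have P: "?P n \<in> sets borel" for n
    by (rule chart_piece_borel[OF C(1)])
  have "emeasure M (B \<inter> ?P n) = emeasure N (B \<inter> ?P n)" for n
  proof -
    have "B \<inter> ?P n \<subseteq> fst (C n)" by (rule le_infI2[OF disjointed_subset])
    then show ?thesis using assms B P[of n] C(1)[of n] by (simp add: is_volume_def)
  qed
  then show "emeasure M B = emeasure N B"
    using emeasure_pieces[OF C _ B] assms by (simp add: is_volume_def)
qed

text \<open>The surface is cut into disjoint Borel pieces, each inside one chart, and the chart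
  measures of the pieces are added up. By consistency on overlaps, the choice of the chart for a
  piece does not influence the value.\<close>

lemma is_volume_ex: "\<exists>M. is_volume M"
proof -
  obtain C :: "nat \<Rightarrow> 'a chart" where C: "\<And>n. C n \<in> A" "(\<Union>n. fst (C n)) = UNIV"
    using countable_atlas by blast
  let ?P = "disjointed (\<lambda>n. fst (C n))"
  define \<mu> where "\<mu> B = (\<Sum>n. emeasure (chart_measure (C n)) (B \<inter> ?P n))" for B
  have P: "?P n \<in> sets borel" for n
    by (rule chart_piece_borel[OF C(1)])
  have ca: "countably_additive (sets borel) \<mu>"
  proof (rule countably_additiveI)
    fix F :: "nat \<Rightarrow> 'a set"
    assume F: "range F \<subseteq> sets borel" "disjoint_family F"
    have "emeasure (chart_measure (C n)) ((\<Union>i. F i) \<inter> ?P n) =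
        (\<Sum>i. emeasure (chart_measure (C n)) (F i \<inter> ?P n))" for n
    proof -
      have "(\<Sum>i. emeasure (chart_measure (C n)) (F i \<inter> ?P n)) = emeasure (chart_measure (C n)) (\<Union>i. F i \<inter> ?P n)"
        using F P by (intro suminf_emeasure) (auto simp: disjoint_family_on_def)
      then show ?thesis by (simp add: Int_UN_distrib2)
    qed
    \<comment> \<open>The outer series is read as an integral over counting measure, so that the
      exchange of the two sums becomes an exchange of integral and series.\<close>
    then have "\<mu> (\<Union>i. F i) = (\<integral>\<^sup>+n. (\<Sum>i. emeasure (chart_measure (C n)) (F i \<inter> ?P n)) \<partial>count_space UNIV)"
      by (simp add: \<mu>_def nn_integral_count_space_nat)
    also have "\<dots> = (\<Sum>i. \<integral>\<^sup>+n. emeasure (chart_measure (C n)) (F i \<inter> ?P n) \<partial>count_space UNIV)"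
      by (rule nn_integral_suminf) simp
    also have "\<dots> = (\<Sum>i. \<mu> (F i))"
      by (simp add: \<mu>_def nn_integral_count_space_nat)
    finally show "(\<Sum>i. \<mu> (F i)) = \<mu> (\<Union>i. F i)" by simp
  qed
  define M where "M = measure_of UNIV (sets borel) \<mu>"
  have sig: "sigma_algebra UNIV (sets (borel :: 'a measure))"
    using sets.sigma_algebra_axioms[of "borel :: 'a measure"] by simp
  have M: "sets M = sets borel"
    unfolding M_def using sets.sets_measure_of_eq[of "borel :: 'a measure"] by (simp add: space_borel)
  have \<mu>: "emeasure M B = \<mu> B" if "B \<in> sets borel" for B
    unfolding M_def
    by (rule emeasure_measure_of_sigma[OF sig _ ca that]) (simp add: positive_def \<mu>_def)
  have "emeasure M B = (\<integral>\<^sup>+ u. ennreal (w c u) * indicator (snd c ` B) u \<partial>lborel)"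
    if c: "c \<in> A" and B: "B \<in> sets borel" "B \<subseteq> fst c" for c B
  proof -
    have "emeasure (chart_measure (C n)) (B \<inter> ?P n) = emeasure (chart_measure c) (B \<inter> ?P n)" for n
    proof (rule chart_measure_consistent)
      show "B \<inter> ?P n \<subseteq> fst (C n)" by (rule le_infI2[OF disjointed_subset])
    qed (use C(1) c B P in auto)
    then have "emeasure M B = (\<Sum>n. emeasure (chart_measure c) (B \<inter> ?P n))"
      using \<mu>[OF B(1)] by (simp add: \<mu>_def)
    also have "\<dots> = emeasure (chart_measure c) B"
      using emeasure_pieces[OF C _ B(1), of "chart_measure c"] by simp
    finally show ?thesis
      using emeasure_chart_measure[OF c B(1)] B(2) by (simp add: Int_absorb2)
  qed
  with M have "is_volume M" by (simp add: is_volume_def)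
  then show ?thesis ..
qed

definition volume :: "'a measure" where
  "volume = (THE M. is_volume M)"

lemma is_volume: "is_volume volume"
proof -
  have "\<exists>!M. is_volume M" using is_volume_ex is_volume_unique by blast
  then show ?thesis unfolding volume_def by (rule theI')
qed

lemma sets_volume [simp, measurable_cong]: "sets volume = sets borel"
  using is_volume by (simp add: is_volume_def)

lemma density_volume_chart:
  assumes c: "c \<in> A"
  shows "density volume (indicator (fst c)) = chart_measure c"
proof (rule measure_eqI)
  fix B assume "B \<in> sets (density volume (indicator (fst c)))"
  then have B: "B \<in> sets borel" by simp
  have "emeasure (density volume (indicator (fst c))) B = emeasure volume (B \<inter> fst c)"
    using B c by (subst emeasure_density)
      (auto intro!: nn_integral_cong simp: indicator_def simp flip: nn_integral_indicator)
  also have "\<dots> = emeasure (chart_measure c) B"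
    using is_volume c B emeasure_chart_measure[OF c B] by (simp add: is_volume_def)
  finally show "emeasure (density volume (indicator (fst c))) B = emeasure (chart_measure c) B" .
qed simp

text \<open>Since \<open>f\<close> vanishes off the chart, multiplying it by the indicator of
  \<open>fst c\<close> changes nothing, and the volume may be replaced by the chart measure.\<close>

lemma volume_transfer:
  fixes f :: "'a \<Rightarrow> real"
  assumes c: "c \<in> A" and f: "f \<in> borel_measurable borel" and 0: "\<And>x. x \<notin> fst c \<Longrightarrow> f x = 0"
  shows integrable_volume_iff: "integrable volume f \<longleftrightarrow>
      integrable lborel (\<lambda>u. indicator (chart_image c) u * (w c u * f (chart_inv c u)))" (is ?I)
    and integral_volume_eq: "integral\<^sup>L volume f =
      integral\<^sup>L lborel (\<lambda>u. indicator (chart_image c) u * (w c u * f (chart_inv c u)))" (is ?E)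
proof -
  let ?R = "restrict_space lborel (chart_image c)"
  have dens: "chart_measure c = density volume (\<lambda>x. ennreal (indicator (fst c) x))"
    using density_volume_chart[OF c] by (simp add: ennreal_indicator)
  have eq: "(\<lambda>x. indicator (fst c) x *\<^sub>R f x) = f"
    using 0 by (auto simp: indicator_def fun_eq_iff)
  have fV: "f \<in> borel_measurable volume" using f by (simp cong: measurable_cong_sets)
  have ind: "indicator (fst c) \<in> borel_measurable volume" using c by simp
  have indAE: "AE x in volume. 0 \<le> indicat_real (fst c) x" by simp
  have fcomp: "(\<lambda>u. f (chart_inv c u)) \<in> borel_measurable ?R"
    using measurable_compose[OF chart_inv_measurable[OF c] f]
    by (simp cong: measurable_cong_sets sets_restrict_space_cong)
  have wAE: "AE u in ?R. 0 \<le> w c u"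
    using w_nonneg[OF c] by (intro AE_I2) (auto simp: space_restrict_space)
  have "integrable volume f \<longleftrightarrow> integrable (chart_measure c) f"
    unfolding dens integrable_density[OF fV ind indAE] eq ..
  also have "\<dots> \<longleftrightarrow> integrable (density ?R (\<lambda>u. ennreal (w c u))) (\<lambda>u. f (chart_inv c u))"
    unfolding chart_measure_def by (rule integrable_distr_eq[OF chart_inv_measurable'[OF c] f])
  also have "\<dots> \<longleftrightarrow> integrable ?R (\<lambda>u. w c u *\<^sub>R f (chart_inv c u))"
    by (rule integrable_density[OF fcomp w_measurable[OF c] wAE])
  also have "\<dots> \<longleftrightarrow> integrable lborel (\<lambda>u. indicator (chart_image c) u * (w c u * f (chart_inv c u)))"
    using c by (subst integrable_restrict_space) auto
  finally show ?I .
  have "integral\<^sup>L volume f = integral\<^sup>L (chart_measure c) f"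
    unfolding dens integral_density[OF fV ind indAE] eq ..
  also have "\<dots> = integral\<^sup>L (density ?R (\<lambda>u. ennreal (w c u))) (\<lambda>u. f (chart_inv c u))"
    unfolding chart_measure_def by (rule integral_distr[OF chart_inv_measurable'[OF c] f])
  also have "\<dots> = integral\<^sup>L ?R (\<lambda>u. w c u *\<^sub>R f (chart_inv c u))"
    by (rule integral_density[OF fcomp w_measurable[OF c] wAE])
  also have "\<dots> = integral\<^sup>L lborel (\<lambda>u. indicator (chart_image c) u * (w c u * f (chart_inv c u)))"
    using c by (subst integral_restrict_space) auto
  finally show ?E .
qed

end

subsection \<open>Area density and conormals of a pair of vectors\<close>

text \<open>The Gram determinant of two vectors, that is, the squared area of the parallelogram they
  span.\<close>

definition gram :: "'b::real_inner \<Rightarrow> 'b \<Rightarrow> real" where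
  "gram p q = (p \<bullet> p) * (q \<bullet> q) - (p \<bullet> q)\<^sup>2"

definition area :: "'b::real_inner \<Rightarrow> 'b \<Rightarrow> real" where
  "area p q = sqrt (gram p q)"

text \<open>The gradient of \<open>area\<close> with respect to its first argument.\<close>
definition conormal :: "'b::real_inner \<Rightarrow> 'b \<Rightarrow> 'b" where
  "conormal p q = inverse (area p q) *\<^sub>R ((q \<bullet> q) *\<^sub>R p - (p \<bullet> q) *\<^sub>R q)"

lemma gram_commute: "gram p q = gram q p"
  by (simp add: gram_def inner_commute mult.commute)

lemma area_commute: "area p q = area q p"
  by (simp add: area_def gram_commute)

lemma gram_nonneg: "0 \<le> gram p q"
  using Cauchy_Schwarz_ineq[of p q] by (simp add: gram_def)

lemma area_nonneg [simp]: "0 \<le> area p q"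
  by (simp add: area_def gram_nonneg)

lemma area_pos_iff [simp]: "0 < area p q \<longleftrightarrow> 0 < gram p q"
  by (simp add: area_def)

lemma area_square [simp]: "(area p q)\<^sup>2 = gram p q" "area p q * area p q = gram p q"
  by (simp_all add: area_def gram_nonneg flip: power2_eq_square)

lemma conormal_inner:
  "conormal p q \<bullet> n = inverse (area p q) * ((q \<bullet> q) * (p \<bullet> n) - (p \<bullet> q) * (q \<bullet> n))"
  by (simp add: conormal_def inner_diff_left)

lemma conormal_inner_left:
  assumes "0 < gram p q"
  shows "conormal p q \<bullet> p = area p q"
proof -
  have "(q \<bullet> q) * (p \<bullet> p) - (p \<bullet> q) * (q \<bullet> p) = area p q * area p q"
    by (simp add: gram_def power2_eq_square inner_commute mult.commute)
  then show ?thesis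
    using assms by (simp add: conormal_inner mult.assoc[symmetric] del: area_square)
      (simp add: area_def)
qed

lemma conormal_inner_right: "conormal p q \<bullet> q = 0"
  by (simp add: conormal_inner mult.commute)

text \<open>As \<open>area\<close> is symmetric, its gradient in the second argument is the conormal
  with the arguments exchanged.\<close>

lemma has_derivative_area:
  assumes p: "(p has_derivative p') (at x)" and q: "(q has_derivative q') (at x)"
    and pos: "0 < gram (p x) (q x)"
  shows "((\<lambda>x. area (p x) (q x)) has_derivative
    (\<lambda>v. p' v \<bullet> conormal (p x) (q x) + q' v \<bullet> conormal (q x) (p x))) (at x)"
proof -
  have "((\<lambda>x. gram (p x) (q x)) has_derivative
    (\<lambda>v. 2 * ((p' v \<bullet> p x) * (q x \<bullet> q x) + (p x \<bullet> p x) * (q' v \<bullet> q x)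
      - (p x \<bullet> q x) * (p' v \<bullet> q x + q' v \<bullet> p x)))) (at x)"
    unfolding gram_def power2_eq_square
    by (rule derivative_eq_intros p q refl)+
      (simp add: fun_eq_iff algebra_simps inner_commute)
  from has_derivative_compose[OF this DERIV_real_sqrt[OF pos, unfolded has_field_derivative_def]]
  have "((\<lambda>x. area (p x) (q x)) has_derivative (\<lambda>v. inverse (area (p x) (q x)) / 2 *
      (2 * ((p' v \<bullet> p x) * (q x \<bullet> q x) + (p x \<bullet> p x) * (q' v \<bullet> q x)
      - (p x \<bullet> q x) * (p' v \<bullet> q x + q' v \<bullet> p x))))) (at x)"
    unfolding area_def .
  moreover have "inverse (area (p x) (q x)) / 2 *
      (2 * ((p' v \<bullet> p x) * (q x \<bullet> q x) + (p x \<bullet> p x) * (q' v \<bullet> q x)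
      - (p x \<bullet> q x) * (p' v \<bullet> q x + q' v \<bullet> p x))) =
      p' v \<bullet> conormal (p x) (q x) + q' v \<bullet> conormal (q x) (p x)" for v
    unfolding inner_commute[of _ "conormal _ _"] conormal_inner area_commute[of "q x"]
    by (simp add: inner_commute algebra_simps)
  ultimately show ?thesis by (simp only:)
qed

lemma Ck_on_gram:
  assumes "open S" "Ck_on k S p" "Ck_on k S q"
  shows "Ck_on k S (\<lambda>x. gram (p x) (q x))"
  unfolding gram_def power2_eq_square using assms
  by (intro Ck_on_diff Ck_on_mult Ck_on_inner)

lemma Ck_on_area:
  assumes "open S" "Ck_on k S p" "Ck_on k S q" "\<And>x. x \<in> S \<Longrightarrow> 0 < gram (p x) (q x)"
  shows "Ck_on k S (\<lambda>x. area (p x) (q x))"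
proof -
  have "Ck_on k S (\<lambda>x. gram (p x) (q x) powr (1/2))"
    by (intro Ck_on_powr' Ck_on_gram assms)
  then show ?thesis by (simp add: area_def powr_half_sqrt gram_nonneg)
qed

lemma Ck_on_inverse_area:
  assumes "open S" "Ck_on k S p" "Ck_on k S q" "\<And>x. x \<in> S \<Longrightarrow> 0 < gram (p x) (q x)"
  shows "Ck_on k S (\<lambda>x. inverse (area (p x) (q x)))"
proof -
  have "Ck_on k S (\<lambda>x. gram (p x) (q x) powr (- (1/2)))"
    by (intro Ck_on_powr' Ck_on_gram assms)
  moreover have "gram (p x) (q x) powr (- (1/2)) = inverse (area (p x) (q x))" for x
    by (subst powr_minus) (simp add: area_def powr_half_sqrt gram_nonneg)
  ultimately show ?thesis by simp
qed

lemma Ck_on_conormal: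
  assumes "open S" "Ck_on k S p" "Ck_on k S q" "\<And>x. x \<in> S \<Longrightarrow> 0 < gram (p x) (q x)"
  shows "Ck_on k S (\<lambda>x. conormal (p x) (q x))"
  unfolding conormal_def using assms
  by (intro Ck_on_scaleR Ck_on_inverse_area Ck_on_diff Ck_on_inner)

text \<open>The equality case of Cauchy-Schwarz:
  \<open>(q \<bullet> q) *\<^sub>R p - (p \<bullet> q) *\<^sub>R q\<close> has squared norm
  \<open>(q \<bullet> q) * gram p q\<close>, so a vanishing determinant yields a kernel vector.
  Conversely the conormals are, up to the factor \<open>area\<close>, a dual basis, and pairing with
  them recovers both coordinates of a kernel vector as 0.\<close>

lemma inj_iff_gram_pos:
  fixes L :: "real^2 \<Rightarrow> 'b::real_inner"
  assumes "linear L"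
  shows "inj L \<longleftrightarrow> 0 < gram (L (axis 1 1)) (L (axis 2 1))"
proof -
  interpret linear L by fact
  let ?p = "L (axis 1 1)" and ?q = "L (axis 2 1)"
  have v: "v = v $ 1 *\<^sub>R axis 1 1 + v $ 2 *\<^sub>R axis 2 1" for v :: "real^2"
    by (simp add: vec_eq_iff forall_2 axis_def)
  have L: "L v = v $ 1 *\<^sub>R ?p + v $ 2 *\<^sub>R ?q" for v
    by (subst v) (simp add: add scale)
  have sq: "((?q \<bullet> ?q) *\<^sub>R ?p - (?p \<bullet> ?q) *\<^sub>R ?q) \<bullet> ((?q \<bullet> ?q) *\<^sub>R ?p - (?p \<bullet> ?q) *\<^sub>R ?q)
      = (?q \<bullet> ?q) * gram ?p ?q"
    by (simp add: gram_def inner_diff inner_commute[of ?q ?p] algebra_simps power2_eq_square)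
  show ?thesis
  proof
    assume inj: "inj L"
    then have ker: "v = 0" if "L v = 0" for v
      using that linear_injective_0[OF assms] by blast
    show "0 < gram ?p ?q"
    proof (rule ccontr)
      assume "\<not> 0 < gram ?p ?q"
      then have "gram ?p ?q = 0" using gram_nonneg[of ?p ?q] by linarith
      with sq have "(?q \<bullet> ?q) *\<^sub>R ?p - (?p \<bullet> ?q) *\<^sub>R ?q = 0" by simp
      then have "L ((?q \<bullet> ?q) *\<^sub>R axis 1 1 - (?p \<bullet> ?q) *\<^sub>R axis 2 1) = 0"
        by (simp add: diff scale)
      from ker[OF this] have "((?q \<bullet> ?q) *\<^sub>R axis 1 1 - (?p \<bullet> ?q) *\<^sub>R axis 2 1 :: real^2) $ 1 = (0 :: real^2) $ 1"
        by (rule arg_cong)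
      then have "?q = 0" by (simp add: axis_def)
      with ker[of "axis 2 1"] show False by (simp add: axis_eq_0_iff)
    qed
  next
    assume pos: "0 < gram ?p ?q"
    have "v = 0" if "L v = 0" for v
    proof -
      have "conormal ?p ?q \<bullet> (v $ 1 *\<^sub>R ?p + v $ 2 *\<^sub>R ?q) = 0"
        "conormal ?q ?p \<bullet> (v $ 1 *\<^sub>R ?p + v $ 2 *\<^sub>R ?q) = 0"
        using that L[of v] by simp_all
      then have "v $ 1 * area ?p ?q = 0" "v $ 2 * area ?q ?p = 0"
        using pos conormal_inner_left[of ?p ?q] conormal_inner_right[of ?p ?q]
          conormal_inner_left[of ?q ?p] conormal_inner_right[of ?q ?p]
        by (simp_all add: inner_add_right gram_commute[of ?q ?p])
      then show ?thesis
        using pos by (simp add: vec_eq_iff forall_2 area_def gram_commute[of ?q ?p])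
    qed
    then show "inj L" using linear_injective_0[OF assms] by blast
  qed
qed

subsection \<open>The energy of a coordinate patch\<close>

definition pd :: "2 \<Rightarrow> (real^2 \<Rightarrow> 'b::real_normed_vector) \<Rightarrow> real^2 \<Rightarrow> 'b" where
  "pd i F u = frechet_derivative F (at u) (axis i 1)"

definition energy_density :: "real \<Rightarrow> 'b::euclidean_space \<Rightarrow> (real^2 \<Rightarrow> 'b) \<Rightarrow> real^2 \<Rightarrow> real" where
  "energy_density a e F u = (F u \<bullet> e) powr a * area (pd 1 F u) (pd 2 F u)"

text \<open>The derivative of \<open>energy_density\<close> at \<open>F\<close> in the direction \<open>Z\<close>.\<close>
definition first_variation ::
    "real \<Rightarrow> 'b::euclidean_space \<Rightarrow> (real^2 \<Rightarrow> 'b) \<Rightarrow> (real^2 \<Rightarrow> 'b) \<Rightarrow> real^2 \<Rightarrow> real" where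
  "first_variation a e F Z u =
     a * (F u \<bullet> e) powr (a - 1) * area (pd 1 F u) (pd 2 F u) * (Z u \<bullet> e) +
     (F u \<bullet> e) powr a * (pd 1 Z u \<bullet> conormal (pd 1 F u) (pd 2 F u) +
                           pd 2 Z u \<bullet> conormal (pd 2 F u) (pd 1 F u))"

definition euler_lagrange :: "real \<Rightarrow> 'b::euclidean_space \<Rightarrow> (real^2 \<Rightarrow> 'b) \<Rightarrow> real^2 \<Rightarrow> 'b" where
  "euler_lagrange a e F u =
     (a * (F u \<bullet> e) powr (a - 1) * area (pd 1 F u) (pd 2 F u)) *\<^sub>R e
     - pd 1 (\<lambda>u. (F u \<bullet> e) powr a *\<^sub>R conormal (pd 1 F u) (pd 2 F u)) u
     - pd 2 (\<lambda>u. (F u \<bullet> e) powr a *\<^sub>R conormal (pd 2 F u) (pd 1 F u)) u"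

text \<open>The trace of the second derivative with respect to the induced metric.\<close>
definition trace_second :: "(real^2 \<Rightarrow> 'b::euclidean_space) \<Rightarrow> real^2 \<Rightarrow> 'b" where
  "trace_second F u = inverse (gram (pd 1 F u) (pd 2 F u)) *\<^sub>R
     ((pd 2 F u \<bullet> pd 2 F u) *\<^sub>R pd 1 (pd 1 F) u
      - (2 * (pd 1 F u \<bullet> pd 2 F u)) *\<^sub>R pd 1 (pd 2 F) u
      + (pd 1 F u \<bullet> pd 1 F u) *\<^sub>R pd 2 (pd 2 F) u)"

lemma pd_cong_open:
  assumes "open S" "u \<in> S" "\<And>y. y \<in> S \<Longrightarrow> f y = g y"
  shows "pd i f u = pd i g u"
  unfolding pd_def by (simp only: frechet_derivative_cong_open[OF assms])

lemma Ck_on_pd: "Ck_on (Suc k) S F \<Longrightarrow> Ck_on k S (pd i F)"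
  unfolding pd_def[abs_def] by (rule Ck_on_SucD')

lemma pd_eqI: "(F has_derivative F') (at u) \<Longrightarrow> pd i F u = F' (axis i 1)"
  unfolding pd_def using frechet_derivative_at by metis

locale patch =
  fixes U :: "(real^2) set" and F :: "real^2 \<Rightarrow> 'b::euclidean_space" and e :: 'b and a :: real
  assumes U: "open U" and F: "\<And>k. Ck_on k U F"
    and immersed: "\<And>u. u \<in> U \<Longrightarrow> 0 < gram (pd 1 F u) (pd 2 F u)"
    and pos: "\<And>u. u \<in> U \<Longrightarrow> 0 < F u \<bullet> e"
begin

abbreviation "s u \<equiv> area (pd 1 F u) (pd 2 F u)"
abbreviation "P1 u \<equiv> conormal (pd 1 F u) (pd 2 F u)"
abbreviation "P2 u \<equiv> conormal (pd 2 F u) (pd 1 F u)"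
abbreviation "\<phi> u \<equiv> F u \<bullet> e"

lemma F_derivative: "u \<in> U \<Longrightarrow> (F has_derivative frechet_derivative F (at u)) (at u)"
  by (rule Ck_on_SucD[OF F])

lemma pd_Ck: "Ck_on k U (pd i F)"
  by (rule Ck_on_pd[OF F])

lemma pd_derivative: "u \<in> U \<Longrightarrow> (pd i F has_derivative frechet_derivative (pd i F) (at u)) (at u)"
  by (rule Ck_on_SucD[OF pd_Ck])

lemma immersed': "u \<in> U \<Longrightarrow> 0 < gram (pd 2 F u) (pd 1 F u)"
  using immersed by (subst gram_commute)

lemma P_Ck: "Ck_on k U P1" "Ck_on k U P2"
  by (intro Ck_on_conormal U pd_Ck immersed immersed'; assumption)+

lemma P_derivative:
  "u \<in> U \<Longrightarrow> (P1 has_derivative frechet_derivative P1 (at u)) (at u)"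
  "u \<in> U \<Longrightarrow> (P2 has_derivative frechet_derivative P2 (at u)) (at u)"
  by (rule Ck_on_SucD[OF P_Ck(1)] Ck_on_SucD[OF P_Ck(2)], assumption)+

lemma phi_Ck: "Ck_on k U (\<lambda>u. \<phi> u powr b)"
  by (intro Ck_on_powr' Ck_on_inner F Ck_on_const U pos)

lemma s_Ck: "Ck_on k U s"
  by (intro Ck_on_area U pd_Ck immersed)

lemma phiP_Ck: "Ck_on k U (\<lambda>u. \<phi> u powr a *\<^sub>R P1 u)" "Ck_on k U (\<lambda>u. \<phi> u powr a *\<^sub>R P2 u)"
  by (intro Ck_on_scaleR U phi_Ck P_Ck)+

lemma euler_lagrange_Ck: "Ck_on k U (euler_lagrange a e F)"
  unfolding euler_lagrange_def[abs_def]
  by (intro Ck_on_diff Ck_on_scaleR Ck_on_mult Ck_on_const phi_Ck s_Ck U Ck_on_pd phiP_Ck)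

lemma first_variation_continuous:
  assumes "Ck_on 1 U Z"
  shows "continuous_on U (first_variation a e F Z)"
proof -
  have "continuous_on U (\<lambda>u. \<phi> u powr b)" "continuous_on U s" "continuous_on U P1" "continuous_on U P2"
    "continuous_on U Z" "continuous_on U (pd i Z)" for b i
    using phi_Ck s_Ck P_Ck assms Ck_on_pd[of 0 U Z i] by (auto intro: Ck_on_imp_continuous)
  then show ?thesis
    unfolding first_variation_def[abs_def]
    by (intro continuous_on_add continuous_on_mult continuous_on_inner continuous_on_const)
qed

lemma pd_commute: "u \<in> U \<Longrightarrow> pd i (pd j F) u = pd j (pd i F) u"
  unfolding pd_def[abs_def] by (rule symmetric_second_derivative[OF U _ F])

lemma phi_powr_derivative:
  assumes "u \<in> U"
  shows "((\<lambda>u. \<phi> u powr a) has_derivative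
    (\<lambda>v. a * \<phi> u powr (a - 1) * (frechet_derivative F (at u) v \<bullet> e))) (at u)"
proof -
  have "((\<lambda>u. \<phi> u) has_derivative (\<lambda>v. frechet_derivative F (at u) v \<bullet> e)) (at u)"
    by (intro has_derivative_inner_left F_derivative assms)
  moreover have "((\<lambda>x. x powr a) has_derivative (\<lambda>h. a * \<phi> u powr (a - 1) * h)) (at (\<phi> u))"
    using has_real_derivative_powr[OF pos[OF assms], of a] by (simp add: has_field_derivative_def)
  ultimately show ?thesis
    using has_derivative_compose by fastforce
qed

lemma first_variation_minus_euler_lagrange:
  assumes u: "u \<in> U" and Z: "(Z has_derivative Z') (at u)"
  shows "first_variation a e F Z u - euler_lagrange a e F u \<bullet> Z u =
    pd 1 (\<lambda>u. (\<phi> u powr a *\<^sub>R P1 u) \<bullet> Z u) u + pd 2 (\<lambda>u. (\<phi> u powr a *\<^sub>R P2 u) \<bullet> Z u) u"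
proof -
  have "((\<lambda>u. X u \<bullet> Z u) has_derivative (\<lambda>v. X u \<bullet> Z' v + frechet_derivative X (at u) v \<bullet> Z u)) (at u)"
    if "\<And>k. Ck_on k U X" for X
    by (intro has_derivative_inner Z Ck_on_SucD[OF that u])
  from pd_eqI[OF this] have prod: "pd i (\<lambda>u. X u \<bullet> Z u) u = X u \<bullet> pd i Z u + pd i X u \<bullet> Z u"
    if "\<And>k. Ck_on k U X" for X i
    using that pd_eqI[OF Z] by (simp add: pd_def)
  show ?thesis
    unfolding prod[OF phiP_Ck(1)] prod[OF phiP_Ck(2)] first_variation_def euler_lagrange_def
    by (simp add: inner_diff_left inner_commute algebra_simps)
qed

lemma s_derivative:
  assumes "u \<in> U"
  shows "pd i s u = pd i (pd 1 F) u \<bullet> P1 u + pd i (pd 2 F) u \<bullet> P2 u"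
  using pd_eqI[OF has_derivative_area[OF pd_derivative pd_derivative immersed]] assms
  by (simp add: pd_def)

lemma euler_lagrange_expand:
  assumes u: "u \<in> U"
  shows "euler_lagrange a e F u \<bullet> n = a * \<phi> u powr (a - 1) *
      (s u * (e \<bullet> n) - (pd 1 F u \<bullet> e) * (P1 u \<bullet> n) - (pd 2 F u \<bullet> e) * (P2 u \<bullet> n))
      - \<phi> u powr a * (pd 1 P1 u \<bullet> n + pd 2 P2 u \<bullet> n)"
proof -
  have "pd i (\<lambda>u. \<phi> u powr a *\<^sub>R X u) u =
      \<phi> u powr a *\<^sub>R pd i X u + (a * \<phi> u powr (a - 1) * (pd i F u \<bullet> e)) *\<^sub>R X u"
    if "(X has_derivative frechet_derivative X (at u)) (at u)" for X :: "real^2 \<Rightarrow> 'b" and i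
    using pd_eqI[OF has_derivative_scaleR[OF phi_powr_derivative[OF u] that]] by (simp add: pd_def)
  from this[OF P_derivative(1)[OF u]] this[OF P_derivative(2)[OF u]] show ?thesis
    unfolding euler_lagrange_def by (simp add: inner_diff_left inner_add_left algebra_simps)
qed

lemma divergence_inner:
  assumes u: "u \<in> U" and X: "(X has_derivative frechet_derivative X (at u)) (at u)"
    and V: "(V has_derivative frechet_derivative V (at u)) (at u)"
  shows "pd i X u \<bullet> V u = pd i (\<lambda>u. X u \<bullet> V u) u - X u \<bullet> pd i V u"
  using pd_eqI[OF has_derivative_inner[OF X V]] by (simp add: pd_def)

text \<open>The infinitesimal form of invariance under reparametrization. The duality relations
  between conormals and tangent vectors are differentiated; the derivative of \<open>s\<close> and
  the symmetry of second derivatives then cancel everything.\<close>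

lemma euler_lagrange_tangential:
  assumes u: "u \<in> U"
  shows "euler_lagrange a e F u \<bullet> pd 1 F u = 0" "euler_lagrange a e F u \<bullet> pd 2 F u = 0"
proof -
  have P: "P1 v \<bullet> pd 1 F v = s v" "P2 v \<bullet> pd 2 F v = s v" "P1 v \<bullet> pd 2 F v = 0" "P2 v \<bullet> pd 1 F v = 0"
    if "v \<in> U" for v
    using conormal_inner_left[OF immersed[OF that]] conormal_inner_left[of "pd 2 F v" "pd 1 F v"]
      immersed[OF that] gram_commute[of "pd 1 F v"] area_commute[of "pd 1 F v"]
    by (simp_all add: conormal_inner_right)
  have D: "pd 1 P1 u \<bullet> pd 1 F u = pd 1 s u - P1 u \<bullet> pd 1 (pd 1 F) u"
    "pd 2 P2 u \<bullet> pd 1 F u = - (P2 u \<bullet> pd 2 (pd 1 F) u)"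
    "pd 1 P1 u \<bullet> pd 2 F u = - (P1 u \<bullet> pd 1 (pd 2 F) u)"
    "pd 2 P2 u \<bullet> pd 2 F u = pd 2 s u - P2 u \<bullet> pd 2 (pd 2 F) u"
    using divergence_inner[OF u P_derivative(1)[OF u] pd_derivative[OF u]]
      divergence_inner[OF u P_derivative(2)[OF u] pd_derivative[OF u]]
      pd_cong_open[OF U u P(1)] pd_cong_open[OF U u P(2)] pd_cong_open[OF U u P(3)] pd_cong_open[OF U u P(4)]
      pd_eqI[OF has_derivative_const[of "0::real"]]
    by simp_all
  show "euler_lagrange a e F u \<bullet> pd 1 F u = 0" "euler_lagrange a e F u \<bullet> pd 2 F u = 0"
    unfolding euler_lagrange_expand[OF u] D P[OF u] s_derivative[OF u]
    using pd_commute[OF u, of 1 2]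
    by (simp_all add: inner_commute algebra_simps)
qed

text \<open>The vector \<open>n\<close> is fixed and normal at the single point \<open>u\<close>.
  Against it the conormals vanish at \<open>u\<close>, and the divergence of the conormals reduces
  to the second derivatives of \<open>F\<close>, whose combination is \<open>s u\<close> times the
  trace.\<close>

lemma euler_lagrange_normal:
  assumes u: "u \<in> U" and n: "pd 1 F u \<bullet> n = 0" "pd 2 F u \<bullet> n = 0"
  shows "euler_lagrange a e F u \<bullet> n =
    (s u * \<phi> u powr (a - 1)) * (a * (e \<bullet> n) - \<phi> u * (trace_second F u \<bullet> n))"
proof -
  let ?w = "\<lambda>u. inverse (s u)"
  have w: "(?w has_derivative frechet_derivative ?w (at u)) (at u)"
    by (rule Ck_on_SucD[OF Ck_on_inverse_area[OF U pd_Ck pd_Ck immersed] u])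
  have nn: "pd i F u \<bullet> n = 0" for i
    using exhaust_2[of i] n by auto
  \<comment> \<open>In the product rule the derivatives of the coefficients are multiplied by
    \<open>pd i F u \<bullet> n\<close>, which is 0 at \<open>u\<close>.\<close>
  have lin: "((\<lambda>u. (c u * (pd j F u \<bullet> n) - d u * (pd k F u \<bullet> n))) has_derivative
      (\<lambda>v. c u * (frechet_derivative (pd j F) (at u) v \<bullet> n) - d u * (frechet_derivative (pd k F) (at u) v \<bullet> n))) (at u)"
    if "\<And>k. Ck_on k U c" "\<And>k. Ck_on k U d" for c d j k
    by (rule has_derivative_eq_rhs, (rule derivative_intros Ck_on_SucD[OF that(1) u] Ck_on_SucD[OF that(2) u] pd_derivative[OF u])+)
      (simp add: nn)
  have inner_Ck: "Ck_on k U (\<lambda>u. pd i F u \<bullet> pd j F u)" for i j k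
    by (intro Ck_on_inner U pd_Ck)
  have D1: "pd 1 P1 u \<bullet> n = inverse (s u) * ((pd 2 F u \<bullet> pd 2 F u) * (pd 1 (pd 1 F) u \<bullet> n)
      - (pd 1 F u \<bullet> pd 2 F u) * (pd 1 (pd 2 F) u \<bullet> n))"
  proof -
    have "pd 1 P1 u \<bullet> n = pd 1 (\<lambda>u. P1 u \<bullet> n) u"
      using pd_eqI[OF has_derivative_inner_left[OF P_derivative(1)[OF u]]] by (simp add: pd_def)
    then show ?thesis
      unfolding conormal_inner
      using pd_eqI[OF has_derivative_mult[OF w lin[OF inner_Ck inner_Ck]]] n by (simp add: pd_def)
  qed
  have D2: "pd 2 P2 u \<bullet> n = inverse (s u) * ((pd 1 F u \<bullet> pd 1 F u) * (pd 2 (pd 2 F) u \<bullet> n)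
      - (pd 2 F u \<bullet> pd 1 F u) * (pd 2 (pd 1 F) u \<bullet> n))"
  proof -
    have "pd 2 P2 u \<bullet> n = pd 2 (\<lambda>u. P2 u \<bullet> n) u"
      using pd_eqI[OF has_derivative_inner_left[OF P_derivative(2)[OF u]]] by (simp add: pd_def)
    then show ?thesis
      unfolding conormal_inner area_commute[of "pd 2 F _"]
      using pd_eqI[OF has_derivative_mult[OF w lin[OF inner_Ck inner_Ck]]] n by (simp add: pd_def)
  qed
  have "pd 1 P1 u \<bullet> n + pd 2 P2 u \<bullet> n = s u * (trace_second F u \<bullet> n)"
  proof -
    have "inverse (s u) = s u * inverse (gram (pd 1 F u) (pd 2 F u))"
      using immersed[OF u] by (simp add: divide_simps flip: area_square(2))
    then show ?thesis
      unfolding D1 D2 trace_second_def using pd_commute[OF u, of 2 1]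
      by (simp add: inner_diff_left inner_add_left inner_commute[of "pd 2 F u" "pd 1 F u"] algebra_simps)
  qed
  moreover have "P1 u \<bullet> n = 0" "P2 u \<bullet> n = 0"
    using n by (simp_all add: conormal_inner)
  moreover have "\<phi> u powr a = \<phi> u powr (a - 1) * \<phi> u"
    using pos[OF u] by (simp add: powr_diff)
  ultimately show ?thesis
    unfolding euler_lagrange_expand[OF u] by (simp add: algebra_simps)
qed

lemma pd_eq_0_outside:
  assumes "closed C" "\<And>u. u \<in> U \<Longrightarrow> u \<notin> C \<Longrightarrow> Z u = 0" "u \<in> U" "u \<notin> C"
  shows "pd i Z u = 0"
proof -
  have "pd i Z u = pd i (\<lambda>_. 0) u"
    by (rule pd_cong_open[of "U - C"]) (use assms U in auto)
  then show ?thesis using pd_eqI[OF has_derivative_const] by metis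
qed

lemma first_variation_eq_0_outside:
  assumes "closed C" "\<And>u. u \<in> U \<Longrightarrow> u \<notin> C \<Longrightarrow> Z u = 0" "u \<in> U" "u \<notin> C"
  shows "first_variation a e F Z u = 0"
  using pd_eq_0_outside[OF assms] assms(2-4) by (simp add: first_variation_def)

text \<open>Integration by parts: the difference of the two integrands is a sum of coordinate
  derivatives of functions supported in \<open>C\<close>, and each of these integrates to 0.\<close>

lemma first_variation_integral:
  assumes Z: "Ck_on 1 U Z" and C: "compact C" "C \<subseteq> U" and 0: "\<And>u. u \<in> U \<Longrightarrow> u \<notin> C \<Longrightarrow> Z u = 0"
  shows "integrable lborel (\<lambda>u. indicator U u * first_variation a e F Z u)"
    and "integrable lborel (\<lambda>u. indicator U u * (euler_lagrange a e F u \<bullet> Z u))"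
    and "(\<integral>u. indicator U u * first_variation a e F Z u \<partial>lborel) =
         (\<integral>u. indicator U u * (euler_lagrange a e F u \<bullet> Z u) \<partial>lborel)"
proof -
  have cl: "closed C" using C compact_imp_closed by blast
  have cong: "continuous_on C (\<lambda>u. indicator U u * f u)" if "continuous_on U f" for f :: "real^2 \<Rightarrow> real"
    using continuous_on_subset[OF that C(2)] by (rule continuous_on_eq) (use C in \<open>auto simp: indicator_def\<close>)
  show int1: "integrable lborel (\<lambda>u. indicator U u * first_variation a e F Z u)"
    by (rule integrable_compact_support[OF C(1) cong[OF first_variation_continuous[OF Z]]])
      (use first_variation_eq_0_outside[OF cl 0] in \<open>auto simp: indicator_def\<close>)
  have "continuous_on U (\<lambda>u. euler_lagrange a e F u \<bullet> Z u)"
    using Ck_on_imp_continuous[OF euler_lagrange_Ck] Ck_on_imp_continuous[OF Z]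
    by (intro continuous_on_inner)
  then show int2: "integrable lborel (\<lambda>u. indicator U u * (euler_lagrange a e F u \<bullet> Z u))"
    by (intro integrable_compact_support[OF C(1) cong]) (use 0 in \<open>auto simp: indicator_def\<close>)
  have zero: "integrable lborel (\<lambda>u. indicator U u * pd i (\<lambda>u. X u \<bullet> Z u) u)"
     "(\<integral>u. indicator U u * pd i (\<lambda>u. X u \<bullet> Z u) u \<partial>lborel) = 0"
    if X: "Ck_on 1 U X" for X i
  proof -
    \<comment> \<open>Extension by zero. It is of class C^1 on the whole plane because it is so on
      the open sets \<open>U\<close> and \<open>- C\<close>, which together cover the plane.\<close>
    define Y where "Y u = (if u \<in> U then X u \<bullet> Z u else 0)" for u
    have "Ck_on 1 U (\<lambda>u. X u \<bullet> Z u)" by (intro Ck_on_inner U X Z)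
    then have "Ck_on 1 U Y" by (rule Ck_on_cong[OF U, rotated]) (simp add: Y_def)
    moreover have "Ck_on 1 (- C) Y"
      by (rule Ck_on_cong[OF _ _ Ck_on_const[of _ _ 0]]) (use cl 0 in \<open>auto simp: Y_def\<close>)
    ultimately have "Ck_on 1 (U \<union> - C) Y" using U cl by (intro Ck_on_Un) auto
    moreover have "U \<union> - C = UNIV" using C by auto
    ultimately have Y: "Ck_on (Suc 0) UNIV Y" by simp
    have Y0: "Y u = 0" if "u \<notin> C" for u using that 0 by (auto simp: Y_def)
    have pdY: "pd i Y u = indicator U u * pd i (\<lambda>u. X u \<bullet> Z u) u" for u
    proof (cases "u \<in> U")
      case True
      then show ?thesis using pd_cong_open[OF U True, of Y] by (simp add: Y_def)
    next
      case False
      have "pd i Y u = pd i (\<lambda>_. 0) u"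
        by (rule pd_cong_open[of "- C"]) (use False C cl Y0 in auto)
      then show ?thesis using False pd_eqI[OF has_derivative_const[of "0::real"]] by simp
    qed
    have cont: "continuous_on UNIV (pd i Y)"
      using Ck_on_pd[OF Y] by simp
    have "pd i Y u = 0" if "u \<notin> C" for u
    proof -
      have "pd i Y u = pd i (\<lambda>_. 0) u"
        by (rule pd_cong_open[of "- C"]) (use that cl Y0 in auto)
      then show ?thesis using pd_eqI[OF has_derivative_const[of "0::real"]] by simp
    qed
    then show "integrable lborel (\<lambda>u. indicator U u * pd i (\<lambda>u. X u \<bullet> Z u) u)"
      using integrable_compact_support[OF C(1) continuous_on_subset[OF cont]] by (simp add: pdY[abs_def])
    have "integral\<^sup>L lborel (pd i Y) = 0"
      unfolding pd_def[abs_def]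
      by (rule integral_directional_derivative_eq_0[OF Ck_on_SucD[OF Y UNIV_I] _ C(1) Y0])
        (use cont in \<open>simp_all add: pd_def[abs_def]\<close>)
    then show "(\<integral>u. indicator U u * pd i (\<lambda>u. X u \<bullet> Z u) u \<partial>lborel) = 0"
      by (simp add: pdY[abs_def])
  qed
  let ?d = "\<lambda>u. indicator U u * pd 1 (\<lambda>u. (\<phi> u powr a *\<^sub>R P1 u) \<bullet> Z u) u"
  let ?d' = "\<lambda>u. indicator U u * pd 2 (\<lambda>u. (\<phi> u powr a *\<^sub>R P2 u) \<bullet> Z u) u"
  have "indicator U u * first_variation a e F Z u =
      indicator U u * (euler_lagrange a e F u \<bullet> Z u) + (?d u + ?d' u)" for u
    using first_variation_minus_euler_lagrange[of u Z, OF _ Ck_on_SucD[of 0 U Z]] Z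
    by (cases "u \<in> U") (simp_all add: algebra_simps)
  then show "(\<integral>u. indicator U u * first_variation a e F Z u \<partial>lborel) =
         (\<integral>u. indicator U u * (euler_lagrange a e F u \<bullet> Z u) \<partial>lborel)"
    using zero[OF phiP_Ck(1), of 1] zero[OF phiP_Ck(2), of 2] int2
    by (simp only: Bochner_Integration.integral_add Bochner_Integration.integrable_add)
qed

end

subsection \<open>Variations of a coordinate patch\<close>

lemma has_derivative_slice:
  assumes "(H has_derivative H') (at (t, u))"
  shows "((\<lambda>u. H (t, u)) has_derivative (\<lambda>v. H' (0, v))) (at u)"
    and "((\<lambda>t. H (t, u)) has_derivative (\<lambda>r. H' (r, 0))) (at t)"
proof -
  have "((\<lambda>u. (t, u)) has_derivative (\<lambda>v. (0, v))) (at u)" "((\<lambda>t. (t, u)) has_derivative (\<lambda>r. (r, 0))) (at t)"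
    by (auto intro!: derivative_eq_intros)
  from this[THEN has_derivative_compose] assms show
    "((\<lambda>u. H (t, u)) has_derivative (\<lambda>v. H' (0, v))) (at u)"
    "((\<lambda>t. H (t, u)) has_derivative (\<lambda>r. H' (r, 0))) (at t)" by auto
qed

text \<open>Time becomes one more coordinate of a single map, so that exchanging time and space
  derivatives is an instance of the symmetry of second derivatives. Positivity is demanded at time 0
  only.\<close>

locale patch_variation =
  fixes U :: "(real^2) set" and \<Psi> :: "real \<times> (real^2) \<Rightarrow> 'b::euclidean_space"
    and e :: 'b and a \<epsilon> :: real
  assumes open_U: "open U" and eps: "0 < \<epsilon>" and Psi: "\<And>k. Ck_on k ({-\<epsilon><..<\<epsilon>} \<times> U) \<Psi>"
    and immersions: "\<And>t u. \<bar>t\<bar> < \<epsilon> \<Longrightarrow> u \<in> U \<Longrightarrow>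
      0 < gram (pd 1 (\<lambda>u. \<Psi> (t, u)) u) (pd 2 (\<lambda>u. \<Psi> (t, u)) u)"
    and positive: "\<And>u. u \<in> U \<Longrightarrow> 0 < \<Psi> (0, u) \<bullet> e"
begin

abbreviation "\<Omega> \<equiv> {-\<epsilon><..<\<epsilon>} \<times> U"
abbreviation "dt H z \<equiv> frechet_derivative H (at z) (1::real, 0::real^2)"
abbreviation "dx i H z \<equiv> frechet_derivative H (at z) (0::real, axis i (1::real) :: real^2)"

lemma open_Omega: "open \<Omega>"
  using open_U by (simp add: open_Times)

lemma Ck_on_slice:
  assumes "Ck_on k \<Omega> H"
  shows "Ck_on k U (\<lambda>u. H (0, u))"
proof (rule Ck_on_compose[OF open_U open_Omega _ assms])
  show "Ck_on k U (\<lambda>u. (0, u))"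
    by (intro Ck_on_linear bounded_linear_Pair bounded_linear_zero bounded_linear_ident)
qed (use eps in auto)

lemma pd_slice:
  assumes "(t, u) \<in> \<Omega>" "Ck_on (Suc k) \<Omega> H"
  shows "pd i (\<lambda>u. H (t, u)) u = dx i H (t, u)"
  by (rule pd_eqI[OF has_derivative_slice(1)[OF Ck_on_SucD[OF assms(2,1)]]])

definition velocity :: "real^2 \<Rightarrow> 'b" where
  "velocity u = dt \<Psi> (0, u)"

lemma velocity_Ck: "Ck_on k U velocity"
  unfolding velocity_def[abs_def] by (rule Ck_on_slice[OF Ck_on_SucD'[OF Psi]])

sublocale patch U "\<lambda>u. \<Psi> (0, u)" e a
  by unfold_locales (use open_U positive immersions[of 0] eps Ck_on_slice[OF Psi] in auto)

definition density :: "real \<times> (real^2) \<Rightarrow> real" where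
  "density z = (\<Psi> z \<bullet> e) powr a * area (dx 1 \<Psi> z) (dx 2 \<Psi> z)"

lemma energy_density_eq:
  assumes "(t, u) \<in> \<Omega>"
  shows "energy_density a e (\<lambda>u. \<Psi> (t, u)) u = density (t, u)"
  unfolding energy_density_def density_def pd_slice[OF assms Psi] ..

text \<open>Away from time 0 the height \<open>\<Psi> z \<bullet> e\<close> may lose its sign.
  Smoothness of the real power is available on this open set, which contains
  \<open>{0} \<times> U\<close>.\<close>

definition \<Omega>' :: "(real \<times> (real^2)) set" where
  "\<Omega>' = \<Omega> \<inter> (\<lambda>z. \<Psi> z \<bullet> e) -` {0<..}"

lemma open_Omega_pos: "open \<Omega>'"
  unfolding \<Omega>'_def
  by (intro continuous_open_preimage open_Omega continuous_on_inner continuous_on_const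
      Ck_on_imp_continuous[OF Psi]) auto

lemma gram_pos:
  assumes "z \<in> \<Omega>"
  shows "0 < gram (dx 1 \<Psi> z) (dx 2 \<Psi> z)"
proof -
  obtain t u where z: "z = (t, u)" "(t, u) \<in> \<Omega>" using assms by (cases z) auto
  then show ?thesis
    using immersions[of t u] pd_slice[OF z(2) Psi] by auto
qed

lemma density_Ck: "Ck_on k \<Omega>' density"
proof -
  have *: "Ck_on k \<Omega>' \<Psi>" "Ck_on k \<Omega>' (\<lambda>z. frechet_derivative \<Psi> (at z) v)" for v
    using Ck_on_subset[OF Psi] Ck_on_subset[OF Ck_on_SucD'[OF Psi]] by (auto simp: \<Omega>'_def)
  show ?thesis
    unfolding density_def[abs_def]
    by (intro Ck_on_mult Ck_on_powr' Ck_on_area Ck_on_inner Ck_on_const * open_Omega_pos gram_pos)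
      (auto simp: \<Omega>'_def)
qed

text \<open>The area depends on the space derivatives of \<open>\<Psi>\<close>; commuting them with
  the time derivative turns them into space derivatives of the velocity.\<close>

lemma density_derivative_0:
  assumes u: "u \<in> U"
  shows "dt density (0, u) = first_variation a e (\<lambda>u. \<Psi> (0, u)) velocity u"
proof -
  let ?z = "(0, u) :: real \<times> (real^2)"
  have z: "?z \<in> \<Omega>" using u eps by auto
  have pos0: "0 < \<Psi> ?z \<bullet> e" by (rule positive[OF u])
  have d1: "((\<lambda>z. \<Psi> z \<bullet> e) has_derivative (\<lambda>v. frechet_derivative \<Psi> (at ?z) v \<bullet> e)) (at ?z)"
    by (intro has_derivative_inner_left Ck_on_SucD[OF Psi z])
  have "((\<lambda>x. x powr a) has_derivative (\<lambda>h. a * (\<Psi> ?z \<bullet> e) powr (a - 1) * h)) (at (\<Psi> ?z \<bullet> e))"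
    using has_real_derivative_powr[OF pos0, of a] by (simp add: has_field_derivative_def)
  from has_derivative_compose[OF d1 this]
  have d2: "((\<lambda>z. (\<Psi> z \<bullet> e) powr a) has_derivative
    (\<lambda>v. a * (\<Psi> ?z \<bullet> e) powr (a - 1) * (frechet_derivative \<Psi> (at ?z) v \<bullet> e))) (at ?z)" .
  have Psi2: "(\<lambda>z. frechet_derivative \<Psi> (at z) v) differentiable (at ?z)" for v
    using Ck_on_SucD'[OF Psi[of "Suc (Suc 0)"], of v] z by (simp add: Ck_on.simps(2))
  then have d3: "((\<lambda>z. frechet_derivative \<Psi> (at z) v) has_derivative
      frechet_derivative (\<lambda>z. frechet_derivative \<Psi> (at z) v) (at ?z)) (at ?z)" for v
    by (simp add: frechet_derivative_works)
  from has_derivative_mult[OF d2 has_derivative_area[OF d3 d3 gram_pos[OF z]]]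
  have "dt density ?z = (\<Psi> ?z \<bullet> e) powr a *
     (dt (dx 1 \<Psi>) ?z \<bullet> conormal (dx 1 \<Psi> ?z) (dx 2 \<Psi> ?z) +
      dt (dx 2 \<Psi>) ?z \<bullet> conormal (dx 2 \<Psi> ?z) (dx 1 \<Psi> ?z)) +
     a * (\<Psi> ?z \<bullet> e) powr (a - 1) * (dt \<Psi> ?z \<bullet> e) * area (dx 1 \<Psi> ?z) (dx 2 \<Psi> ?z)"
    unfolding density_def[abs_def] using frechet_derivative_at by (metis (no_types, lifting))
  moreover have "dt (dx i \<Psi>) ?z = pd i velocity u" for i
  proof -
    have "dt (dx i \<Psi>) ?z = dx i (dt \<Psi>) ?z"
      by (rule symmetric_second_derivative[OF open_Omega z Psi])
    also have "\<dots> = pd i velocity u"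
      unfolding velocity_def[abs_def]
      by (rule pd_slice[symmetric, OF z Ck_on_SucD'[OF Psi[of "Suc (Suc 0)"]]])
    finally show ?thesis .
  qed
  ultimately show ?thesis
    unfolding first_variation_def pd_slice[OF z Psi]
    by (simp add: velocity_def algebra_simps)
qed

text \<open>Only \<open>t\<close> is differentiated, so the weight enters as a bounded factor and
  its discontinuities are harmless. The dominating function is a bound for the time derivative of
  the density on a compact strip over \<open>C\<close>.\<close>

lemma weighted_energy_derivative:
  assumes C: "compact C" "C \<subseteq> U" and m: "m \<in> borel_measurable borel" "\<And>u. \<bar>m u\<bar> \<le> 1"
    and m0: "\<And>u. u \<notin> C \<Longrightarrow> m u = 0"
  obtains \<delta> where "0 < \<delta>" "\<delta> \<le> \<epsilon>"
    "\<And>t. \<bar>t\<bar> < \<delta> \<Longrightarrow> integrable lborel (\<lambda>u. m u * energy_density a e (\<lambda>u. \<Psi> (t, u)) u)"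
    "((\<lambda>t. \<integral>u. m u * energy_density a e (\<lambda>u. \<Psi> (t, u)) u \<partial>lborel) has_real_derivative
       (\<integral>u. m u * first_variation a e (\<lambda>u. \<Psi> (0, u)) velocity u \<partial>lborel)) (at 0)"
proof -
  have "compact ({0} \<times> C)" using C by (intro compact_Times) auto
  moreover have "{0} \<times> C \<subseteq> \<Omega>'" using C positive eps by (auto simp: \<Omega>'_def)
  \<comment> \<open>A uniform tube around the compact slice at time 0, inside the set where the
    density is smooth.\<close>
  ultimately obtain r where r: "0 < r" "(\<Union>z\<in>{0} \<times> C. ball z r) \<subseteq> \<Omega>'"
    using compact_subset_open_imp_ball_epsilon_subset[OF _ open_Omega_pos] by blast
  \<comment> \<open>Half the radius, so that the closed strip still lies in the open tube.\<close>
  define \<delta> where "\<delta> = r / 2"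
  have \<delta>: "0 < \<delta>" using r by (simp add: \<delta>_def)
  have sub: "{-\<delta>..\<delta>} \<times> C \<subseteq> \<Omega>'"
  proof safe
    fix t u assume "t \<in> {-\<delta>..\<delta>}" "u \<in> C"
    then have "(t, u) \<in> ball (0, u) r" using r by (auto simp: dist_Pair_Pair dist_real_def \<delta>_def)
    then show "(t, u) \<in> \<Omega>'" using r(2) \<open>u \<in> C\<close> by blast
  qed
  define \<delta>' where "\<delta>' = min \<delta> \<epsilon>"
  have \<delta>': "0 < \<delta>'" "\<delta>' \<le> \<epsilon>" "\<delta>' \<le> \<delta>" using \<delta> eps by (auto simp: \<delta>'_def)
  have memb: "(t, u) \<in> \<Omega>'" "(t, u) \<in> \<Omega>" if "\<bar>t\<bar> < \<delta>'" "u \<in> C" for t u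
  proof -
    have "t \<in> {-\<delta>..\<delta>}" using that \<delta>' by auto
    then show "(t, u) \<in> \<Omega>'" using sub that by blast
    then show "(t, u) \<in> \<Omega>" by (simp add: \<Omega>'_def)
  qed
  have eq: "m u * energy_density a e (\<lambda>u. \<Psi> (t, u)) u = m u * (indicator C u *\<^sub>R density (t, u))"
    if "\<bar>t\<bar> < \<delta>'" for t u
    using memb(2)[OF that, of u] energy_density_eq[of t u] m0[of u] by (cases "u \<in> C") auto
  have cont: "continuous_on ({-\<delta>..\<delta>} \<times> C) (dt density)"
    using Ck_on_imp_continuous[OF Ck_on_SucD'[OF density_Ck]] sub continuous_on_subset by blast
  have "bounded (dt density ` ({-\<delta>..\<delta>} \<times> C))"
    using C by (intro compact_imp_bounded compact_continuous_image cont compact_Times) auto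
  then obtain B where B: "B > 0" "\<And>z. z \<in> {-\<delta>..\<delta>} \<times> C \<Longrightarrow> \<bar>dt density z\<bar> \<le> B"
    by (auto simp: bounded_pos)
  have int: "integrable lborel (\<lambda>u. m u * (indicator C u *\<^sub>R density (t, u)))" if "\<bar>t\<bar> < \<delta>'" for t
  proof -
    have "continuous_on C (\<lambda>u. density (t, u))"
      by (rule continuous_on_compose2[OF Ck_on_imp_continuous[OF density_Ck[of 0]]])
        (use memb(1)[OF that] in \<open>auto intro!: continuous_intros\<close>)
    from integrable_weight[OF C(1) this m m0]
    have "integrable lborel (\<lambda>u. m u * density (t, u))" .
    moreover have "m u * density (t, u) = m u * (indicator C u *\<^sub>R density (t, u))" for u
      using m0[of u] by (cases "u \<in> C") auto
    ultimately show ?thesis by simp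
  qed
  have "((\<lambda>t. \<integral>u. m u * (indicator C u *\<^sub>R density (t, u)) \<partial>lborel) has_real_derivative
       (\<integral>u. m u * (indicator C u *\<^sub>R dt density (0, u)) \<partial>lborel)) (at 0)"
  proof (rule has_real_derivative_integral[OF \<delta>'(1), where w = "\<lambda>u. indicator C u *\<^sub>R B"])
    fix t u assume t: "\<bar>t\<bar> < \<delta>'"
    show "((\<lambda>t. m u * (indicator C u *\<^sub>R density (t, u))) has_real_derivative
      m u * (indicator C u *\<^sub>R dt density (t, u))) (at t)"
    proof (cases "u \<in> C")
      case True
      have "((\<lambda>t. density (t, u)) has_derivative (\<lambda>r. frechet_derivative density (at (t, u)) (r, 0))) (at t)"
        by (rule has_derivative_slice(2)[OF Ck_on_SucD[OF density_Ck memb(1)[OF t True]]])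
      moreover have "frechet_derivative density (at (t, u)) (r, 0) = dt density (t, u) * r" for r
        using linear_cmul[OF has_derivative_linear[OF Ck_on_SucD[OF density_Ck memb(1)[OF t True]]], of r "(1, 0)"]
        by (simp add: mult.commute)
      ultimately have "((\<lambda>t. density (t, u)) has_real_derivative dt density (t, u)) (at t)"
        unfolding has_field_derivative_def by (rule has_derivative_eq_rhs[OF _ ext])
      from DERIV_cmult[OF this, of "m u"] show ?thesis using True by simp
    qed simp
    have "\<bar>m u\<bar> * \<bar>dt density (t, u)\<bar> \<le> 1 * B" if "u \<in> C"
    proof -
      have "(t, u) \<in> {-\<delta>..\<delta>} \<times> C" using t that \<delta>' by auto
      from B(2)[OF this] show ?thesis by (intro mult_mono m(2)) auto
    qed
    then show "\<bar>m u * (indicator C u *\<^sub>R dt density (t, u))\<bar> \<le> indicator C u *\<^sub>R B"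
      using B(1) by (auto simp: abs_mult indicator_def)
  qed (use int borel_integrable_compact[OF C(1) continuous_on_const[of C B]] in auto)
  moreover have "m u * (indicator C u *\<^sub>R dt density (0, u)) =
      m u * first_variation a e (\<lambda>u. \<Psi> (0, u)) velocity u" for u
    using m0[of u] density_derivative_0[of u] C(2) by (cases "u \<in> C") auto
  ultimately have D: "((\<lambda>t. \<integral>u. m u * (indicator C u *\<^sub>R density (t, u)) \<partial>lborel) has_real_derivative
       (\<integral>u. m u * first_variation a e (\<lambda>u. \<Psi> (0, u)) velocity u \<partial>lborel)) (at 0)"
    by (simp only:)
  show ?thesis
  proof (rule that[OF \<delta>'(1,2)])
    show "integrable lborel (\<lambda>u. m u * energy_density a e (\<lambda>u. \<Psi> (t, u)) u)" if "\<bar>t\<bar> < \<delta>'" for t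
      using int[OF that] by (simp only: eq[OF that])
    show "((\<lambda>t. \<integral>u. m u * energy_density a e (\<lambda>u. \<Psi> (t, u)) u \<partial>lborel) has_real_derivative
       (\<integral>u. m u * first_variation a e (\<lambda>u. \<Psi> (0, u)) velocity u \<partial>lborel)) (at 0)"
      by (rule has_field_derivative_transform_within[OF D \<delta>'(1)]) (simp_all only: eq dist_real_def UNIV_I diff_zero)
  qed
qed

end

subsection \<open>Change of charts\<close>

text \<open>Under a linear change of the pair the Gram matrix is multiplied by the coefficient
  matrix from one side and its transpose from the other, hence its determinant by the squared
  determinant of the coefficients.\<close>

lemma gram_combination:
  "gram (j11 *\<^sub>R p + j21 *\<^sub>R q) (j12 *\<^sub>R p + j22 *\<^sub>R q) = (j11 * j22 - j12 * j21)\<^sup>2 * gram p q"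
  by (simp add: gram_def inner_add inner_commute[of q p] power2_eq_square algebra_simps)

lemma area_combination:
  "area (j11 *\<^sub>R p + j21 *\<^sub>R q) (j12 *\<^sub>R p + j22 *\<^sub>R q) = \<bar>j11 * j22 - j12 * j21\<bar> * area p q"
  by (simp add: area_def gram_combination real_sqrt_mult)

text \<open>The derivative of the area scales like the area itself when the pair and its variation
  change by the same matrix. The polynomial part gains the squared determinant and the inverse area
  loses one absolute value of it, which is where invertibility enters.\<close>

lemma conormal_combination:
  assumes "j11 * j22 - j12 * j21 \<noteq> 0"
  shows "(j11 *\<^sub>R y + j21 *\<^sub>R z) \<bullet> conormal (j11 *\<^sub>R p + j21 *\<^sub>R q) (j12 *\<^sub>R p + j22 *\<^sub>R q) +
     (j12 *\<^sub>R y + j22 *\<^sub>R z) \<bullet> conormal (j12 *\<^sub>R p + j22 *\<^sub>R q) (j11 *\<^sub>R p + j21 *\<^sub>R q) =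
     \<bar>j11 * j22 - j12 * j21\<bar> * (y \<bullet> conormal p q + z \<bullet> conormal q p)"
proof -
  let ?p = "j11 *\<^sub>R p + j21 *\<^sub>R q" and ?q = "j12 *\<^sub>R p + j22 *\<^sub>R q"
  let ?y = "j11 *\<^sub>R y + j21 *\<^sub>R z" and ?z = "j12 *\<^sub>R y + j22 *\<^sub>R z"
  let ?d = "j11 * j22 - j12 * j21"
  have expand: "y \<bullet> conormal p q + z \<bullet> conormal q p = inverse (area p q) *
      ((q \<bullet> q) * (p \<bullet> y) - (p \<bullet> q) * (q \<bullet> y) + (p \<bullet> p) * (q \<bullet> z) - (p \<bullet> q) * (p \<bullet> z))"
    for p q y z :: 'a
    unfolding inner_commute[of _ "conormal _ _"] conormal_inner area_commute[of q p]
    by (simp add: inner_commute[of q p] algebra_simps)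
  have poly: "(?q \<bullet> ?q) * (?p \<bullet> ?y) - (?p \<bullet> ?q) * (?q \<bullet> ?y) + (?p \<bullet> ?p) * (?q \<bullet> ?z) - (?p \<bullet> ?q) * (?p \<bullet> ?z) =
      ?d * ?d * ((q \<bullet> q) * (p \<bullet> y) - (p \<bullet> q) * (q \<bullet> y) + (p \<bullet> p) * (q \<bullet> z) - (p \<bullet> q) * (p \<bullet> z))"
    unfolding inner_add inner_scaleR inner_commute[of q p] by algebra
  have "inverse (\<bar>?d\<bar> * area p q) * (?d * ?d * r) = \<bar>?d\<bar> * (inverse (area p q) * r)" for r
    using assms by (cases "area p q = 0") (simp_all add: field_simps abs_mult_self_eq flip: abs_mult)
  then show ?thesis unfolding expand poly area_combination by blast
qed

lemma linear_vec2:
  fixes D :: "real^2 \<Rightarrow> 'b::real_vector"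
  assumes "linear D"
  shows "D w = w $ 1 *\<^sub>R D (axis 1 1) + w $ 2 *\<^sub>R D (axis 2 1)"
proof -
  interpret linear D by fact
  have "w = w $ 1 *\<^sub>R axis 1 1 + w $ 2 *\<^sub>R axis 2 1"
    by (simp add: vec_eq_iff forall_2 axis_def)
  then have "D w = D (w $ 1 *\<^sub>R axis 1 1 + w $ 2 *\<^sub>R axis 2 1)" by simp
  then show ?thesis by (simp add: add scale)
qed

lemma jacobian_entry: "jacobian c d u $ i $ j = frechet_derivative (transition c d) (at u) (axis j 1) $ i"
  by (simp add: matrix_def)

context surface
begin

lemma transition_in:
  assumes "c \<in> A" "d \<in> A" "u \<in> overlap c d"
  shows "transition c d u \<in> chart_image d" "chart_inv d (transition c d u) = chart_inv c u"
  using assms by (auto simp: overlap_iff)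

lemma lift_transition:
  assumes "c \<in> A" "d \<in> A" "u \<in> overlap c d"
  shows "(f \<circ> chart_inv d) (transition c d u) = (f \<circ> chart_inv c) u"
  using transition_in(2)[OF assms] by simp

lemma has_derivative_chart_change:
  assumes c: "c \<in> A" and d: "d \<in> A" and u: "u \<in> overlap c d"
    and f: "(f \<circ> chart_inv d has_derivative D) (at (transition c d u))"
  shows "(f \<circ> chart_inv c has_derivative (\<lambda>v. D (frechet_derivative (transition c d) (at u) v))) (at u)"
proof (rule has_derivative_transform_within_open[OF _ open_overlap[OF c d] u])
  show "((\<lambda>u. (f \<circ> chart_inv d) (transition c d u)) has_derivative
      (\<lambda>v. D (frechet_derivative (transition c d) (at u) v))) (at u)"
    by (rule has_derivative_compose[OF transition_has_derivative[OF c d u] f])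
qed (rule lift_transition[OF c d])

lemma pd_chart_change:
  assumes c: "c \<in> A" and d: "d \<in> A" and u: "u \<in> overlap c d"
    and f: "f \<circ> chart_inv d differentiable (at (transition c d u))"
  shows "pd j (f \<circ> chart_inv c) u =
    jacobian c d u $ 1 $ j *\<^sub>R pd 1 (f \<circ> chart_inv d) (transition c d u) +
    jacobian c d u $ 2 $ j *\<^sub>R pd 2 (f \<circ> chart_inv d) (transition c d u)"
proof -
  have D: "(f \<circ> chart_inv d has_derivative frechet_derivative (f \<circ> chart_inv d) (at (transition c d u)))
      (at (transition c d u))"
    using f by (simp add: frechet_derivative_works)
  show ?thesis
    using pd_eqI[OF has_derivative_chart_change[OF c d u D]] linear_vec2[OF has_derivative_linear[OF D]]
    unfolding jacobian_entry pd_def by metis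
qed

text \<open>The first variation transforms as a density, like the area, so its quotient by the area
  is a function on the surface.\<close>

lemma first_variation_chart_change:
  assumes c: "c \<in> A" and d: "d \<in> A" and u: "u \<in> overlap c d"
    and f: "f \<circ> chart_inv d differentiable (at (transition c d u))"
    and Z: "Z \<circ> chart_inv d differentiable (at (transition c d u))"
    and J: "det (jacobian c d u) \<noteq> 0"
  shows "first_variation a e (f \<circ> chart_inv c) (Z \<circ> chart_inv c) u =
    \<bar>det (jacobian c d u)\<bar> * first_variation a e (f \<circ> chart_inv d) (Z \<circ> chart_inv d) (transition c d u)"
proof -
  have J': "jacobian c d u $ 1 $ 1 * jacobian c d u $ 2 $ 2 - jacobian c d u $ 1 $ 2 * jacobian c d u $ 2 $ 1 \<noteq> 0"
    using J by (simp add: det_2)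
  show ?thesis
    unfolding first_variation_def pd_chart_change[OF c d u f] pd_chart_change[OF c d u Z]
      area_combination conormal_combination[OF J'] lift_transition[OF c d u] det_2
    by (simp add: algebra_simps)
qed

end

section \<open>Induced metrics and immersions in terms of the area density\<close>

lemma sqrt_det_induced_metric:
  "sqrt (det (induced_metric f c u)) = area (pd 1 (f \<circ> chart_inv c) u) (pd 2 (f \<circ> chart_inv c) u)"
  by (simp add: det_2 induced_metric_def area_def gram_def pd_def power2_eq_square inner_commute)

lemma smooth_map_Ck: "smooth_map A f \<Longrightarrow> c \<in> A \<Longrightarrow> Ck_on k (chart_image c) (f \<circ> chart_inv c)"
  by (auto simp: smooth_map_def smooth_on_def)

lemma Ck_on_differentiable: "Ck_on (Suc k) S f \<Longrightarrow> x \<in> S \<Longrightarrow> f differentiable (at x)"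
  by (simp add: Ck_on.simps(2))

lemma (in surface) immersion_iff:
  "immersion A f \<longleftrightarrow> smooth_map A f \<and>
     (\<forall>c\<in>A. \<forall>u\<in>chart_image c. 0 < gram (pd 1 (f \<circ> chart_inv c) u) (pd 2 (f \<circ> chart_inv c) u))"
proof -
  have "inj (frechet_derivative (f \<circ> chart_inv c) (at u)) \<longleftrightarrow>
      0 < gram (pd 1 (f \<circ> chart_inv c) u) (pd 2 (f \<circ> chart_inv c) u)"
    if "smooth_map A f" "c \<in> A" "u \<in> chart_image c" for c u
    using inj_iff_gram_pos[OF has_derivative_linear[OF Ck_on_SucD[OF smooth_map_Ck[OF that(1,2)] that(3)]]]
    by (simp add: pd_def)
  then show ?thesis unfolding immersion_def by blast
qed

subsection \<open>The volume measure of an induced metric\<close>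

lemma (in surface) surface_density_induced_metric:
  assumes f: "smooth_map A f"
  shows "surface_density A (\<lambda>c u. sqrt (det (induced_metric f c u)))"
proof
  fix c u assume "c \<in> A" "u \<in> chart_image c"
  then show "0 \<le> sqrt (det (induced_metric f c u))"
    by (simp only: sqrt_det_induced_metric area_nonneg)
next
  fix c assume c: "c \<in> A"
  have "continuous_on (chart_image c) (pd i (f \<circ> chart_inv c))" for i
    by (rule Ck_on_imp_continuous[OF Ck_on_pd[OF smooth_map_Ck[OF f c]]])
  then show "continuous_on (chart_image c) (\<lambda>u. sqrt (det (induced_metric f c u)))"
    unfolding sqrt_det_induced_metric area_def gram_def by (intro continuous_intros)
next
  fix c d u assume cd: "c \<in> A" "d \<in> A" "u \<in> overlap c d"
  have diff: "f \<circ> chart_inv d differentiable (at (transition c d u))"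
    by (rule Ck_on_differentiable[OF smooth_map_Ck[OF f cd(2)] transition_in(1)[OF cd]])
  show "sqrt (det (induced_metric f c u)) =
      \<bar>det (jacobian c d u)\<bar> * sqrt (det (induced_metric f d (transition c d u)))"
    unfolding sqrt_det_induced_metric pd_chart_change[OF cd diff] area_combination
    unfolding det_2 ..
qed

lemma volume_measure_eq:
  assumes "surface_density A (\<lambda>c u. sqrt (det (h c u)))"
  shows "volume_measure A h = surface_density.volume A (\<lambda>c u. sqrt (det (h c u)))"
proof -
  interpret surface_density A "\<lambda>c u. sqrt (det (h c u))" by fact
  show ?thesis unfolding volume_measure_def volume_def is_volume_def ..
qed

lemma volume_measure_cong:
  assumes "\<And>c u. c \<in> A \<Longrightarrow> u \<in> chart_image c \<Longrightarrow> h c u = h' c u"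
  shows "volume_measure A h = volume_measure A h'"
proof -
  have eq: "(\<integral>\<^sup>+ u. ennreal (sqrt (det (h c u))) * indicator (snd c ` B) u \<partial>lborel) =
      (\<integral>\<^sup>+ u. ennreal (sqrt (det (h' c u))) * indicator (snd c ` B) u \<partial>lborel)"
    if "c \<in> A" "B \<subseteq> fst c" for c B
    using that assms[OF that(1)] by (intro nn_integral_cong) (auto simp: indicator_def chart_image_def)
  show ?thesis
    unfolding volume_measure_def
    by (intro arg_cong[of _ _ The] ext conj_cong ball_cong imp_cong refl) (simp only: eq)
qed

subsection \<open>Normal spaces and mean curvature\<close>

lemma orthogonal_projection_unique:
  assumes "subspace W" "w \<in> W" "\<And>z. z \<in> W \<Longrightarrow> v \<bullet> z = w \<bullet> z"
  shows "orthogonal_projection W v = w"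
  unfolding orthogonal_projection_def
proof (rule the_equality)
  show "w \<in> W \<and> (\<forall>z\<in>W. orthogonal (v - w) z)"
    using assms by (auto simp: orthogonal_def inner_diff_left)
  fix w' assume w': "w' \<in> W \<and> (\<forall>z\<in>W. orthogonal (v - w') z)"
  have "w' - w \<in> W" using assms w' by (intro subspace_diff) auto
  then have "(v - w') \<bullet> (w' - w) = 0" "v \<bullet> (w' - w) = w \<bullet> (w' - w)"
    using w' assms(3) by (auto simp: orthogonal_def)
  then have "(w' - w) \<bullet> (w' - w) = 0" by (simp add: inner_diff_left)
  then show "w' = w" by simp
qed

lemma matrix_inv_2:
  fixes M :: "real^2^2"
  assumes "det M \<noteq> 0"
  shows "matrix_inv M $ 1 $ 1 = M $ 2 $ 2 / det M" "matrix_inv M $ 2 $ 2 = M $ 1 $ 1 / det M"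
    "matrix_inv M $ 1 $ 2 = - M $ 1 $ 2 / det M" "matrix_inv M $ 2 $ 1 = - M $ 2 $ 1 / det M"
proof -
  define B :: "real^2^2" where "B = vector [vector [M $ 2 $ 2 / det M, - M $ 1 $ 2 / det M],
    vector [- M $ 2 $ 1 / det M, M $ 1 $ 1 / det M]]"
  have MB: "M ** B = mat 1" "B ** M = mat 1"
    using assms det_2[of M]
    by (simp_all add: B_def matrix_matrix_mult_def mat_def vec_eq_iff forall_2 sum_2 vector_2 divide_simps)
  \<comment> \<open>\<open>matrix_inv\<close> is defined by choice, so an inverse is exhibited
    first; multiplying by it from the left then identifies the chosen one.\<close>
  then have "\<exists>B. M ** B = mat 1 \<and> B ** M = mat 1" by blast
  from someI_ex[OF this] have "M ** matrix_inv M = mat 1"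
    unfolding matrix_inv_def by (rule conjunct1)
  then have "B ** (M ** matrix_inv M) = B" by (simp only: matrix_mul_rid)
  then have "matrix_inv M = B"
    by (simp only: matrix_mul_assoc MB matrix_mul_lid)
  then show "matrix_inv M $ 1 $ 1 = M $ 2 $ 2 / det M" "matrix_inv M $ 2 $ 2 = M $ 1 $ 1 / det M"
    "matrix_inv M $ 1 $ 2 = - M $ 1 $ 2 / det M" "matrix_inv M $ 2 $ 1 = - M $ 2 $ 1 / det M"
    by (simp_all add: B_def vector_2)
qed

locale immersed_surface = surface A for A :: "'a::{t2_space,second_countable_topology} chart set" +
  fixes g :: "'a \<Rightarrow> 'b::euclidean_space" and e :: 'b and a :: real
  assumes immersion: "immersion A g" and positive: "\<And>x. 0 < g x \<bullet> e"
begin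

lemma g_Ck: "c \<in> A \<Longrightarrow> Ck_on k (chart_image c) (g \<circ> chart_inv c)"
  using immersion by (intro smooth_map_Ck[of A]) (simp_all add: immersion_def)

lemma g_differentiable: "c \<in> A \<Longrightarrow> u \<in> chart_image c \<Longrightarrow> g \<circ> chart_inv c differentiable (at u)"
  by (rule Ck_on_differentiable[OF g_Ck])

lemma gram_g: "c \<in> A \<Longrightarrow> u \<in> chart_image c \<Longrightarrow>
    0 < gram (pd 1 (g \<circ> chart_inv c) u) (pd 2 (g \<circ> chart_inv c) u)"
  using immersion by (simp add: immersion_iff)

lemma patch_chart: "c \<in> A \<Longrightarrow> patch (chart_image c) (g \<circ> chart_inv c) e"
  by unfold_locales (simp_all add: open_chart_image g_Ck gram_g positive)

text \<open>The Gram determinant of the immersion in the chart \<open>c\<close> is the one in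
  \<open>d\<close> times the squared Jacobian determinant, and it is positive.\<close>

lemma det_jacobian:
  assumes cd: "c \<in> A" "d \<in> A" "u \<in> overlap c d"
  shows "det (jacobian c d u) \<noteq> 0"
proof
  assume 0: "det (jacobian c d u) = 0"
  have "u \<in> chart_image c" using cd overlap_iff by blast
  from gram_g[OF cd(1) this] show False
    unfolding pd_chart_change[OF cd g_differentiable[OF cd(2) transition_in(1)[OF cd]]] gram_combination
    using 0 by (simp add: det_2)
qed

lemma overlap_snd: "x \<in> fst c \<Longrightarrow> x \<in> fst d \<Longrightarrow> snd c x \<in> overlap c d"
  by auto

text \<open>Removes the arbitrary chart from the definition: the coordinate vectors of one chart are
  linear combinations of those of any other.\<close>

lemma normal_space_iff:
  assumes c: "c \<in> A" "x \<in> fst c"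
  shows "n \<in> normal_space A g x \<longleftrightarrow>
    pd 1 (g \<circ> chart_inv c) (snd c x) \<bullet> n = 0 \<and> pd 2 (g \<circ> chart_inv c) (snd c x) \<bullet> n = 0"
proof -
  let ?d = "chart_at A x"
  note d = chart_at_mem[of x] mem_chart_at[of x]
  let ?D = "frechet_derivative (g \<circ> chart_inv ?d) (at (snd ?d x))"
  have lin: "linear ?D"
    using g_differentiable[OF d(1) in_chart_image[OF d(2)]]
    by (intro has_derivative_linear) (simp add: frechet_derivative_works)
  have "n \<in> normal_space A g x \<longleftrightarrow> (\<forall>v. ?D v \<bullet> n = 0)"
    by (auto simp: normal_space_def tangent_space_def orthogonal_comp_def orthogonal_def Let_def)
  also have "\<dots> \<longleftrightarrow> ?D (axis 1 1) \<bullet> n = 0 \<and> ?D (axis 2 1) \<bullet> n = 0"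
  proof safe
    fix v assume "?D (axis 1 1) \<bullet> n = 0" "?D (axis 2 1) \<bullet> n = 0"
    then show "?D v \<bullet> n = 0"
      by (subst linear_vec2[OF lin]) (simp add: inner_add_left)
  qed auto
  finally have 1: "n \<in> normal_space A g x \<longleftrightarrow>
      pd 1 (g \<circ> chart_inv ?d) (snd ?d x) \<bullet> n = 0 \<and> pd 2 (g \<circ> chart_inv ?d) (snd ?d x) \<bullet> n = 0"
    by (simp add: pd_def)
  have 2: "pd i (g \<circ> chart_inv c') (snd c' x) \<bullet> n = 0"
    if c': "c' \<in> A" "x \<in> fst c'" and d': "d' \<in> A" "x \<in> fst d'"
      and n: "pd 1 (g \<circ> chart_inv d') (snd d' x) \<bullet> n = 0" "pd 2 (g \<circ> chart_inv d') (snd d' x) \<bullet> n = 0"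
    for c' d' i
  proof -
    have "transition c' d' (snd c' x) = snd d' x" using c' by simp
    then show ?thesis
      using pd_chart_change[OF c'(1) d'(1) overlap_snd[OF c'(2) d'(2)], of g i]
        g_differentiable[OF d'(1) in_chart_image[OF d'(2)]] n
      by (simp add: inner_add_left)
  qed
  show ?thesis unfolding 1 using 2[OF c d] 2[OF d c] by blast
qed

lemma subspace_normal_space: "subspace (normal_space A g x)"
  unfolding normal_space_def by (rule subspace_orthogonal_comp)

lemma normal_part_eqI:
  assumes "w \<in> normal_space A g x" "\<And>n. n \<in> normal_space A g x \<Longrightarrow> v \<bullet> n = w \<bullet> n"
  shows "normal_part A g x v = w"
  unfolding normal_part_def by (rule orthogonal_projection_unique[OF subspace_normal_space assms])

lemma normal_part_in: "normal_part A g x v \<in> normal_space A g x" (is ?P)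
  and normal_part_inner: "n \<in> normal_space A g x \<Longrightarrow> normal_part A g x v \<bullet> n = v \<bullet> n"
proof -
  let ?N = "normal_space A g x"
  obtain y z where yz: "y \<in> span ?N" "\<And>w. w \<in> span ?N \<Longrightarrow> orthogonal z w" "v = y + z"
    using orthogonal_subspace_decomp_exists[of ?N v] by blast
  have span: "span ?N = ?N" using subspace_normal_space by (rule span_eq_iff[THEN iffD2])
  have y: "v \<bullet> n = y \<bullet> n" if "n \<in> ?N" for n
    using yz(2)[of n] that unfolding span yz(3) by (simp add: orthogonal_def inner_add_left)
  have "normal_part A g x v = y"
    using yz(1) y unfolding span by (intro normal_part_eqI)
  then show ?P "n \<in> ?N \<Longrightarrow> normal_part A g x v \<bullet> n = v \<bullet> n"
    using yz(1) y unfolding span by auto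
qed

lemma normal_space_eqI:
  assumes "v \<in> normal_space A g x" "w \<in> normal_space A g x"
    "\<And>n. n \<in> normal_space A g x \<Longrightarrow> v \<bullet> n = w \<bullet> n"
  shows "v = w"
proof -
  have "v - w \<in> normal_space A g x" by (intro subspace_diff subspace_normal_space assms)
  from assms(3)[OF this] have "(v - w) \<bullet> (v - w) = 0" by (simp add: inner_diff_left)
  then show ?thesis by simp
qed

text \<open>The normal part of the second derivative is a tensor: the terms with second derivatives
  of the transition map multiply tangent vectors and vanish against \<open>n\<close>.\<close>

lemma second_pd_chart_change:
  assumes c: "c \<in> A" "x \<in> fst c" and d: "d \<in> A" "x \<in> fst d" and n: "n \<in> normal_space A g x"
  defines "J \<equiv> jacobian c d (snd c x)"
  shows "pd i (pd j (g \<circ> chart_inv c)) (snd c x) \<bullet> n =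
     J $ 1 $ j * (J $ 1 $ i * (pd 1 (pd 1 (g \<circ> chart_inv d)) (snd d x) \<bullet> n) +
                  J $ 2 $ i * (pd 2 (pd 1 (g \<circ> chart_inv d)) (snd d x) \<bullet> n)) +
     J $ 2 $ j * (J $ 1 $ i * (pd 1 (pd 2 (g \<circ> chart_inv d)) (snd d x) \<bullet> n) +
                  J $ 2 $ i * (pd 2 (pd 2 (g \<circ> chart_inv d)) (snd d x) \<bullet> n))"
proof -
  let ?u = "snd c x" and ?v = "snd d x" and ?\<tau> = "transition c d"
  let ?g = "g \<circ> chart_inv d" and ?\<tau>' = "frechet_derivative (transition c d) (at (snd c x))"
  have u: "?u \<in> overlap c d" using c d by auto
  have \<tau>u: "?\<tau> ?u = ?v" using c by simp
  interpret c: patch "chart_image c" "g \<circ> chart_inv c" e a by (rule patch_chart[OF c(1)])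
  interpret d: patch "chart_image d" "g \<circ> chart_inv d" e a by (rule patch_chart[OF d(1)])
  have nd: "pd l ?g ?v \<bullet> n = 0" for l
    using n exhaust_2[of l] unfolding normal_space_iff[OF d] by auto
  define J' where "J' l v = jacobian c d v $ l $ j" for l v
  have J'd: "(J' l has_derivative frechet_derivative (J' l) (at ?u)) (at ?u)" for l
  proof -
    have "Ck_on (Suc 0) (overlap c d) (\<lambda>v. frechet_derivative ?\<tau> (at v) (axis j 1))"
      by (rule Ck_on_SucD'[OF transition_smooth[OF c(1) d(1)]])
    then have "Ck_on (Suc 0) (overlap c d) (\<lambda>v. frechet_derivative ?\<tau> (at v) (axis j 1) \<bullet> axis l 1)"
      by (intro Ck_on_inner Ck_on_const open_overlap c d)
    then have "Ck_on (Suc 0) (overlap c d) (J' l)"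
      unfolding J'_def[abs_def] jacobian_entry by (simp add: inner_axis)
    from Ck_on_SucD[OF this u] show ?thesis .
  qed
  have gd: "((\<lambda>v. pd l ?g (?\<tau> v) \<bullet> n) has_derivative (\<lambda>h. frechet_derivative (pd l ?g) (at ?v) (?\<tau>' h) \<bullet> n)) (at ?u)" for l
  proof (intro has_derivative_inner_left has_derivative_compose[OF transition_has_derivative[OF c(1) d(1) u]])
    show "(pd l ?g has_derivative frechet_derivative (pd l ?g) (at ?v)) (at (?\<tau> ?u))"
      unfolding \<tau>u using d by (intro d.pd_derivative) simp
  qed
  have eq: "J' 1 v * (pd 1 ?g (?\<tau> v) \<bullet> n) + J' 2 v * (pd 2 ?g (?\<tau> v) \<bullet> n) = pd j (g \<circ> chart_inv c) v \<bullet> n"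
    if v: "v \<in> overlap c d" for v
    using pd_chart_change[OF c(1) d(1) v g_differentiable[OF d(1) transition_in(1)[OF c(1) d(1) v]], of j]
    by (simp add: J'_def inner_add_left)
  have "pd i (pd j (g \<circ> chart_inv c)) ?u \<bullet> n = pd i (\<lambda>v. pd j (g \<circ> chart_inv c) v \<bullet> n) ?u"
    using pd_eqI[OF has_derivative_inner_left[OF c.pd_derivative[OF in_chart_image[OF c(2)]]]]
    by (simp add: pd_def)
  also have "\<dots> = pd i (\<lambda>v. J' 1 v * (pd 1 ?g (?\<tau> v) \<bullet> n) + J' 2 v * (pd 2 ?g (?\<tau> v) \<bullet> n)) ?u"
    by (rule pd_cong_open[OF open_overlap[OF c(1) d(1)] u, symmetric]) (rule eq)
  also have "\<dots> = J' 1 ?u * (frechet_derivative (pd 1 ?g) (at ?v) (?\<tau>' (axis i 1)) \<bullet> n) +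
      J' 2 ?u * (frechet_derivative (pd 2 ?g) (at ?v) (?\<tau>' (axis i 1)) \<bullet> n)"
    using pd_eqI[OF has_derivative_add[OF has_derivative_mult[OF J'd gd] has_derivative_mult[OF J'd gd]]]
    by (simp only: \<tau>u nd mult_zero_right add_0_right)
  finally have *: "pd i (pd j (g \<circ> chart_inv c)) ?u \<bullet> n =
      J' 1 ?u * (frechet_derivative (pd 1 ?g) (at ?v) (?\<tau>' (axis i 1)) \<bullet> n) +
      J' 2 ?u * (frechet_derivative (pd 2 ?g) (at ?v) (?\<tau>' (axis i 1)) \<bullet> n)" .
  have "frechet_derivative (pd l ?g) (at ?v) (?\<tau>' (axis i 1)) \<bullet> n =
      J $ 1 $ i * (pd 1 (pd l ?g) ?v \<bullet> n) + J $ 2 $ i * (pd 2 (pd l ?g) ?v \<bullet> n)" for l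
  proof -
    have lin: "linear (frechet_derivative (pd l ?g) (at ?v))"
      using d by (intro has_derivative_linear[OF d.pd_derivative]) simp
    show ?thesis
      unfolding J_def jacobian_entry pd_def[of _ "pd l ?g"]
      by (subst linear_vec2[OF lin]) (simp add: inner_add_left)
  qed
  then show ?thesis unfolding * by (simp add: J'_def J_def)
qed

text \<open>The contraction of the second derivatives with the cofactors of the Gram matrix gains
  the squared Jacobian determinant, and so does the Gram determinant in the denominator.
  \<open>poly\<close> is this scaling, written out in matrix entries.\<close>

lemma trace_second_chart_change:
  assumes c: "c \<in> A" "x \<in> fst c" and d: "d \<in> A" "x \<in> fst d" and n: "n \<in> normal_space A g x"
  shows "trace_second (g \<circ> chart_inv c) (snd c x) \<bullet> n = trace_second (g \<circ> chart_inv d) (snd d x) \<bullet> n"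
proof -
  have u: "snd c x \<in> overlap c d" using c d by auto
  have \<tau>: "transition c d (snd c x) = snd d x" using c by simp
  interpret d: patch "chart_image d" "g \<circ> chart_inv d" e a by (rule patch_chart[OF d(1)])
  note pd = pd_chart_change[OF c(1) d(1) u g_differentiable[OF d(1) transition_in(1)[OF c(1) d(1) u]], unfolded \<tau>]
  have sym: "pd 2 (pd 1 (g \<circ> chart_inv d)) (snd d x) = pd 1 (pd 2 (g \<circ> chart_inv d)) (snd d x)"
    using d by (intro d.pd_commute) simp
  let ?J = "jacobian c d (snd c x)"
  have J: "?J $ 1 $ 1 * ?J $ 2 $ 2 - ?J $ 1 $ 2 * ?J $ 2 $ 1 \<noteq> 0"
    using det_jacobian[OF c(1) d(1) u] by (simp add: det_2)
  have poly: "(j12 * j12 * p + 2 * j12 * j22 * r + j22 * j22 * q) * (j11 * (j11 * h11 + j21 * h12) + j21 * (j11 * h12 + j21 * h22))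
     - 2 * (j11 * j12 * p + (j11 * j22 + j12 * j21) * r + j21 * j22 * q) * (j12 * (j11 * h11 + j21 * h12) + j22 * (j11 * h12 + j21 * h22))
     + (j11 * j11 * p + 2 * j11 * j21 * r + j21 * j21 * q) * (j12 * (j12 * h11 + j22 * h12) + j22 * (j12 * h12 + j22 * h22))
     = (j11 * j22 - j12 * j21)\<^sup>2 * (q * h11 - 2 * r * h12 + p * h22)" for j11 j12 j21 j22 p q r h11 h12 h22 :: real
    by algebra
  have inner: "(x *\<^sub>R p + y *\<^sub>R q) \<bullet> (x' *\<^sub>R p + y' *\<^sub>R q) = x * x' * (p \<bullet> p) + (x * y' + x' * y) * (p \<bullet> q) + y * y' * (q \<bullet> q)"
    for p q :: 'b and x y x' y'
    by (simp add: inner_add inner_commute[of q p] algebra_simps)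
  have expand: "trace_second F u \<bullet> n = inverse (gram (pd 1 F u) (pd 2 F u)) *
     ((pd 2 F u \<bullet> pd 2 F u) * (pd 1 (pd 1 F) u \<bullet> n)
      - 2 * (pd 1 F u \<bullet> pd 2 F u) * (pd 1 (pd 2 F) u \<bullet> n)
      + (pd 1 F u \<bullet> pd 1 F u) * (pd 2 (pd 2 F) u \<bullet> n))" for F u
    by (simp add: trace_second_def inner_diff_left inner_add_left)
  have main: "(pd 2 (g \<circ> chart_inv c) (snd c x) \<bullet> pd 2 (g \<circ> chart_inv c) (snd c x)) * (pd 1 (pd 1 (g \<circ> chart_inv c)) (snd c x) \<bullet> n)
      - 2 * (pd 1 (g \<circ> chart_inv c) (snd c x) \<bullet> pd 2 (g \<circ> chart_inv c) (snd c x)) * (pd 1 (pd 2 (g \<circ> chart_inv c)) (snd c x) \<bullet> n)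
      + (pd 1 (g \<circ> chart_inv c) (snd c x) \<bullet> pd 1 (g \<circ> chart_inv c) (snd c x)) * (pd 2 (pd 2 (g \<circ> chart_inv c)) (snd c x) \<bullet> n)
     = (?J $ 1 $ 1 * ?J $ 2 $ 2 - ?J $ 1 $ 2 * ?J $ 2 $ 1)\<^sup>2 *
      ((pd 2 (g \<circ> chart_inv d) (snd d x) \<bullet> pd 2 (g \<circ> chart_inv d) (snd d x)) * (pd 1 (pd 1 (g \<circ> chart_inv d)) (snd d x) \<bullet> n)
      - 2 * (pd 1 (g \<circ> chart_inv d) (snd d x) \<bullet> pd 2 (g \<circ> chart_inv d) (snd d x)) * (pd 1 (pd 2 (g \<circ> chart_inv d)) (snd d x) \<bullet> n)
      + (pd 1 (g \<circ> chart_inv d) (snd d x) \<bullet> pd 1 (g \<circ> chart_inv d) (snd d x)) * (pd 2 (pd 2 (g \<circ> chart_inv d)) (snd d x) \<bullet> n))"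
    unfolding second_pd_chart_change[OF c d n] sym pd inner poly[symmetric]
    by (simp add: algebra_simps)
  show ?thesis
    unfolding expand main using J by (simp add: pd gram_combination)
qed

text \<open>The cofactor formula for the inverse metric turns the trace in the chosen chart into
  \<open>trace_second\<close>, which may then be computed in any chart \<open>c\<close>.\<close>

lemma mean_curvature_inner:
  assumes c: "c \<in> A" "x \<in> fst c" and n: "n \<in> normal_space A g x"
  shows "2 * (mean_curvature A g x \<bullet> n) = trace_second (g \<circ> chart_inv c) (snd c x) \<bullet> n"
proof -
  let ?d = "chart_at A x"
  note d = chart_at_mem[of x] mem_chart_at[of x]
  interpret d: patch "chart_image ?d" "g \<circ> chart_inv ?d" e a by (rule patch_chart[OF d(1)])
  let ?u = "snd ?d x" and ?g = "g \<circ> chart_inv ?d"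
  let ?M = "induced_metric g ?d ?u"
  have M: "?M $ i $ j = pd i ?g ?u \<bullet> pd j ?g ?u" for i j
    by (simp add: induced_metric_def pd_def)
  have det: "det ?M = gram (pd 1 ?g ?u) (pd 2 ?g ?u)"
    by (simp add: det_2 M gram_def power2_eq_square inner_commute)
  then have det0: "det ?M \<noteq> 0" using gram_g[OF d(1) in_chart_image[OF d(2)]] by simp
  have II: "second_fundamental_form A g ?d x (axis i 1) (axis j 1) \<bullet> n = pd i (pd j ?g) ?u \<bullet> n" for i j
    unfolding second_fundamental_form_def normal_part_inner[OF n] by (simp add: pd_def[abs_def])
  have sym: "pd 2 (pd 1 ?g) ?u = pd 1 (pd 2 ?g) ?u"
    using d by (intro d.pd_commute) simp
  have "2 * (mean_curvature A g x \<bullet> n) =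
      matrix_inv ?M $ 1 $ 1 * (pd 1 (pd 1 ?g) ?u \<bullet> n) + matrix_inv ?M $ 1 $ 2 * (pd 1 (pd 2 ?g) ?u \<bullet> n) +
      (matrix_inv ?M $ 2 $ 1 * (pd 2 (pd 1 ?g) ?u \<bullet> n) + matrix_inv ?M $ 2 $ 2 * (pd 2 (pd 2 ?g) ?u \<bullet> n))"
    unfolding mean_curvature_def Let_def sum_2 inner_add_left inner_scaleR_left II by simp
  also have "\<dots> = trace_second ?g ?u \<bullet> n"
    unfolding matrix_inv_2[OF det0] det M sym trace_second_def inner_scaleR_left inner_add_left inner_diff_left
      inner_commute[of "pd 2 ?g ?u" "pd 1 ?g ?u"] divide_inverse
    by algebra
  also have "\<dots> = trace_second (g \<circ> chart_inv c) (snd c x) \<bullet> n"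
    by (rule trace_second_chart_change[OF d c n])
  finally show ?thesis .
qed

lemma mean_curvature_normal: "mean_curvature A g x \<in> normal_space A g x"
  unfolding mean_curvature_def Let_def second_fundamental_form_def
  by (intro subspace_scale subspace_sum subspace_normal_space normal_part_in)

text \<open>After multiplication by \<open>(g x \<bullet> e) powr (a - 1)\<close> this is the L^2
  gradient of the energy; its vanishing is the singular minimal surface equation.\<close>

definition force :: "'a \<Rightarrow> 'b" where
  "force x = a *\<^sub>R normal_part A g x e - (2 * (g x \<bullet> e)) *\<^sub>R mean_curvature A g x"

lemma force_normal: "force x \<in> normal_space A g x"
  unfolding force_def
  by (intro subspace_diff subspace_scale subspace_normal_space normal_part_in mean_curvature_normal)

text \<open>Both sides are normal vectors, so comparing their inner products with normal vectors
  suffices; there the divergence of the conormals has become the mean curvature.\<close>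

lemma euler_lagrange_eq_force:
  assumes c: "c \<in> A" "x \<in> fst c"
  shows "euler_lagrange a e (g \<circ> chart_inv c) (snd c x) =
    (sqrt (det (induced_metric g c (snd c x))) * (g x \<bullet> e) powr (a - 1)) *\<^sub>R force x"
proof (rule normal_space_eqI)
  interpret c: patch "chart_image c" "g \<circ> chart_inv c" e a by (rule patch_chart[OF c(1)])
  let ?u = "snd c x"
  have u: "?u \<in> chart_image c" using c by simp
  have gx: "(g \<circ> chart_inv c) ?u = g x" using c by simp
  show "euler_lagrange a e (g \<circ> chart_inv c) ?u \<in> normal_space A g x"
    using c.euler_lagrange_tangential[OF u] unfolding normal_space_iff[OF c] by (simp add: inner_commute)
  show "(sqrt (det (induced_metric g c ?u)) * (g x \<bullet> e) powr (a - 1)) *\<^sub>R force x \<in> normal_space A g x"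
    by (intro subspace_scale subspace_normal_space force_normal)
  fix n assume n: "n \<in> normal_space A g x"
  have "force x \<bullet> n = a * (e \<bullet> n) - (g x \<bullet> e) * (trace_second (g \<circ> chart_inv c) ?u \<bullet> n)"
    by (simp add: force_def inner_diff_left normal_part_inner[OF n] flip: mean_curvature_inner[OF c n])
  then show "euler_lagrange a e (g \<circ> chart_inv c) ?u \<bullet> n =
      (sqrt (det (induced_metric g c ?u)) * (g x \<bullet> e) powr (a - 1)) *\<^sub>R force x \<bullet> n"
    using c.euler_lagrange_normal[OF u] n
    unfolding normal_space_iff[OF c] sqrt_det_induced_metric gx by simp
qed

end

section \<open>Locality and additivity of the first variation\<close>

lemma first_variation_cong:
  assumes "open S" "u \<in> S" "\<And>v. v \<in> S \<Longrightarrow> Z v = Z' v"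
  shows "first_variation a e F Z u = first_variation a e F Z' u"
proof -
  have "pd i Z u = pd i Z' u" for i
    by (rule pd_cong_open[OF assms])
  then show ?thesis by (simp add: first_variation_def assms(3)[OF assms(2)])
qed

lemma first_variation_sum:
  assumes "finite I" "\<And>i. i \<in> I \<Longrightarrow> Z i differentiable (at u)"
  shows "first_variation a e F (\<lambda>u. \<Sum>i\<in>I. Z i u) u = (\<Sum>i\<in>I. first_variation a e F (Z i) u)"
proof -
  have "((\<lambda>u. \<Sum>i\<in>I. Z i u) has_derivative (\<lambda>v. \<Sum>i\<in>I. frechet_derivative (Z i) (at u) v)) (at u)"
    using assms(2) by (intro has_derivative_sum) (simp add: frechet_derivative_works)
  from pd_eqI[OF this] have "pd j (\<lambda>u. \<Sum>i\<in>I. Z i u) u = (\<Sum>i\<in>I. pd j (Z i) u)" for j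
    by (simp add: pd_def)
  then show ?thesis
    by (simp add: first_variation_def sum.distrib inner_sum_left sum_distrib_left distrib_left)
qed

subsection \<open>Functions on a surface\<close>

context surface
begin

lemma continuous_on_charts:
  assumes "\<And>c. c \<in> A \<Longrightarrow> continuous_on (chart_image c) (f \<circ> chart_inv c)"
  shows "continuous_on UNIV f"
proof -
  have "continuous_on (fst c) f" if c: "c \<in> A" for c
  proof -
    have "continuous_on (fst c) (\<lambda>x. (f \<circ> chart_inv c) (snd c x))"
      by (rule continuous_on_compose2[OF assms[OF c] continuous_chart[OF c]]) auto
    then show ?thesis by (rule continuous_on_eq) (use c in auto)
  qed
  then have "continuous_on (\<Union>c\<in>A. fst c) f"
    using open_chart by (intro continuous_on_open_UN) auto
  then show ?thesis by (simp only: charts_cover)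
qed

lemma continuous_on_charts_Ck:
  assumes "\<And>c. c \<in> A \<Longrightarrow> Ck_on k (chart_image c) (f \<circ> chart_inv c)"
  shows "continuous_on UNIV f"
  using assms Ck_on_imp_continuous by (intro continuous_on_charts) blast

lemma measurable_in_chart:
  fixes f :: "'a \<Rightarrow> real"
  assumes c: "c \<in> A" and f: "f \<in> borel_measurable borel"
  shows "(\<lambda>u. indicator (chart_image c) u * f (chart_inv c u)) \<in> borel_measurable borel"
  using borel_measurable_restrict_space_iff[of "chart_image c" borel "\<lambda>u. f (chart_inv c u)"]
    measurable_compose[OF chart_inv_measurable[OF c] f] c
  by simp

lemma open_in_chart:
  assumes c: "c \<in> A" and "open S"
  shows "open {u \<in> chart_image c. chart_inv c u \<in> S}"
proof -
  have "{u \<in> chart_image c. chart_inv c u \<in> S} = chart_image c \<inter> chart_inv c -` S" by auto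
  then show ?thesis
    using continuous_open_preimage[OF continuous_chart_inv open_chart_image] assms by simp
qed

lemma compact_chart_inv_image:
  assumes "c \<in> A" "compact C" "C \<subseteq> chart_image c"
  shows "compact (chart_inv c ` C)"
  using assms continuous_on_subset[OF continuous_chart_inv] by (intro compact_continuous_image) auto

definition surface_bump :: "'a chart \<Rightarrow> real^2 \<Rightarrow> real \<Rightarrow> 'a \<Rightarrow> real" where
  "surface_bump c p r x = (if x \<in> fst c then bump p r (snd c x) else 0)"

lemma surface_bump_nonneg: "0 \<le> surface_bump c p r x"
  by (simp add: surface_bump_def bump_nonneg)

lemma surface_bump_chart:
  assumes "c \<in> A" "u \<in> chart_image c"
  shows "surface_bump c p r (chart_inv c u) = bump p r u"
  using assms by (simp add: surface_bump_def)

lemma surface_bump_pos_iff: "0 < r \<Longrightarrow> 0 < surface_bump c p r x \<longleftrightarrow> x \<in> fst c \<and> snd c x \<in> ball p r"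
  using bump_pos_iff[of r p "snd c x"] by (simp add: surface_bump_def)

lemma surface_bump_support:
  assumes "c \<in> A" "0 < r" "x \<notin> chart_inv c ` cball p r"
  shows "surface_bump c p r x = 0"
proof (rule ccontr)
  assume "surface_bump c p r x \<noteq> 0"
  then have "0 < surface_bump c p r x" using surface_bump_nonneg[of c p r x] by linarith
  then have "x \<in> fst c" "snd c x \<in> cball p r"
    using surface_bump_pos_iff[OF assms(2)] by auto
  then have "x \<in> chart_inv c ` cball p r"
    using assms(1) by (intro image_eqI[of _ _ "snd c x"]) auto
  with assms(3) show False by blast
qed

text \<open>Near the chart domain of \<open>c\<close> the function is a bump composed with a
  transition map, and off the image of the closed ball it is 0. The latter region is open because
  compact sets are closed in a Hausdorff space.\<close>

lemma surface_bump_Ck: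
  assumes c: "c \<in> A" and d: "d \<in> A" and r: "0 < r" "cball p r \<subseteq> chart_image c"
  shows "Ck_on k (chart_image d) (surface_bump c p r \<circ> chart_inv d)"
proof -
  let ?K = "chart_inv c ` cball p r"
  have K: "compact ?K" "closed ?K"
    using compact_chart_inv_image[OF c compact_cball r(2)] compact_imp_closed by auto
  let ?V = "{u \<in> chart_image d. chart_inv d u \<in> - ?K}"
  have V: "open ?V" by (rule open_in_chart[OF d]) (use K in auto)
  have "Ck_on k (overlap d c) (\<lambda>u. bump p r (transition d c u))"
    by (rule Ck_on_compose[OF open_overlap[OF d c] open_UNIV transition_smooth[OF d c] Ck_on_bump]) simp
  then have 1: "Ck_on k (overlap d c) (surface_bump c p r \<circ> chart_inv d)"
    by (rule Ck_on_cong[OF open_overlap[OF d c], rotated]) (use overlap_iff[OF d, of _ c] in \<open>auto simp: surface_bump_def\<close>)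
  have 2: "Ck_on k ?V (surface_bump c p r \<circ> chart_inv d)"
    by (rule Ck_on_cong[OF V _ Ck_on_const[of _ _ 0]]) (use surface_bump_support[OF c r(1), symmetric] in auto)
  have "overlap d c \<union> ?V = chart_image d"
    using overlap_iff[OF d, of _ c] r(2) c by auto
  then show ?thesis using Ck_on_Un[OF open_overlap[OF d c] V 1 2] by simp
qed

lemma volume_measure_transfer:
  fixes F :: "'a \<Rightarrow> real"
  assumes f: "smooth_map A f" and c: "c \<in> A" and F: "F \<in> borel_measurable borel" "\<forall>x. x \<notin> fst c \<longrightarrow> F x = 0"
  shows "integrable (volume_measure A (induced_metric f)) F \<longleftrightarrow>
      integrable lborel (\<lambda>u. indicator (chart_image c) u * F (chart_inv c u) *
        area (pd 1 (f \<circ> chart_inv c) u) (pd 2 (f \<circ> chart_inv c) u))"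
    and "integral\<^sup>L (volume_measure A (induced_metric f)) F =
      (\<integral>u. indicator (chart_image c) u * F (chart_inv c u) *
        area (pd 1 (f \<circ> chart_inv c) u) (pd 2 (f \<circ> chart_inv c) u) \<partial>lborel)"
proof -
  interpret surface_density A "\<lambda>c u. sqrt (det (induced_metric f c u))"
    by (rule surface_density_induced_metric[OF f])
  have V: "volume_measure A (induced_metric f) = volume"
    by (rule volume_measure_eq[OF surface_density_axioms])
  have "integrable volume F \<longleftrightarrow> integrable lborel
      (\<lambda>u. indicator (chart_image c) u * (sqrt (det (induced_metric f c u)) * F (chart_inv c u)))"
    by (rule integrable_volume_iff[OF c F(1)]) (use F(2) in blast)
  then show "integrable (volume_measure A (induced_metric f)) F \<longleftrightarrow>
      integrable lborel (\<lambda>u. indicator (chart_image c) u * F (chart_inv c u) *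
        area (pd 1 (f \<circ> chart_inv c) u) (pd 2 (f \<circ> chart_inv c) u))"
    unfolding V by (simp only: sqrt_det_induced_metric mult_ac)
  have "integral\<^sup>L volume F =
      (\<integral>u. indicator (chart_image c) u * (sqrt (det (induced_metric f c u)) * F (chart_inv c u)) \<partial>lborel)"
    by (rule integral_volume_eq[OF c F(1)]) (use F(2) in blast)
  then show "integral\<^sup>L (volume_measure A (induced_metric f)) F =
      (\<integral>u. indicator (chart_image c) u * F (chart_inv c u) *
        area (pd 1 (f \<circ> chart_inv c) u) (pd 2 (f \<circ> chart_inv c) u) \<partial>lborel)"
    unfolding V by (simp only: sqrt_det_induced_metric mult_ac)
qed

end

subsection \<open>The first variation of the energy\<close>

context immersed_surface
begin

abbreviation area_in :: "'a chart \<Rightarrow> real^2 \<Rightarrow> real" where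
  "area_in c u \<equiv> area (pd 1 (g \<circ> chart_inv c) u) (pd 2 (g \<circ> chart_inv c) u)"

abbreviation M :: "'a measure" where
  "M \<equiv> volume_measure A (induced_metric g)"

text \<open>The density of the first variation with respect to \<open>M\<close>; it does not depend on the chart.\<close>
definition variation_density :: "('a \<Rightarrow> 'b) \<Rightarrow> 'a \<Rightarrow> real" where
  "variation_density Z x = (let d = chart_at A x in
     first_variation a e (g \<circ> chart_inv d) (Z \<circ> chart_inv d) (snd d x) / area_in d (snd d x))"

text \<open>One derivative is all that the first variation takes of \<open>Z\<close>.\<close>

definition C1_field :: "('a \<Rightarrow> 'b) \<Rightarrow> bool" where
  "C1_field Z \<longleftrightarrow> (\<forall>c\<in>A. Ck_on 1 (chart_image c) (Z \<circ> chart_inv c))"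

lemma C1_fieldD: "C1_field Z \<Longrightarrow> c \<in> A \<Longrightarrow> Ck_on 1 (chart_image c) (Z \<circ> chart_inv c)"
  by (simp add: C1_field_def)

lemma C1_field_differentiable:
  "C1_field Z \<Longrightarrow> c \<in> A \<Longrightarrow> u \<in> chart_image c \<Longrightarrow> Z \<circ> chart_inv c differentiable (at u)"
  by (rule Ck_on_differentiable[of 0 "chart_image c"]) (simp_all add: C1_field_def)

lemma area_in_pos: "c \<in> A \<Longrightarrow> u \<in> chart_image c \<Longrightarrow> 0 < area_in c u"
  using gram_g by simp

lemma area_in_neq_0: "c \<in> A \<Longrightarrow> u \<in> chart_image c \<Longrightarrow> area_in c u \<noteq> 0"
  using area_in_pos by (metis less_irrefl)

text \<open>The first variation and the area change by the same Jacobian factor between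
  \<open>c\<close> and the chosen chart, so their quotient is the same in both.\<close>

lemma variation_density_chart:
  assumes Z: "C1_field Z" and c: "c \<in> A" "u \<in> chart_image c"
  shows "first_variation a e (g \<circ> chart_inv c) (Z \<circ> chart_inv c) u =
    variation_density Z (chart_inv c u) * area_in c u"
proof -
  let ?d = "chart_at A (chart_inv c u)"
  have d: "?d \<in> A" by (rule chart_at_mem)
  have u: "u \<in> overlap c ?d" using overlap_iff[OF c(1)] c mem_chart_at by blast
  let ?v = "transition c ?d u"
  have v: "?v \<in> chart_image ?d" by (rule transition_in(1)[OF c(1) d u])
  have "area_in c u = \<bar>det (jacobian c ?d u)\<bar> * area_in ?d ?v"
    unfolding pd_chart_change[OF c(1) d u g_differentiable[OF d v]] area_combination
    unfolding det_2 ..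
  then show ?thesis
    using first_variation_chart_change[OF c(1) d u g_differentiable[OF d v] C1_field_differentiable[OF Z d v]
        det_jacobian[OF c(1) d u], of a e] area_in_neq_0[OF d v]
    by (simp add: variation_density_def Let_def)
qed

lemma force_chart:
  assumes c: "c \<in> A" "u \<in> chart_image c"
  shows "euler_lagrange a e (g \<circ> chart_inv c) u \<bullet> Z (chart_inv c u) =
    (g (chart_inv c u) \<bullet> e) powr (a - 1) * (force (chart_inv c u) \<bullet> Z (chart_inv c u)) * area_in c u"
  using euler_lagrange_eq_force[OF c(1) chart_inv_in[OF c]] c
  unfolding sqrt_det_induced_metric by simp

lemma continuous_area_in:
  assumes "c \<in> A"
  shows "continuous_on (chart_image c) (area_in c)"
proof -
  interpret c: patch "chart_image c" "g \<circ> chart_inv c" e a by (rule patch_chart[OF assms])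
  show ?thesis by (rule Ck_on_imp_continuous[OF c.s_Ck])
qed

lemma continuous_variation_density:
  assumes Z: "C1_field Z"
  shows "continuous_on UNIV (variation_density Z)"
proof (rule continuous_on_charts)
  fix c assume c: "c \<in> A"
  interpret c: patch "chart_image c" "g \<circ> chart_inv c" e a by (rule patch_chart[OF c])
  have "continuous_on (chart_image c)
     (\<lambda>u. first_variation a e (g \<circ> chart_inv c) (Z \<circ> chart_inv c) u / area_in c u)"
    by (intro continuous_on_divide c.first_variation_continuous C1_fieldD[OF Z c] continuous_area_in c
        ballI area_in_neq_0)
  then show "continuous_on (chart_image c) (variation_density Z \<circ> chart_inv c)"
    by (rule continuous_on_eq) (simp add: variation_density_chart[OF Z c] area_in_neq_0[OF c])
qed

abbreviation force_density :: "('a \<Rightarrow> 'b) \<Rightarrow> 'a \<Rightarrow> real" where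
  "force_density Z x \<equiv> (g x \<bullet> e) powr (a - 1) * (force x \<bullet> Z x)"

lemma continuous_force_density:
  assumes Z: "C1_field Z"
  shows "continuous_on UNIV (force_density Z)"
proof (rule continuous_on_charts)
  fix c assume c: "c \<in> A"
  interpret c: patch "chart_image c" "g \<circ> chart_inv c" e a by (rule patch_chart[OF c])
  have "continuous_on (chart_image c)
     (\<lambda>u. (euler_lagrange a e (g \<circ> chart_inv c) u \<bullet> (Z \<circ> chart_inv c) u) / area_in c u)"
    by (intro continuous_on_divide continuous_on_inner continuous_area_in c ballI area_in_neq_0
        Ck_on_imp_continuous[OF c.euler_lagrange_Ck] Ck_on_imp_continuous[OF C1_fieldD[OF Z c]])
  then show "continuous_on (chart_image c) (force_density Z \<circ> chart_inv c)"
    by (rule continuous_on_eq) (simp add: force_chart[OF c] area_in_neq_0[OF c])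
qed

text \<open>Closedness of \<open>K\<close> makes \<open>Z\<close> vanish near \<open>x\<close>, so
  that its derivatives at \<open>x\<close> vanish as well.\<close>

lemma variation_density_eq_0:
  assumes K: "closed K" "\<And>x. x \<notin> K \<Longrightarrow> Z x = 0" and x: "x \<notin> K"
  shows "variation_density Z x = 0"
proof -
  let ?d = "chart_at A x"
  let ?S = "{u \<in> chart_image ?d. chart_inv ?d u \<in> - K}"
  have "open ?S" by (rule open_in_chart[OF chart_at_mem]) (use K in auto)
  moreover have "snd ?d x \<in> ?S"
    using x mem_chart_at[of x] chart_at_mem[of x] by simp
  ultimately have "first_variation a e (g \<circ> chart_inv ?d) (Z \<circ> chart_inv ?d) (snd ?d x) =
      first_variation a e (g \<circ> chart_inv ?d) (\<lambda>_. 0) (snd ?d x)"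
    by (rule first_variation_cong) (use K in auto)
  also have "\<dots> = 0"
    using pd_eqI[OF has_derivative_const[of "0::'b"]] by (simp add: first_variation_def)
  finally show ?thesis by (simp add: variation_density_def Let_def)
qed

lemma variation_density_sum:
  assumes "finite I" "\<And>i. i \<in> I \<Longrightarrow> C1_field (Z i)"
  shows "variation_density (\<lambda>x. \<Sum>i\<in>I. Z i x) x = (\<Sum>i\<in>I. variation_density (Z i) x)"
proof -
  let ?d = "chart_at A x"
  have "first_variation a e (g \<circ> chart_inv ?d) (\<lambda>u. \<Sum>i\<in>I. (Z i \<circ> chart_inv ?d) u) (snd ?d x) =
      (\<Sum>i\<in>I. first_variation a e (g \<circ> chart_inv ?d) (Z i \<circ> chart_inv ?d) (snd ?d x))"
    by (intro first_variation_sum assms(1)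
        C1_field_differentiable[OF assms(2) chart_at_mem in_chart_image[OF mem_chart_at]])
  then show ?thesis
    by (simp add: variation_density_def Let_def sum_divide_distrib o_def)
qed

text \<open>For a field supported in one chart both integrals are Lebesgue integrals over the chart
  image, where the integration by parts of a patch applies.\<close>

lemma variation_density_integral:
  assumes Z: "C1_field Z" and c: "c \<in> A" and C: "compact C" "C \<subseteq> chart_image c"
    and 0: "\<And>x. x \<notin> chart_inv c ` C \<Longrightarrow> Z x = 0"
  shows "integrable M (variation_density Z)" "integrable M (force_density Z)"
    and "integral\<^sup>L M (variation_density Z) = integral\<^sup>L M (force_density Z)"
proof -
  interpret c: patch "chart_image c" "g \<circ> chart_inv c" e a by (rule patch_chart[OF c])
  have smooth: "smooth_map A g" using immersion by (simp add: immersion_def)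
  have K: "closed (chart_inv c ` C)" "chart_inv c ` C \<subseteq> fst c"
    using compact_imp_closed[OF compact_chart_inv_image[OF c C]] C c by auto
  have Z0: "(Z \<circ> chart_inv c) u = 0" if "u \<in> chart_image c" "u \<notin> C" for u
  proof -
    have "chart_inv c u \<notin> chart_inv c ` C"
    proof
      assume "chart_inv c u \<in> chart_inv c ` C"
      then obtain v where "v \<in> C" "chart_inv c u = chart_inv c v" by auto
      then have "u = v" using chart_inv_right[OF c that(1)] chart_inv_right[OF c, of v] C by auto
      with that \<open>v \<in> C\<close> show False by simp
    qed
    then show ?thesis using 0 by simp
  qed
  note fv = c.first_variation_integral[OF C1_fieldD[OF Z c] C Z0]
  have eq1: "indicator (chart_image c) u * variation_density Z (chart_inv c u) * area_in c u =
      indicator (chart_image c) u * first_variation a e (g \<circ> chart_inv c) (Z \<circ> chart_inv c) u" for u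
    using variation_density_chart[OF Z c, of u] by (cases "u \<in> chart_image c") auto
  have eq2: "indicator (chart_image c) u * force_density Z (chart_inv c u) * area_in c u =
      indicator (chart_image c) u * (euler_lagrange a e (g \<circ> chart_inv c) u \<bullet> (Z \<circ> chart_inv c) u)" for u
    using force_chart[OF c, of u Z] by (cases "u \<in> chart_image c") auto
  have vd0: "variation_density Z x = 0" if "x \<notin> chart_inv c ` C" for x
    by (rule variation_density_eq_0[OF K(1) 0 that])
  have m1: "variation_density Z \<in> borel_measurable borel" "\<forall>x. x \<notin> fst c \<longrightarrow> variation_density Z x = 0"
    using continuous_variation_density[OF Z] vd0 K(2)
    by (auto intro: borel_measurable_continuous_onI)
  have m2: "force_density Z \<in> borel_measurable borel" "\<forall>x. x \<notin> fst c \<longrightarrow> force_density Z x = 0"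
  proof -
    have "Z x = 0" if "x \<notin> fst c" for x
      using K(2) that by (intro 0) blast
    then show "\<forall>x. x \<notin> fst c \<longrightarrow> force_density Z x = 0" by simp
  qed (rule borel_measurable_continuous_onI[OF continuous_force_density[OF Z]])
  show "integrable M (variation_density Z)"
    unfolding volume_measure_transfer(1)[OF smooth c m1] eq1 by (rule fv(1))
  show "integrable M (force_density Z)"
    unfolding volume_measure_transfer(1)[OF smooth c m2] eq2 by (rule fv(2))
  show "integral\<^sup>L M (variation_density Z) = integral\<^sup>L M (force_density Z)"
    unfolding volume_measure_transfer(2)[OF smooth c m1] volume_measure_transfer(2)[OF smooth c m2] eq1 eq2
    by (rule fv(3))
qed

end

section \<open>Variations of the whole surface and the derivative of their energy\<close>

lemma smooth_variation_immersion:
  "compact_variation A g \<epsilon> K G \<Longrightarrow> \<bar>t\<bar> < \<epsilon> \<Longrightarrow> immersion A (G t)"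
  by (auto simp: compact_variation_def smooth_variation_def abs_less_iff)

locale surface_variation = immersed_surface A g e a
  for A :: "'a::{t2_space,second_countable_topology} chart set" and g :: "'a \<Rightarrow> 'b::euclidean_space"
    and e :: 'b and a :: real +
  fixes \<epsilon> :: real and K :: "'a set" and G :: "real \<Rightarrow> 'a \<Rightarrow> 'b"
  assumes variation: "compact_variation A g \<epsilon> K G"
begin

lemma eps_pos: "0 < \<epsilon>" and compact_K: "compact K" and G_0: "G 0 = g"
  and G_outside: "\<bar>t\<bar> < \<epsilon> \<Longrightarrow> x \<notin> K \<Longrightarrow> G t x = g x"
  using variation by (auto simp: compact_variation_def smooth_variation_def abs_less_iff)

lemma smooth_G: "\<bar>t\<bar> < \<epsilon> \<Longrightarrow> smooth_map A (G t)"
  using smooth_variation_immersion[OF variation] by (simp add: immersion_def)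

lemma closed_K: "closed K"
  using compact_K compact_imp_closed by blast

lemma patch_variation_chart:
  assumes c: "c \<in> A"
  shows "patch_variation (chart_image c) (\<lambda>(t, u). G t (chart_inv c u)) e \<epsilon>"
proof
  show "Ck_on k ({-\<epsilon><..<\<epsilon>} \<times> chart_image c) (\<lambda>(t, u). G t (chart_inv c u))" for k
    using variation c by (auto simp: compact_variation_def smooth_variation_def smooth_on_def)
  show "0 < gram (pd 1 (\<lambda>u. case (t, u) of (t, u) \<Rightarrow> G t (chart_inv c u)) u)
      (pd 2 (\<lambda>u. case (t, u) of (t, u) \<Rightarrow> G t (chart_inv c u)) u)" if "\<bar>t\<bar> < \<epsilon>" "u \<in> chart_image c" for t u
    using smooth_variation_immersion[OF variation that(1)] that(2) c unfolding immersion_iff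
    by (simp add: o_def)
qed (use eps_pos open_chart_image[OF c] positive in \<open>simp_all add: G_0\<close>)

text \<open>The full variational field, tangential part included: the energy is differentiated in
  its direction, and the pairing with the normal vector \<open>force\<close> discards the tangential
  part afterwards.\<close>

definition field :: "'a \<Rightarrow> 'b" where
  "field x = vector_derivative (\<lambda>t. G t x) (at 0)"

lemma velocity_eq_field:
  assumes c: "c \<in> A" and u: "u \<in> chart_image c"
  shows "patch_variation.velocity (\<lambda>(t, u). G t (chart_inv c u)) u = (field \<circ> chart_inv c) u"
proof -
  let ?\<Psi> = "\<lambda>(t, u). G t (chart_inv c u)"
  interpret patch_variation "chart_image c" ?\<Psi> e a \<epsilon> by (rule patch_variation_chart[OF c])
  have "((\<lambda>t. ?\<Psi> (t, u)) has_derivative (\<lambda>r. frechet_derivative ?\<Psi> (at (0, u)) (r, 0))) (at 0)"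
    by (rule has_derivative_slice(2)[OF Ck_on_SucD[OF Psi]]) (use u eps_pos in auto)
  moreover have "frechet_derivative ?\<Psi> (at (0, u)) (r, 0) = r *\<^sub>R frechet_derivative ?\<Psi> (at (0, u)) (1, 0)" for r
  proof -
    have "linear (frechet_derivative ?\<Psi> (at (0, u)))"
      by (rule has_derivative_linear[OF Ck_on_SucD[OF Psi]]) (use u eps_pos in auto)
    from linear_cmul[OF this, of r "(1, 0)"] show ?thesis by simp
  qed
  ultimately have "((\<lambda>t. ?\<Psi> (t, u)) has_vector_derivative frechet_derivative ?\<Psi> (at (0, u)) (1, 0)) (at 0)"
    unfolding has_vector_derivative_def by (rule has_derivative_eq_rhs[OF _ ext])
  from vector_derivative_at[OF this] show ?thesis
    by (simp add: velocity_def field_def)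
qed

lemma field_C1: "C1_field field"
  unfolding C1_field_def
proof
  fix c assume c: "c \<in> A"
  interpret patch_variation "chart_image c" "\<lambda>(t, u). G t (chart_inv c u)" e a \<epsilon>
    by (rule patch_variation_chart[OF c])
  show "Ck_on 1 (chart_image c) (field \<circ> chart_inv c)"
    by (rule Ck_on_cong[OF open_U velocity_eq_field[OF c] velocity_Ck])
qed

lemma field_outside:
  assumes "x \<notin> K"
  shows "field x = 0"
proof -
  have "((\<lambda>t. G t x) has_vector_derivative 0) (at 0)"
    by (rule has_vector_derivative_transform_within_open[OF has_vector_derivative_const[of "g x"], of "{-\<epsilon><..<\<epsilon>}"])
      (use eps_pos G_outside[OF _ assms] in \<open>auto simp: abs_less_iff\<close>)
  then show ?thesis unfolding field_def by (rule vector_derivative_at)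
qed

text \<open>On the surface both the integrand and the measure depend on \<open>t\<close>. In a chart
  the area factor moves into the integrand, and the derivative is taken under the fixed Lebesgue
  measure.\<close>

lemma energy_weight_derivative:
  assumes c: "c \<in> A" and C: "compact C" "C \<subseteq> chart_image c"
    and m: "m \<in> borel_measurable borel" "\<And>x. \<bar>m x\<bar> \<le> 1"
    and m0: "\<And>x. x \<notin> chart_inv c ` C \<Longrightarrow> m x = 0"
  obtains \<delta> where "0 < \<delta>" "\<delta> \<le> \<epsilon>"
    "\<And>t. \<bar>t\<bar> < \<delta> \<Longrightarrow> integrable (volume_measure A (induced_metric (G t))) (\<lambda>x. m x * (G t x \<bullet> e) powr a)"
    "integrable M (\<lambda>x. m x * variation_density field x)"
    "((\<lambda>t. \<integral>x. m x * (G t x \<bullet> e) powr a \<partial>volume_measure A (induced_metric (G t))) has_real_derivative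
       (\<integral>x. m x * variation_density field x \<partial>M)) (at 0)"
proof -
  let ?\<Psi> = "\<lambda>(t, u). G t (chart_inv c u)"
  let ?m = "\<lambda>u. indicator (chart_image c) u * m (chart_inv c u)"
  interpret patch_variation "chart_image c" ?\<Psi> e a \<epsilon> by (rule patch_variation_chart[OF c])
  have smooth: "smooth_map A g" using immersion by (simp add: immersion_def)
  have outside: "\<forall>x. x \<notin> fst c \<longrightarrow> m x = 0"
  proof (intro allI impI m0)
    fix x assume "x \<notin> fst c"
    then show "x \<notin> chart_inv c ` C" using C(2) c by auto
  qed
  have m': "?m \<in> borel_measurable borel" by (rule measurable_in_chart[OF c m(1)])
  have bound: "\<bar>?m u\<bar> \<le> 1" for u using m(2) by (simp add: indicator_def)
  have m'0: "?m u = 0" if "u \<notin> C" for u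
  proof (cases "u \<in> chart_image c")
    case True
    have "chart_inv c u \<notin> chart_inv c ` C"
    proof
      assume "chart_inv c u \<in> chart_inv c ` C"
      then obtain v where v: "v \<in> C" "chart_inv c u = chart_inv c v" by auto
      then have "u = v" using chart_inv_right[OF c True] chart_inv_right[OF c, of v] C by auto
      with that v show False by simp
    qed
    then show ?thesis using m0 by simp
  qed simp
  obtain \<delta> where \<delta>: "0 < \<delta>" "\<delta> \<le> \<epsilon>"
    and int: "\<And>t. \<bar>t\<bar> < \<delta> \<Longrightarrow> integrable lborel (\<lambda>u. ?m u * energy_density a e (\<lambda>u. ?\<Psi> (t, u)) u)"
    and der: "((\<lambda>t. \<integral>u. ?m u * energy_density a e (\<lambda>u. ?\<Psi> (t, u)) u \<partial>lborel) has_real_derivative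
       (\<integral>u. ?m u * first_variation a e (\<lambda>u. ?\<Psi> (0, u)) velocity u \<partial>lborel)) (at 0)"
    using weighted_energy_derivative[OF C m' bound m'0] by blast
  have fv: "first_variation a e (\<lambda>u. ?\<Psi> (0, u)) velocity u = variation_density field (chart_inv c u) * area_in c u"
    if "u \<in> chart_image c" for u
  proof -
    have "first_variation a e (\<lambda>u. ?\<Psi> (0, u)) velocity u = first_variation a e (g \<circ> chart_inv c) velocity u"
      by (simp add: G_0 o_def)
    also have "\<dots> = first_variation a e (g \<circ> chart_inv c) (field \<circ> chart_inv c) u"
      by (rule first_variation_cong[OF open_U that velocity_eq_field[OF c]])
    also have "\<dots> = variation_density field (chart_inv c u) * area_in c u"
      by (rule variation_density_chart[OF field_C1 c that])
    finally show ?thesis .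
  qed
  have ed: "energy_density a e (\<lambda>u. ?\<Psi> (t, u)) u =
      (G t (chart_inv c u) \<bullet> e) powr a * area (pd 1 (G t \<circ> chart_inv c) u) (pd 2 (G t \<circ> chart_inv c) u)" for t u
    by (simp add: energy_density_def o_def)
  have meas: "(\<lambda>x. m x * (G t x \<bullet> e) powr a) \<in> borel_measurable borel" if "\<bar>t\<bar> < \<epsilon>" for t
  proof -
    have "continuous_on UNIV (G t)"
      by (rule continuous_on_charts_Ck[OF smooth_map_Ck[OF smooth_G[OF that]]])
    then have "(\<lambda>x. G t x \<bullet> e) \<in> borel_measurable borel"
      by (intro borel_measurable_continuous_onI continuous_on_inner continuous_on_const)
    then show ?thesis using m(1) by measurable
  qed
  have meas0: "(\<lambda>x. m x * variation_density field x) \<in> borel_measurable borel"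
    by (intro borel_measurable_times m(1) borel_measurable_continuous_onI continuous_variation_density field_C1)
  have out1: "\<forall>x. x \<notin> fst c \<longrightarrow> m x * f x = 0" for f using outside by simp
  have eq: "indicator (chart_image c) u * (m (chart_inv c u) * (G t (chart_inv c u) \<bullet> e) powr a) *
      area (pd 1 (G t \<circ> chart_inv c) u) (pd 2 (G t \<circ> chart_inv c) u) = ?m u * energy_density a e (\<lambda>u. ?\<Psi> (t, u)) u" for t u
    unfolding ed by simp
  have eq0: "indicator (chart_image c) u * (m (chart_inv c u) * variation_density field (chart_inv c u)) * area_in c u =
     ?m u * first_variation a e (\<lambda>u. ?\<Psi> (0, u)) velocity u" for u
    using fv[of u] by (cases "u \<in> chart_image c") simp_all
  show ?thesis
  proof (rule that[OF \<delta>])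
    show "integrable (volume_measure A (induced_metric (G t))) (\<lambda>x. m x * (G t x \<bullet> e) powr a)" if "\<bar>t\<bar> < \<delta>" for t
    proof -
      have t: "\<bar>t\<bar> < \<epsilon>" using that \<delta> by linarith
      show ?thesis
        unfolding volume_measure_transfer(1)[OF smooth_G[OF t] c meas[OF t] out1] eq by (rule int[OF that])
    qed
    have "continuous_on C (first_variation a e (\<lambda>u. ?\<Psi> (0, u)) velocity)"
      using continuous_on_subset[OF first_variation_continuous[OF velocity_Ck] C(2)] .
    from integrable_weight[OF C(1) this m' bound m'0]
    show "integrable M (\<lambda>x. m x * variation_density field x)"
      unfolding volume_measure_transfer(1)[OF smooth c meas0 out1] eq0 .
    have int0: "(\<integral>x. m x * variation_density field x \<partial>M) =
        (\<integral>u. ?m u * first_variation a e (\<lambda>u. ?\<Psi> (0, u)) velocity u \<partial>lborel)"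
      unfolding volume_measure_transfer(2)[OF smooth c meas0 out1] eq0 ..
    show "((\<lambda>t. \<integral>x. m x * (G t x \<bullet> e) powr a \<partial>volume_measure A (induced_metric (G t))) has_real_derivative
       (\<integral>x. m x * variation_density field x \<partial>M)) (at 0)"
      unfolding int0
    proof (rule has_field_derivative_transform_within[OF der eps_pos UNIV_I])
      fix t :: real assume "dist t 0 < \<epsilon>"
      then have t: "\<bar>t\<bar> < \<epsilon>" by simp
      show "(\<integral>u. ?m u * energy_density a e (\<lambda>u. ?\<Psi> (t, u)) u \<partial>lborel) =
          (\<integral>x. m x * (G t x \<bullet> e) powr a \<partial>volume_measure A (induced_metric (G t)))"
        unfolding volume_measure_transfer(2)[OF smooth_G[OF t] c meas[OF t] out1] eq ..
    qed
  qed
qed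

text \<open>Every point of \<open>K\<close> is the centre of a bump that is positive there; by
  compactness finitely many of the open positivity sets cover \<open>K\<close>.\<close>

lemma bump_cover:
  obtains I :: "'a set" and c p r where "finite I"
    "\<And>i. i \<in> I \<Longrightarrow> c i \<in> A" "\<And>i. i \<in> I \<Longrightarrow> 0 < r i" "\<And>i. i \<in> I \<Longrightarrow> cball (p i) (r i) \<subseteq> chart_image (c i)"
    "\<And>x. x \<in> K \<Longrightarrow> 0 < (\<Sum>i\<in>I. surface_bump (c i) (p i) (r i) x)"
proof -
  let ?c = "\<lambda>x. chart_at A x" and ?p = "\<lambda>x. snd (chart_at A x) x"
  have "\<exists>r>0. cball (?p x) r \<subseteq> chart_image (?c x)" for x
    using open_chart_image[OF chart_at_mem[of x]] in_chart_image[OF mem_chart_at[of x]]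
    by (simp add: open_contains_cball)
  then obtain r where r: "\<And>x. 0 < r x" "\<And>x. cball (?p x) (r x) \<subseteq> chart_image (?c x)" by metis
  let ?b = "\<lambda>x. surface_bump (?c x) (?p x) (r x)"
  have "continuous_on UNIV (?b x)" for x
    by (rule continuous_on_charts_Ck[of 0]) (rule surface_bump_Ck[OF chart_at_mem _ r(1) r(2)])
  then have op: "open {y. 0 < ?b x y}" for x
    by (intro open_Collect_less continuous_on_const)
  have self: "0 < ?b x x" for x
    using r(1)[of x] mem_chart_at[of x] by (simp add: surface_bump_pos_iff)
  have "K \<subseteq> (\<Union>x\<in>K. {y. 0 < ?b x y})" using self by auto
  from compactE_image[OF compact_K _ this] op
  obtain I where I: "I \<subseteq> K" "finite I" "K \<subseteq> (\<Union>x\<in>I. {y. 0 < ?b x y})" by blast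
  have pos: "0 < (\<Sum>i\<in>I. ?b i x)" if x: "x \<in> K" for x
  proof -
    obtain i where i: "i \<in> I" "0 < ?b i x" using I(3) x by blast
    have "?b i x \<le> (\<Sum>i\<in>I. ?b i x)"
      using surface_bump_nonneg by (intro member_le_sum I(2) i(1)) auto
    with i show ?thesis by linarith
  qed
  show ?thesis
    by (rule that[OF I(2) chart_at_mem r(1) r(2) pos])
qed

text \<open>The measurable weights \<open>m i\<close> split the energies, as
  \<open>indicator K\<close> is a factor of the integrand at every time. After differentiation it
  can be removed, and the smooth fields \<open>Z i\<close> take over for integration by
  parts.\<close>

lemma energy_has_derivative:
  "((\<lambda>t. energy_potential A a e K (G t)) has_real_derivative integral\<^sup>L M (force_density field)) (at 0)"
proof -
  obtain I :: "'a set" and c p r where I: "finite I" and c: "\<And>i. i \<in> I \<Longrightarrow> c i \<in> A"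
    and r: "\<And>i. i \<in> I \<Longrightarrow> 0 < r i" "\<And>i. i \<in> I \<Longrightarrow> cball (p i) (r i) \<subseteq> chart_image (c i)"
    and S_pos: "\<And>x. x \<in> K \<Longrightarrow> 0 < (\<Sum>i\<in>I. surface_bump (c i) (p i) (r i) x)"
    by (rule bump_cover) blast
  define b where "b i = surface_bump (c i) (p i) (r i)" for i
  define S where "S x = (\<Sum>i\<in>I. b i x)" for x
  have b_Ck: "Ck_on k (chart_image d) (b i \<circ> chart_inv d)" if "i \<in> I" "d \<in> A" for i d k
    unfolding b_def by (rule surface_bump_Ck[OF c[OF that(1)] that(2) r[OF that(1)]])
  have b_nonneg: "0 \<le> b i x" for i x by (simp add: b_def surface_bump_nonneg)
  have b_support: "b i x = 0" if "i \<in> I" "x \<notin> chart_inv (c i) ` cball (p i) (r i)" for i x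
    unfolding b_def by (rule surface_bump_support[OF c[OF that(1)] r(1)[OF that(1)] that(2)])
  have S_Ck: "Ck_on k (chart_image d) (S \<circ> chart_inv d)" if "d \<in> A" for d k
    using Ck_on_sum[OF open_chart_image[OF that] b_Ck[OF _ that], of I] by (simp add: S_def o_def)
  have S_K: "0 < S x" if "x \<in> K" for x using S_pos[OF that] by (simp add: S_def b_def)
  have S_nonneg: "0 \<le> S x" for x unfolding S_def by (intro sum_nonneg b_nonneg)
  have cont_b: "continuous_on UNIV (b i)" if "i \<in> I" for i
    by (rule continuous_on_charts_Ck[OF b_Ck[OF that]])
  have cont_S: "continuous_on UNIV S" by (rule continuous_on_charts_Ck[OF S_Ck])
  \<comment> \<open>The zeros of \<open>S\<close> lie off \<open>K\<close>, where the field
    vanishes. On the open set where \<open>S\<close> is positive the quotient is regular, on the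
    complement of \<open>K\<close> it is 0, and these two sets cover the surface.\<close>
  define Y where "Y x = inverse (S x) *\<^sub>R field x" for x
  have Y_C1: "Ck_on 1 (chart_image d) (Y \<circ> chart_inv d)" if d: "d \<in> A" for d
  proof -
    let ?U = "{u \<in> chart_image d. chart_inv d u \<in> {x. 0 < S x}}" and ?V = "{u \<in> chart_image d. chart_inv d u \<in> - K}"
    have U: "open ?U" by (intro open_in_chart d open_Collect_less cont_S continuous_on_const)
    have V: "open ?V" by (rule open_in_chart[OF d]) (use closed_K in auto)
    have "Ck_on 1 ?U (\<lambda>u. ((S \<circ> chart_inv d) u powr (-1)) *\<^sub>R (field \<circ> chart_inv d) u)"
      by (intro Ck_on_scaleR Ck_on_powr' U Ck_on_subset[OF S_Ck[OF d]] Ck_on_subset[OF C1_fieldD[OF field_C1 d]]) auto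
    then have 1: "Ck_on 1 ?U (Y \<circ> chart_inv d)"
      by (rule Ck_on_cong[OF U, rotated]) (simp add: Y_def powr_minus)
    have 2: "Ck_on 1 ?V (Y \<circ> chart_inv d)"
      by (rule Ck_on_cong[OF V _ Ck_on_const[of _ _ 0]]) (simp add: Y_def field_outside)
    have "?U \<union> ?V = chart_image d" using S_K by auto
    with Ck_on_Un[OF U V 1 2] show ?thesis by simp
  qed
  define Z where "Z i x = b i x *\<^sub>R Y x" for i x
  have Z_C1: "C1_field (Z i)" if "i \<in> I" for i
    unfolding C1_field_def
  proof
    fix d assume d: "d \<in> A"
    from Ck_on_scaleR[OF open_chart_image[OF d] b_Ck[OF that d] Y_C1[OF d]]
    show "Ck_on 1 (chart_image d) (Z i \<circ> chart_inv d)" by (simp add: Z_def o_def)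
  qed
  have field_sum: "field x = (\<Sum>i\<in>I. Z i x)" for x
  proof -
    have "(\<Sum>i\<in>I. Z i x) = (S x * inverse (S x)) *\<^sub>R field x"
      by (simp add: Z_def Y_def S_def sum_distrib_right flip: scaleR_sum_left)
    also have "\<dots> = field x"
      using S_K[of x] field_outside[of x] by (cases "x \<in> K") auto
    finally show ?thesis ..
  qed
  have Z_int: "integrable M (variation_density (Z i))" "integrable M (force_density (Z i))"
    "integral\<^sup>L M (variation_density (Z i)) = integral\<^sup>L M (force_density (Z i))" if "i \<in> I" for i
  proof -
    have "Z i x = 0" if "x \<notin> chart_inv (c i) ` cball (p i) (r i)" for x
      using b_support[OF \<open>i \<in> I\<close> that] by (simp add: Z_def)
    from variation_density_integral[OF Z_C1[OF that] c[OF that] compact_cball r(2)[OF that] this]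
    show "integrable M (variation_density (Z i))" "integrable M (force_density (Z i))"
      "integral\<^sup>L M (variation_density (Z i)) = integral\<^sup>L M (force_density (Z i))" by blast+
  qed
  \<comment> \<open>Each weight is one of several nonnegative summands of
    \<open>indicator K x\<close>, which gives the bound 1. The indicator makes the sum correct also
    at points outside \<open>K\<close>.\<close>
  define m where "m i x = indicator K x * (b i x / S x)" for i x
  have m_meas: "m i \<in> borel_measurable borel" if "i \<in> I" for i
    unfolding m_def[abs_def]
    by (intro borel_measurable_times borel_measurable_divide borel_measurable_continuous_onI cont_b that cont_S
        borel_measurable_indicator borel_closed closed_K)
  have m_sum: "(\<Sum>i\<in>I. m i x) = indicator K x" for x
    using S_K[of x] by (auto simp: m_def indicator_def S_def simp flip: sum_divide_distrib)
  have m_bound: "\<bar>m i x\<bar> \<le> 1" if "i \<in> I" for i x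
  proof -
    have m: "0 \<le> m i x" for i by (simp add: m_def b_nonneg S_nonneg)
    then have "m i x \<le> (\<Sum>i\<in>I. m i x)" by (intro member_le_sum I that) auto
    also have "\<dots> \<le> 1" by (simp add: m_sum indicator_def)
    finally show ?thesis using m[of i] by linarith
  qed
  have m_0: "m i x = 0" if "i \<in> I" "x \<notin> chart_inv (c i) ` cball (p i) (r i)" for i x
    using b_support[OF that] by (simp add: m_def)
  let ?M = "\<lambda>t. volume_measure A (induced_metric (G t))"
  let ?f = "\<lambda>i t x. m i x * (G t x \<bullet> e) powr a"
  have "\<exists>\<delta>>0. (\<forall>t. \<bar>t\<bar> < \<delta> \<longrightarrow> integrable (?M t) (?f i t)) \<and>
      integrable M (\<lambda>x. m i x * variation_density field x) \<and>
      ((\<lambda>t. integral\<^sup>L (?M t) (?f i t)) has_real_derivative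
        (\<integral>x. m i x * variation_density field x \<partial>M)) (at 0)" if "i \<in> I" for i
    by (rule energy_weight_derivative[OF c[OF that] compact_cball r(2)[OF that] m_meas[OF that] m_bound[OF that] m_0[OF that]])
      blast+
  then have "\<forall>i\<in>I. \<exists>\<delta>. 0 < \<delta> \<and> (\<forall>t. \<bar>t\<bar> < \<delta> \<longrightarrow> integrable (?M t) (?f i t))"
    and int0: "\<And>i. i \<in> I \<Longrightarrow> integrable M (\<lambda>x. m i x * variation_density field x)"
    and der: "\<And>i. i \<in> I \<Longrightarrow> ((\<lambda>t. integral\<^sup>L (?M t) (?f i t)) has_real_derivative
        (\<integral>x. m i x * variation_density field x \<partial>M)) (at 0)"
    by blast+
  from bchoice[OF this(1)] obtain \<delta> where \<delta>: "\<And>i. i \<in> I \<Longrightarrow> 0 < \<delta> i"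
    and int: "\<And>i t. i \<in> I \<Longrightarrow> \<bar>t\<bar> < \<delta> i \<Longrightarrow> integrable (?M t) (?f i t)"
    by blast
  \<comment> \<open>The element 1 keeps the minimum meaningful when the index set is empty.\<close>
  define \<delta>' where "\<delta>' = Min (insert 1 (\<delta> ` I))"
  have \<delta>': "0 < \<delta>'" "\<And>i. i \<in> I \<Longrightarrow> \<delta>' \<le> \<delta> i" using I \<delta> by (auto simp: \<delta>'_def)
  have "((\<lambda>t. \<Sum>i\<in>I. integral\<^sup>L (?M t) (?f i t)) has_real_derivative
      (\<Sum>i\<in>I. \<integral>x. m i x * variation_density field x \<partial>M)) (at 0)"
    by (intro DERIV_sum der)
  then have "((\<lambda>t. energy_potential A a e K (G t)) has_real_derivative
      (\<Sum>i\<in>I. \<integral>x. m i x * variation_density field x \<partial>M)) (at 0)"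
  proof (rule has_field_derivative_transform_within[OF _ \<delta>'(1) UNIV_I])
    fix t :: real assume "dist t 0 < \<delta>'"
    then have t: "\<bar>t\<bar> < \<delta> i" if "i \<in> I" for i using \<delta>'(2)[OF that] by simp
    have "indicator K x *\<^sub>R (G t x \<bullet> e) powr a = (\<Sum>i\<in>I. ?f i t x)" for x
      by (simp add: m_sum flip: sum_distrib_right)
    then show "(\<Sum>i\<in>I. integral\<^sup>L (?M t) (?f i t)) = energy_potential A a e K (G t)"
      unfolding energy_potential_def set_lebesgue_integral_def
      using Bochner_Integration.integral_sum[of I "?M t" "\<lambda>i. ?f i t"] int[OF _ t] by simp
  qed
  also have "(\<Sum>i\<in>I. \<integral>x. m i x * variation_density field x \<partial>M) = (\<integral>x. (\<Sum>i\<in>I. m i x * variation_density field x) \<partial>M)"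
    by (rule Bochner_Integration.integral_sum[symmetric]) (rule int0)
  \<comment> \<open>The weights sum to the indicator of \<open>K\<close>, which drops out because
    the variation density is 0 off \<open>K\<close>.\<close>
  also have "(\<lambda>x. \<Sum>i\<in>I. m i x * variation_density field x) = variation_density field"
  proof
    fix x
    have "variation_density field x = 0" if "x \<notin> K"
      by (rule variation_density_eq_0[OF closed_K field_outside that])
    then show "(\<Sum>i\<in>I. m i x * variation_density field x) = variation_density field x"
      by (cases "x \<in> K") (simp_all add: m_sum flip: sum_distrib_right)
  qed
  \<comment> \<open>From here on the smooth splitting of the field replaces the measurable splitting
    of the energy.\<close>
  also have "variation_density field = (\<lambda>x. \<Sum>i\<in>I. variation_density (Z i) x)"
    unfolding field_sum[abs_def] by (rule ext, rule variation_density_sum[OF I Z_C1])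
  also have "integral\<^sup>L M (\<lambda>x. \<Sum>i\<in>I. variation_density (Z i) x) = (\<Sum>i\<in>I. integral\<^sup>L M (variation_density (Z i)))"
    by (rule Bochner_Integration.integral_sum) (rule Z_int)
  also have "\<dots> = (\<Sum>i\<in>I. integral\<^sup>L M (force_density (Z i)))"
    by (intro sum.cong refl Z_int)
  also have "\<dots> = (\<integral>x. (\<Sum>i\<in>I. force_density (Z i) x) \<partial>M)"
    by (rule Bochner_Integration.integral_sum[symmetric]) (rule Z_int)
  also have "(\<lambda>x. \<Sum>i\<in>I. force_density (Z i) x) = force_density field"
    by (simp add: field_sum inner_sum_right sum_distrib_left)
  finally show ?thesis .
qed

lemma normal_variation_field_inner:
  "force x \<bullet> normal_variation_field A G x = force x \<bullet> field x"
  unfolding normal_variation_field_def G_0 field_def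
  by (simp add: inner_commute[of "force x"] normal_part_inner[OF force_normal])

end

subsection \<open>Critical points\<close>

lemma integral_pos_of_open:
  fixes f :: "'a::euclidean_space \<Rightarrow> real"
  assumes "integrable lborel f" "\<And>x. 0 \<le> f x" "0 < r" "\<And>x. x \<in> ball p r \<Longrightarrow> 0 < f x"
  shows "integral\<^sup>L lborel f \<noteq> 0"
proof
  assume "integral\<^sup>L lborel f = 0"
  then have "AE x in lborel. f x = 0"
    using integral_nonneg_eq_0_iff_AE[OF assms(1)] assms(2) by simp
  then have "AE x in lborel. x \<notin> ball p r"
    by eventually_elim (use assms(4) in force)
  then have "ball p r \<in> null_sets lborel"
    by (subst AE_iff_null_sets) auto
  then have "measure lborel (ball p r) = 0"
    by (simp add: null_sets_def measure_def)
  then show False using content_ball_pos[OF assms(3), of p] by simp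
qed

context immersed_surface
begin

text \<open>Being an immersion is an open condition, and \<open>g\<close> is changed on a compact
  set only, so one time interval serves all points. Positivity of the Gram determinant is secured in
  the chart \<open>c\<close> and carried to other charts by the invertible transition Jacobian; off
  the support nothing changes.\<close>

lemma bump_variation:
  assumes c: "c \<in> A" and r: "0 < r" "cball p r \<subseteq> chart_image c"
  obtains \<epsilon> where "compact_variation A g \<epsilon> (chart_inv c ` cball p r)
     (\<lambda>t x. g x + (t * surface_bump c p r x) *\<^sub>R w)"
proof -
  let ?\<rho> = "surface_bump c p r" and ?K = "chart_inv c ` cball p r"
  let ?G = "\<lambda>t x. g x + (t * ?\<rho> x) *\<^sub>R w"
  have K: "compact ?K" "closed ?K"
    using compact_chart_inv_image[OF c compact_cball r(2)] compact_imp_closed by auto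
  have \<rho>_Ck: "Ck_on k (chart_image d) (?\<rho> \<circ> chart_inv d)" if "d \<in> A" for d k
    by (rule surface_bump_Ck[OF c that r])
  have outside: "?\<rho> x = 0" if "x \<notin> ?K" for x
    by (rule surface_bump_support[OF c r(1) that])
  have smooth: "smooth_map A (?G t)" for t
    unfolding smooth_map_def smooth_on_def
  proof (intro ballI allI)
    fix d k assume d: "d \<in> A"
    have "Ck_on k (chart_image d) (\<lambda>u. (g \<circ> chart_inv d) u + (t * (?\<rho> \<circ> chart_inv d) u) *\<^sub>R w)"
      by (intro Ck_on_add Ck_on_scaleR Ck_on_mult Ck_on_const g_Ck \<rho>_Ck open_chart_image d)
    then show "Ck_on k (chart_image d) (?G t \<circ> chart_inv d)" by (simp add: o_def)
  qed
  have pd: "pd i (?G t \<circ> chart_inv c) u = pd i (g \<circ> chart_inv c) u + (t * pd i (?\<rho> \<circ> chart_inv c) u) *\<^sub>R w"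
    if u: "u \<in> chart_image c" for i t u
  proof -
    have "((\<lambda>u. (g \<circ> chart_inv c) u + (t * (?\<rho> \<circ> chart_inv c) u) *\<^sub>R w) has_derivative
       (\<lambda>v. frechet_derivative (g \<circ> chart_inv c) (at u) v +
         (t * frechet_derivative (?\<rho> \<circ> chart_inv c) (at u) v) *\<^sub>R w)) (at u)"
      by (intro has_derivative_add has_derivative_scaleR_left has_derivative_mult_right
          Ck_on_SucD[OF g_Ck[OF c] u] Ck_on_SucD[OF \<rho>_Ck[OF c] u])
    from pd_eqI[OF this] show ?thesis by (simp add: pd_def o_def)
  qed
  let ?N = "\<lambda>z. gram (pd 1 (g \<circ> chart_inv c) (snd z) + (fst z * pd 1 (?\<rho> \<circ> chart_inv c) (snd z)) *\<^sub>R w)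
     (pd 2 (g \<circ> chart_inv c) (snd z) + (fst z * pd 2 (?\<rho> \<circ> chart_inv c) (snd z)) *\<^sub>R w)"
  \<comment> \<open>The pairs of time and coordinates at which the varied map is still immersed. The
    set is open and contains the slice at time 0 over the closed ball, so a uniform tube around that
    slice supplies \<open>\<epsilon>\<close>.\<close>
  let ?O = "(UNIV \<times> chart_image c) \<inter> ?N -` {0<..}"
  have "continuous_on (UNIV \<times> chart_image c) (\<lambda>z::real \<times> (real^2). pd i f (snd z))"
    if "continuous_on (chart_image c) (pd i f)" for i and f :: "real^2 \<Rightarrow> 'x::real_normed_vector"
    by (rule continuous_on_compose2[OF that]) (auto intro!: continuous_intros)
  note cont = this[OF Ck_on_imp_continuous[OF Ck_on_pd[OF g_Ck[OF c]]]]
    this[OF Ck_on_imp_continuous[OF Ck_on_pd[OF \<rho>_Ck[OF c]]]]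
  have "continuous_on (UNIV \<times> chart_image c) ?N"
    unfolding gram_def by (intro continuous_intros cont)
  then have O: "open ?O"
    by (intro continuous_open_preimage open_Times open_UNIV open_chart_image c) auto
  have "compact ({0::real} \<times> cball p r)" by (intro compact_Times) auto
  moreover have "{0} \<times> cball p r \<subseteq> ?O"
  proof clarify
    fix u assume "u \<in> cball p r"
    then have u: "u \<in> chart_image c" using r by blast
    then show "(0, u) \<in> ?O" using gram_g[OF c u] by simp
  qed
  ultimately obtain \<epsilon> where \<epsilon>: "0 < \<epsilon>" "(\<Union>z\<in>{0} \<times> cball p r. ball z \<epsilon>) \<subseteq> ?O"
    using compact_subset_open_imp_ball_epsilon_subset[OF _ O] by blast
  have in_c: "0 < gram (pd 1 (?G t \<circ> chart_inv c) u) (pd 2 (?G t \<circ> chart_inv c) u)"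
    if t: "\<bar>t\<bar> < \<epsilon>" and u: "u \<in> cball p r" for t u
  proof -
    have "(t, u) \<in> ball (0, u) \<epsilon>" using t by (simp add: dist_Pair_Pair dist_real_def)
    then have "(t, u) \<in> ?O" using \<epsilon>(2) u by blast
    then show ?thesis using pd[of u] by simp
  qed
  have immersion_G: "immersion A (?G t)" if t: "\<bar>t\<bar> < \<epsilon>" for t
    unfolding immersion_iff
  proof (intro conjI ballI smooth)
    fix d u assume d: "d \<in> A" "u \<in> chart_image d"
    show "0 < gram (pd 1 (?G t \<circ> chart_inv d) u) (pd 2 (?G t \<circ> chart_inv d) u)"
    proof (cases "chart_inv d u \<in> ?K")
      case True
      then obtain v where v: "v \<in> cball p r" "chart_inv d u = chart_inv c v" by blast
      then have vc: "v \<in> chart_image c" using r by auto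
      have ud: "u \<in> overlap d c" using overlap_iff[OF d(1)] d(2) v(2) c vc by simp
      have uv: "transition d c u = v" using v(2) c vc by simp
      have diff: "?G t \<circ> chart_inv c differentiable (at (transition d c u))"
        unfolding uv by (rule Ck_on_differentiable[OF smooth_map_Ck[OF smooth c] vc])
      have "gram (pd 1 (?G t \<circ> chart_inv d) u) (pd 2 (?G t \<circ> chart_inv d) u) =
          (det (jacobian d c u))\<^sup>2 * gram (pd 1 (?G t \<circ> chart_inv c) v) (pd 2 (?G t \<circ> chart_inv c) v)"
        unfolding pd_chart_change[OF d(1) c ud diff] gram_combination uv
        unfolding det_2 ..
      then show ?thesis
        using in_c[OF t v(1)] det_jacobian[OF d(1) c ud] by simp
    next
      case False
      let ?V = "{u \<in> chart_image d. chart_inv d u \<in> - ?K}"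
      have V: "open ?V" by (rule open_in_chart[OF d(1)]) (use K in auto)
      have "pd i (?G t \<circ> chart_inv d) u = pd i (g \<circ> chart_inv d) u" for i
        by (rule pd_cong_open[OF V]) (use False d outside in auto)
      then show ?thesis using gram_g[OF d] by simp
    qed
  qed
  have "compact_variation A g \<epsilon> ?K ?G"
    unfolding compact_variation_def smooth_variation_def
  proof (intro conjI ballI allI impI \<epsilon>(1) K(1))
    fix d assume d: "d \<in> A"
    let ?W = "{-\<epsilon><..<\<epsilon>} \<times> chart_image d"
    have W: "open ?W" by (intro open_Times open_chart_image d) auto
    show "smooth_on ?W (\<lambda>(t, u). ?G t (chart_inv d u))"
      unfolding smooth_on_def
    proof
      fix k
      have comp: "Ck_on k ?W (\<lambda>z. f (snd z))" if "Ck_on k (chart_image d) f" for f :: "real^2 \<Rightarrow> 'x::real_normed_vector"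
        by (rule Ck_on_compose[OF W open_chart_image[OF d] Ck_on_linear[OF bounded_linear_snd] that]) auto
      have "Ck_on k ?W (\<lambda>z. (g \<circ> chart_inv d) (snd z) + (fst z * (?\<rho> \<circ> chart_inv d) (snd z)) *\<^sub>R w)"
        by (intro Ck_on_add Ck_on_scaleR Ck_on_mult Ck_on_const W comp[OF g_Ck[OF d]] comp[OF \<rho>_Ck[OF d]]
            Ck_on_linear[OF bounded_linear_fst])
      then show "Ck_on k ?W (\<lambda>(t, u). ?G t (chart_inv d u))"
        by (simp add: case_prod_unfold)
    qed
  qed (use immersion_G outside in \<open>auto simp: abs_less_iff\<close>)
  then show ?thesis by (rule that)
qed

text \<open>The fundamental lemma of the calculus of variations. The test direction is the constant
  vector \<open>w = ?Q p\<close>, whose tangential part away from \<open>p\<close> is invisible to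
  the normal field \<open>?Q\<close>; near \<open>p\<close> the product
  \<open>?Q u \<bullet> w\<close> stays positive, so a bump supported there gives a positive
  integral.\<close>

lemma force_eq_0:
  assumes critical: "energy_critical A a e g"
  shows "force x = 0"
proof (rule ccontr)
  assume force: "force x \<noteq> 0"
  define c where "c = chart_at A x"
  have c: "c \<in> A" "x \<in> fst c" by (simp_all add: c_def chart_at_mem mem_chart_at)
  define p where "p = snd c x"
  have p: "p \<in> chart_image c" using c by (simp add: p_def)
  interpret c: patch "chart_image c" "g \<circ> chart_inv c" e a by (rule patch_chart[OF c(1)])
  let ?Q = "euler_lagrange a e (g \<circ> chart_inv c)"
  define w where "w = ?Q p"
  have "sqrt (det (induced_metric g c p)) \<noteq> 0"
    unfolding sqrt_det_induced_metric by (rule area_in_neq_0[OF c(1) p])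
  then have "w \<noteq> 0"
    using euler_lagrange_eq_force[OF c] force positive[of x] by (simp add: w_def p_def)
  let ?O = "chart_image c \<inter> (\<lambda>u. ?Q u \<bullet> w) -` {0<..}"
  have "open ?O"
    using c.euler_lagrange_Ck
    by (intro continuous_open_preimage open_chart_image c(1) continuous_on_inner continuous_on_const)
      (auto intro: Ck_on_imp_continuous)
  moreover have "p \<in> ?O" using \<open>w \<noteq> 0\<close> p by (simp add: w_def)
  ultimately obtain r where r: "0 < r" "cball p r \<subseteq> ?O"
    unfolding open_contains_cball by blast
  then have r': "cball p r \<subseteq> chart_image c" by blast
  let ?K = "chart_inv c ` cball p r" and ?\<rho> = "surface_bump c p r"
  let ?G = "\<lambda>t x. g x + (t * ?\<rho> x) *\<^sub>R w"
  obtain \<epsilon> where var: "compact_variation A g \<epsilon> ?K ?G"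
    by (rule bump_variation[OF c(1) r(1) r'])
  interpret surface_variation A g e a \<epsilon> ?K ?G by unfold_locales (rule var)
  have field: "field x = ?\<rho> x *\<^sub>R w" for x
  proof -
    have "((\<lambda>t. g x + (t * ?\<rho> x) *\<^sub>R w) has_vector_derivative ?\<rho> x *\<^sub>R w) (at 0)"
      by (auto intro!: derivative_eq_intros simp: has_vector_derivative_def)
    then show ?thesis unfolding field_def by (rule vector_derivative_at)
  qed
  have "((\<lambda>t. energy_potential A a e ?K (?G t)) has_real_derivative 0) (at 0)"
    using critical var unfolding energy_critical_def by blast
  from DERIV_unique[OF energy_has_derivative this]
  have zero: "integral\<^sup>L M (force_density field) = 0" .
  have smooth: "smooth_map A g" using immersion by (simp add: immersion_def)
  have meas: "force_density field \<in> borel_measurable borel"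
    by (rule borel_measurable_continuous_onI[OF continuous_force_density[OF field_C1]])
  have out: "\<forall>x. x \<notin> fst c \<longrightarrow> force_density field x = 0"
    unfolding field by (simp add: surface_bump_def)
  have eq: "indicator (chart_image c) u * force_density field (chart_inv c u) * area_in c u =
      indicator (chart_image c) u * (bump p r u * (?Q u \<bullet> w))" for u
    using force_chart[OF c(1), of u field] surface_bump_chart[OF c(1), of u p r]
    by (cases "u \<in> chart_image c") (auto simp: field)
  have "integrable M (force_density field)"
    by (rule variation_density_integral(2)[OF field_C1 c(1) compact_cball r' field_outside])
  then have "integrable lborel (\<lambda>u. indicator (chart_image c) u * (bump p r u * (?Q u \<bullet> w)))"
    unfolding volume_measure_transfer(1)[OF smooth c(1) meas out] eq .
  then have "integral\<^sup>L lborel (\<lambda>u. indicator (chart_image c) u * (bump p r u * (?Q u \<bullet> w))) \<noteq> 0"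
  proof (rule integral_pos_of_open[OF _ _ r(1)])
    fix u
    have "u \<in> ?O" if "u \<in> ball p r" using r(2) that ball_subset_cball by blast
    then have pos: "0 < ?Q u \<bullet> w" if "u \<in> ball p r" using that by simp
    show "0 \<le> indicator (chart_image c) u * (bump p r u * (?Q u \<bullet> w))"
      using bump_eq_0[OF r(1), of u p] bump_nonneg[of p r u] pos
      by (cases "u \<in> ball p r") (auto intro!: mult_nonneg_nonneg)
    show "0 < indicator (chart_image c) u * (bump p r u * (?Q u \<bullet> w))" if "u \<in> ball p r"
    proof -
      have "u \<in> chart_image c" using that r' ball_subset_cball by blast
      then show ?thesis using pos[OF that] bump_pos_iff[OF r(1), of p u] that by simp
    qed
  qed
  then show False
    using zero unfolding volume_measure_transfer(2)[OF smooth c(1) meas out] eq by contradiction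
qed

lemma first_variation_formula:
  assumes "compact_variation A g \<epsilon> K G"
  shows "((\<lambda>t. energy_potential A a e K (G t)) has_real_derivative
     (\<integral>x. (g x \<bullet> e) powr (a - 1) * (force x \<bullet> normal_variation_field A G x) \<partial>M)) (at 0)"
proof -
  interpret surface_variation A g e a \<epsilon> K G by unfold_locales (rule assms)
  show ?thesis using energy_has_derivative by (simp only: normal_variation_field_inner)
qed

lemma critical_iff_singular_minimal:
  assumes "norm e = 1"
  shows "energy_critical A a e g \<longleftrightarrow> singular_minimal_surface A a e g"
proof -
  have force_iff: "force x = 0 \<longleftrightarrow>
      2 *\<^sub>R mean_curvature A g x = (a / (g x \<bullet> e)) *\<^sub>R normal_part A g x e" for x
  proof -
    \<comment> \<open>Dividing by the positive height turns the vanishing of the force into the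
      defining equation of a singular minimal surface.\<close>
    have "force x = (g x \<bullet> e) *\<^sub>R ((a / (g x \<bullet> e)) *\<^sub>R normal_part A g x e - 2 *\<^sub>R mean_curvature A g x)"
      using positive[of x] by (simp add: force_def scaleR_diff_right mult.commute)
    then show ?thesis using positive[of x] by auto
  qed
  show ?thesis
  proof
    assume "energy_critical A a e g"
    then show "singular_minimal_surface A a e g"
      using force_eq_0 force_iff assms immersion positive by (simp add: singular_minimal_surface_def)
  next
    assume "singular_minimal_surface A a e g"
    then have "force x = 0" for x by (simp add: singular_minimal_surface_def force_iff)
    then show "energy_critical A a e g"
      unfolding energy_critical_def using first_variation_formula by simp
  qed
qed

end

theorem proposition7:
  fixes A :: "'a::{t2_space,second_countable_topology} chart set"
    and h :: "'a metric_coeffs"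
    and g :: "'a \<Rightarrow> real^'n"
    and e :: "real^'n"
    and a :: real
    and p :: nat
  assumes dim: "CARD('n) = p + 2"
    and surface: "smooth_surface A"
    and metric: "riemannian_metric A h"
    and isometric: "isometric_immersion A h g"
    and positive: "\<And>x. g x \<bullet> e > 0"
  shows "(\<forall>\<epsilon> K G. compact_variation A g \<epsilon> K G \<longrightarrow>
            ((\<lambda>t. energy_potential A a e K (G t)) has_real_derivative
               (LINT x|volume_measure A h.
                  (g x \<bullet> e) powr (a - 1) *
                  ((a *\<^sub>R normal_part A g x e - (2 * (g x \<bullet> e)) *\<^sub>R mean_curvature A g x)
                     \<bullet> normal_variation_field A G x)))
            (at 0)) \<and>
         (norm e = 1 \<longrightarrow>
            (energy_critical A a e g \<longleftrightarrow> singular_minimal_surface A a e g))"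
proof -
  interpret immersed_surface A g e a
    using surface isometric positive by unfold_locales (simp_all add: isometric_immersion_def)
  \<comment> \<open>From here on the given metric may be replaced by the one induced by
    \<open>g\<close>, for which the variation formula was derived.\<close>
  have "volume_measure A h = M"
    using isometric by (intro volume_measure_cong) (simp add: isometric_immersion_def)
  then show ?thesis
    using first_variation_formula critical_iff_singular_minimal by (simp add: force_def)
qed

end
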